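(* Assume $F^1,\dots,F^k$ and $a$ are real-analytic, and let $\beta>0$. Let $U:[0,+\infty)\to\mathcal{U}$ solve $\partial_tU_t=-\mathcal{G}^\beta[U_t]$, $U_0=u_0$, and let $u_\infty\in\mathcal{U}$ be any limiting point of $t\mapsto U_t$. Then $d_{u_\infty}\mathcal{F}^\beta=0$, and $u_\infty\in H^m([0,1],\mathbb{R}^k)$ for every integer $m\ge1$.
   Context: $F:\mathbb{R}^n\to\mathbb{R}^{n\times k}$ is globally Lipschitz with columns $F^1,\dots,F^k$; $x_0\in\mathbb{R}^n$ fixed; $\mathcal{U}=L^2([0,1],\mathbb{R}^k)$; $x_u$ solves $\dot x_u=F(x_u)u$, $x_u(0)=x_0$. $a:\mathbb{R}^n\to[0,\infty)$. $\mathcal{F}^\beta(u)=\frac12\|u\|_{L^2}^2+\beta a(x_u(1))$, $\mathcal{G}^\beta$ the Riesz representative of $d\mathcal{F}^\beta$. A limiting point is $u_\infty$ with $\|U_{t_j}-u_\infty\|_{L^2}\to0$ along some $t_j\to+\infty$. $H^m=W^{m,2}$. *)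

theory Defs
  imports "HOL-Analysis.Analysis"
begin

definition real_analytic :: "(real^'n \<Rightarrow> 'b::real_normed_vector) \<Rightarrow> bool" where
  "real_analytic f \<longleftrightarrow>
     (\<forall>x0. \<exists>r>0. \<exists>c :: ('n \<Rightarrow> nat) \<Rightarrow> 'b.
        \<forall>x\<in>ball x0 r.
          ((\<lambda>\<alpha>. (\<Prod>i\<in>UNIV. (x$i - x0$i) ^ (\<alpha> i)) *\<^sub>R c \<alpha>) has_sum f x) UNIV)"

text \<open>The control space L^2([0,1],R^k), represented by functions (a.e. classes).\<close>
definition L2 :: "(real \<Rightarrow> real^'k) set" where
  "L2 = {u. u \<in> borel_measurable (lebesgue_on {0..1}) \<and>
            integrable (lebesgue_on {0..1}) (\<lambda>s. (norm (u s))\<^sup>2)}"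

definition L2inner :: "(real \<Rightarrow> real^'k) \<Rightarrow> (real \<Rightarrow> real^'k) \<Rightarrow> real" where
  "L2inner u v = integral\<^sup>L (lebesgue_on {0..1}) (\<lambda>s. u s \<bullet> v s)"

definition L2norm :: "(real \<Rightarrow> real^'k) \<Rightarrow> real" where
  "L2norm u = sqrt (integral\<^sup>L (lebesgue_on {0..1}) (\<lambda>s. (norm (u s))\<^sup>2))"

text \<open>Endpoint x_u(1) of the (Caratheodory) solution of x' = F(x) u, x(0) = x0 on [0,1].\<close>
definition traj_end :: "(real^'n \<Rightarrow> real^'k^'n) \<Rightarrow> real^'n \<Rightarrow> (real \<Rightarrow> real^'k) \<Rightarrow> real^'n" where
  "traj_end F x0 u = (THE y. \<exists>x. continuous_on {0..1} x \<and>
       (\<forall>t\<in>{0..1}. ((\<lambda>s. F (x s) *v u s) has_integral (x t - x0)) {0..t}) \<and> x 1 = y)"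

definition cost :: "(real^'n \<Rightarrow> real^'k^'n) \<Rightarrow> real^'n \<Rightarrow> (real^'n \<Rightarrow> real) \<Rightarrow> real
                    \<Rightarrow> (real \<Rightarrow> real^'k) \<Rightarrow> real" where
  "cost F x0 a \<beta> u = (1/2) * (L2norm u)\<^sup>2 + \<beta> * a (traj_end F x0 u)"

definition has_L2_gradient :: "((real \<Rightarrow> real^'k) \<Rightarrow> real) \<Rightarrow> (real \<Rightarrow> real^'k) \<Rightarrow> (real \<Rightarrow> real^'k) \<Rightarrow> bool" where
  "has_L2_gradient J u g \<longleftrightarrow> g \<in> L2 \<and>
     (\<forall>\<epsilon>>0. \<exists>\<delta>>0. \<forall>v\<in>L2. L2norm v < \<delta> \<longrightarrow>
        \<bar>J (\<lambda>s. u s + v s) - J u - L2inner g v\<bar> \<le> \<epsilon> * L2norm v)"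

definition test_fun :: "(real \<Rightarrow> real) \<Rightarrow> bool" where
  "test_fun \<phi> \<longleftrightarrow> (\<forall>j x. ((deriv ^^ j) \<phi>) differentiable (at x)) \<and>
                   (\<exists>a b. 0 < a \<and> b < 1 \<and> (\<forall>x. x \<notin> {a..b} \<longrightarrow> \<phi> x = 0))"

definition sobolev_H :: "nat \<Rightarrow> (real \<Rightarrow> real^'k) set" where
  "sobolev_H m = {u. u \<in> L2 \<and> (\<exists>g :: nat \<Rightarrow> real \<Rightarrow> real^'k. g 0 = u \<and> (\<forall>j\<le>m. g j \<in> L2) \<and>
      (\<forall>j\<in>{1..m}. \<forall>\<phi>. test_fun \<phi> \<longrightarrow>
         integral\<^sup>L (lebesgue_on {0..1}) (\<lambda>s. (deriv ^^ j) \<phi> s *\<^sub>R u s)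
         = (-1) ^ j *\<^sub>R integral\<^sup>L (lebesgue_on {0..1}) (\<lambda>s. \<phi> s *\<^sub>R g j s)))}"

end

(*
  The cost is strictly differentiable at every control u: with x the trajectory of u and p the
  costate (the solution of the backward adjoint equation with final value grad a (x 1)),
    cost v - cost w - <u + beta F(x)^T p, v - w> = o(|v - w|)   as v, w -> u.
  In particular the L2 gradients are continuous at u, so near a non-critical limit point the flow
  would lose a fixed amount of cost in a fixed time infinitely often, contradicting the convergence
  of the monotone function t -> cost (U t). No Lojasiewicz inequality is needed. At the limit point
  u = - beta F(x)^T p almost everywhere, and bootstrapping in the ODE for (x, p) makes u smooth.
*)
theory Submission
  imports Defs
begin

section \<open>Real-analytic functions\<close>

text \<open>Controls are merely square integrable, so trajectories and costates are handled through
  integral equations until the very end. Exponential weights let every Picard and Gronwall estimate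
  work on all of \<open>{0..1}\<close> at once, with constants that depend on a control only through
  its \<open>L2norm\<close> and hence are uniform near a given control. The strict form of the
  expansion, with two moving controls, means that a costate has to be built at the limit point
  alone: at a nearby control, any L2 gradient is compared with the formula at the limit point by
  equating two expansions. Analyticity enters in two ways. Power series have continuous partial
  derivatives, which gives strict differentiability uniformly on bounded sets; and these partial
  derivatives are analytic again, which lets the final bootstrap run through all orders.\<close>

lemma has_derivative_has_sum:
  fixes f :: "'i::countable \<Rightarrow> 'a::real_normed_vector \<Rightarrow> real"
  assumes inf: "infinite (UNIV :: 'i set)"
    and S: "convex S"
    and der: "\<And>i x. x \<in> S \<Longrightarrow> (f i has_derivative f' i x) (at x within S)"
    and bnd: "\<And>i x h. x \<in> S \<Longrightarrow> \<bar>f' i x h\<bar> \<le> M i * norm h"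
    and M: "M summable_on UNIV"
    and sum: "\<And>x. x \<in> S \<Longrightarrow> ((\<lambda>i. f i x) has_sum g x) UNIV"
    and sum': "\<And>x h. x \<in> S \<Longrightarrow> ((\<lambda>i. f' i x h) has_sum g' x h) UNIV"
    and x: "x \<in> S"
  shows "(g has_derivative g' x) (at x within S)"
proof -
  \<comment> \<open>An enumeration of the index set turns the unordered sums into series, to which
    termwise differentiation applies.\<close>
  define e :: "nat \<Rightarrow> 'i" where "e = from_nat_into UNIV"
  have e: "bij_betw e UNIV UNIV"
    unfolding e_def using inf by (intro bij_betw_from_nat_into) auto
  have "((\<lambda>n. f (e n) x) has_sum g x) UNIV" if "x \<in> S" for x
    using sum[OF that] has_sum_reindex_bij_betw[OF e, of "\<lambda>i. f i x"] by simp
  hence s1: "(\<lambda>n. f (e n) x) sums g x" if "x \<in> S" for x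
    using that has_sum_imp_sums by blast
  have "((\<lambda>n. f' (e n) x h) has_sum g' x h) UNIV" if "x \<in> S" for x h
    using sum'[OF that] has_sum_reindex_bij_betw[OF e, of "\<lambda>i. f' i x h"] by simp
  hence s2: "(\<lambda>n. f' (e n) x h) sums g' x h" if "x \<in> S" for x h
    using that has_sum_imp_sums by blast
  have sM: "summable (\<lambda>n. M (e n))"
    using M summable_on_reindex_bij_betw[OF e, of M] summable_on_imp_summable by blast
  have "\<exists>h. \<forall>x\<in>S. (\<lambda>n. f (e n) x) sums h x \<and> (h has_derivative g' x) (at x within S)"
  proof (rule has_derivative_series[where f'="\<lambda>n. f' (e n)" and x=x and l="g x"])
    show "(f (e n) has_derivative f' (e n) x) (at x within S)" if "x \<in> S" for n x
      using der that by blast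
    show "convex S" "x \<in> S" "(\<lambda>n. f (e n) x) sums g x" using S x s1 by auto
    fix \<epsilon> :: real assume "\<epsilon> > 0"
    \<comment> \<open>The tail of the series of \<open>M\<close> bounds the error of the derivative
      for all \<open>x\<close> and \<open>h\<close> at once; this is the required uniform
      convergence.\<close>
    then obtain N where N: "\<And>n. n \<ge> N \<Longrightarrow> \<bar>\<Sum>i. M (e (i + n))\<bar> < \<epsilon>"
      using suminf_exist_split[OF _ sM] by (metis real_norm_def)
    have "\<bar>(\<Sum>i<n. f' (e i) x h) - g' x h\<bar> \<le> \<epsilon> * norm h" if n: "n \<ge> N" and xS: "x \<in> S" for n x h
    proof -
      have sh: "(\<lambda>i. f' (e (i + n)) x h) sums (g' x h - (\<Sum>i<n. f' (e i) x h))"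
        using sums_split_initial_segment[OF s2[OF xS]] by blast
      have sMh: "summable (\<lambda>i. M (e (i + n)) * norm h)"
        by (intro summable_mult2 summable_ignore_initial_segment sM)
      have "norm (\<Sum>i. f' (e (i + n)) x h) \<le> (\<Sum>i. M (e (i + n)) * norm h)"
        by (rule norm_suminf_le[OF _ sMh]) (use bnd xS in auto)
      also have "\<dots> = (\<Sum>i. M (e (i + n))) * norm h"
        by (rule suminf_mult2[symmetric]) (intro summable_ignore_initial_segment sM)
      also have "\<dots> \<le> \<epsilon> * norm h"
        using N[OF n] by (intro mult_right_mono) auto
      finally show ?thesis
        using sums_unique[OF sh] by simp
    qed
    then show "\<forall>\<^sub>F n in sequentially. \<forall>x\<in>S. \<forall>h. norm ((\<Sum>i<n. f' (e i) x h) - g' x h) \<le> \<epsilon> * norm h"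
      by (auto simp: eventually_sequentially)
  qed
  then obtain k where k: "\<And>x. x \<in> S \<Longrightarrow> (\<lambda>n. f (e n) x) sums k x"
    "(k has_derivative g' x) (at x within S)" using x by blast
  have "k y = g y" if "y \<in> S" for y
    using k(1)[OF that] s1[OF that] sums_unique2 by blast
  then show ?thesis
    using has_derivative_transform[OF x _ k(2), of g] by simp
qed

lemma has_sum_finite_sum:
  fixes f :: "'j \<Rightarrow> 'i \<Rightarrow> real"
  assumes "finite J" "\<And>j. j \<in> J \<Longrightarrow> (f j has_sum S j) A"
  shows "((\<lambda>i. \<Sum>j\<in>J. f j i) has_sum (\<Sum>j\<in>J. S j)) A"
  using assms by (induction J rule: finite_induct) (auto intro!: has_sum_add)

section \<open>Partial derivatives of real-analytic functions\<close>

lemma real_analytic_component: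
  fixes f :: "real^'n \<Rightarrow> real^'m"
  assumes "real_analytic f"
  shows "real_analytic (\<lambda>x. f x $ k)"
  unfolding real_analytic_def
proof
  fix x0
  obtain r c where r: "r > 0" and c: "\<forall>x\<in>ball x0 r.
          ((\<lambda>\<alpha>. (\<Prod>i\<in>UNIV. (x$i - x0$i) ^ (\<alpha> i)) *\<^sub>R c \<alpha>) has_sum f x) UNIV"
    using assms unfolding real_analytic_def by blast
  have "((\<lambda>\<alpha>. (\<Prod>i\<in>UNIV. (x$i - x0$i) ^ (\<alpha> i)) *\<^sub>R (c \<alpha> $ k)) has_sum f x $ k) UNIV"
    if "x \<in> ball x0 r" for x
    using has_sum_bounded_linear[OF bounded_linear_vec_nth[of k] bspec[OF c that]] by simp
  then show "\<exists>r>0. \<exists>c. \<forall>x\<in>ball x0 r.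
      ((\<lambda>\<alpha>. (\<Prod>i\<in>UNIV. (x$i - x0$i) ^ (\<alpha> i)) *\<^sub>R c \<alpha>) has_sum f x $ k) UNIV"
    using r by (intro exI[of _ r] conjI exI[of _ "\<lambda>\<alpha>. c \<alpha> $ k"]) auto
qed

text \<open>Termwise differentiation on a smaller ball. Each partial derivative comes with its own
  expansion about the same centre, so that the argument can be repeated for it.\<close>

lemma real_analytic_partial_local:
  fixes f :: "real^'n \<Rightarrow> real" and x0 :: "real^'n"
  assumes "real_analytic f"
  shows "\<exists>r>0. \<exists>S c. (\<forall>x\<in>ball x0 r. (f has_derivative (\<lambda>h. \<Sum>i\<in>UNIV. h $ i * S i x)) (at x)) \<and>
    (\<forall>i. \<forall>x\<in>ball x0 r. ((\<lambda>\<alpha>. (\<Prod>j\<in>UNIV. (x$j - x0$j) ^ (\<alpha> j)) *\<^sub>R c i \<alpha>) has_sum S i x) UNIV)"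
proof -
  obtain r c where r: "r > 0" and c: "\<And>x. x\<in>ball x0 r \<Longrightarrow>
          ((\<lambda>\<alpha>. (\<Prod>i\<in>UNIV. (x$i - x0$i) ^ (\<alpha> i)) * c \<alpha>) has_sum f x) UNIV"
    using assms[unfolded real_analytic_def, rule_format, of x0] unfolding real_scaleR_def by blast
  define n where "n = real CARD('n)"
  have n: "n > 0" "n \<ge> 1" unfolding n_def by (simp_all add: Suc_leI)
  \<comment> \<open>The corner point \<open>y\<close> below, with all coordinates shifted by \<rho>,
    has distance at most \<open>n * \<rho> = r / 2\<close> from the centre. The series therefore
    converges there, and an unordered sum of reals converges absolutely.\<close>
  define \<rho> where "\<rho> = r / (2 * n)"
  have \<rho>: "\<rho> > 0" unfolding \<rho>_def using r n by simp
  have \<rho>r: "\<rho> / 2 < r" "n * \<rho> < r" unfolding \<rho>_def using r n by (auto simp: field_simps)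
  let ?B = "ball x0 (\<rho>/2)"
  \<comment> \<open>Differentiation removes one factor of size \<rho>, whence the quotient; the
    factor \<open>\<alpha> i\<close> that it produces is paid for by halving the radius.\<close>
  define M where "M \<alpha> = \<bar>c \<alpha>\<bar> * (\<Prod>j\<in>UNIV. \<rho> ^ \<alpha> j) / \<rho>" for \<alpha> :: "'n \<Rightarrow> nat"
  have M0: "M \<alpha> \<ge> 0" for \<alpha>
    unfolding M_def using \<rho> by (simp add: prod_nonneg)
  define y where "y = x0 + (\<chi> i. \<rho>)"
  have "norm (y - x0) \<le> (\<Sum>i\<in>UNIV. \<bar>(y - x0) $ i\<bar>)" by (rule norm_le_l1_cart)
  also have "\<dots> = n * \<rho>" unfolding y_def n_def using \<rho> by simp
  finally have "y \<in> ball x0 r" using \<rho>r by (simp add: dist_norm norm_minus_commute)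
  from c[OF this] have "(\<lambda>\<alpha>. (\<Prod>i\<in>UNIV. \<rho> ^ (\<alpha> i)) * c \<alpha>) summable_on UNIV"
    unfolding y_def by (auto simp: summable_on_def)
  hence "(\<lambda>\<alpha>. \<bar>(\<Prod>i\<in>UNIV. \<rho> ^ (\<alpha> i)) * c \<alpha>\<bar>) summable_on UNIV"
    using summable_on_iff_abs_summable_on_real[of "\<lambda>\<alpha>. (\<Prod>i\<in>UNIV. \<rho> ^ (\<alpha> i)) * c \<alpha>"] by simp
  hence "(\<lambda>\<alpha>. \<bar>(\<Prod>i\<in>UNIV. \<rho> ^ (\<alpha> i)) * c \<alpha>\<bar> * (1/\<rho>)) summable_on UNIV"
    by (rule summable_on_cmult_left)
  hence sM: "M summable_on UNIV"
    unfolding M_def using \<rho> by (simp add: abs_mult abs_prod mult.commute prod_nonneg)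
  define T where "T \<alpha> i x = c \<alpha> * (real (\<alpha> i) * (x$i - x0$i) ^ (\<alpha> i - 1) *
      (\<Prod>j\<in>UNIV-{i}. (x$j - x0$j) ^ \<alpha> j))" for \<alpha> i x
  have Tb: "\<bar>T \<alpha> i x\<bar> \<le> M \<alpha>" if x: "x \<in> ?B" for \<alpha> i x
  proof -
    have xb: "\<bar>x$j - x0$j\<bar> \<le> \<rho>/2" for j
      using component_le_norm_cart[of "x - x0" j] x by (simp add: dist_norm norm_minus_commute)
    have "\<bar>real (\<alpha> i) * (x$i - x0$i) ^ (\<alpha> i - 1)\<bar> \<le> real (\<alpha> i) * (\<rho>/2) ^ (\<alpha> i - 1)"
      unfolding abs_mult power_abs using xb by (auto intro!: mult_left_mono power_mono)
    \<comment> \<open>The bound \<open>k \<le> 2 ^ (k - 1)\<close> absorbs the exponent; truncated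
      subtraction makes it valid for \<open>k = 0\<close> too.\<close>
    also have "\<dots> \<le> 2 ^ (\<alpha> i - 1) * (\<rho>/2) ^ (\<alpha> i - 1)"
    proof -
      have "\<alpha> i \<le> 2 ^ (\<alpha> i - 1)"
        by (cases "\<alpha> i") (auto simp: Suc_leI)
      hence "real (\<alpha> i) \<le> 2 ^ (\<alpha> i - 1)"
        by (metis of_nat_le_iff of_nat_numeral of_nat_power)
      then show ?thesis using \<rho> by (intro mult_right_mono) auto
    qed
    also have "\<dots> = \<rho> ^ (\<alpha> i - 1)" by (simp flip: power_mult_distrib)
    finally have 1: "\<bar>real (\<alpha> i) * (x$i - x0$i) ^ (\<alpha> i - 1)\<bar> \<le> \<rho> ^ (\<alpha> i - 1)" .
    have 2: "\<bar>\<Prod>j\<in>UNIV-{i}. (x$j - x0$j) ^ \<alpha> j\<bar> \<le> (\<Prod>j\<in>UNIV-{i}. \<rho> ^ \<alpha> j)"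
      unfolding abs_prod power_abs
      by (rule prod_mono) (use xb \<rho> in \<open>auto intro!: power_mono order_trans[OF xb]\<close>)
    have P: "(\<Prod>j\<in>UNIV. \<rho> ^ \<alpha> j) = \<rho> ^ \<alpha> i * (\<Prod>j\<in>UNIV-{i}. \<rho> ^ \<alpha> j)"
      by (simp add: prod.remove)
    show ?thesis
    proof (cases "\<alpha> i = 0")
      case True
      then show ?thesis using M0 by (simp add: T_def)
    next
      case False
      have "\<bar>T \<alpha> i x\<bar> \<le> \<bar>c \<alpha>\<bar> * (\<rho> ^ (\<alpha> i - 1) * (\<Prod>j\<in>UNIV-{i}. \<rho> ^ \<alpha> j))"
        unfolding T_def abs_mult[of "c \<alpha>"] abs_mult[of "real (\<alpha> i) * (x$i - x0$i) ^ (\<alpha> i - 1)"]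
        by (intro mult_left_mono mult_mono 1 2) (use \<rho> in auto)
      also have "\<rho> ^ (\<alpha> i - 1) = \<rho> ^ \<alpha> i / \<rho>"
        using False \<rho> by (cases "\<alpha> i") auto
      finally show ?thesis unfolding M_def P by simp
    qed
  qed
  have absT: "(\<lambda>\<alpha>. T \<alpha> i x) summable_on UNIV" if "x \<in> ?B" for i x
  proof (rule abs_summable_summable[where f="\<lambda>\<alpha>. T \<alpha> i x"], rule Infinite_Sum.abs_summable_on_comparison_test'[OF sM])
    fix \<alpha> show "norm (T \<alpha> i x) \<le> M \<alpha>" using Tb[OF that] by simp
  qed
  define S where "S i x = infsum (\<lambda>\<alpha>. T \<alpha> i x) UNIV" for i x
  have S: "((\<lambda>\<alpha>. T \<alpha> i x) has_sum S i x) UNIV" if "x \<in> ?B" for i x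
    unfolding S_def using absT[OF that] by (rule has_sum_infsum)
  have inf: "infinite (UNIV :: ('n \<Rightarrow> nat) set)"
  proof
    assume "finite (UNIV :: ('n \<Rightarrow> nat) set)"
    hence "finite (range (\<lambda>(k::nat) (i::'n). k))" by (rule rev_finite_subset) simp
    moreover have "inj (\<lambda>(k::nat) (i::'n). k)" by (auto simp: inj_on_def fun_eq_iff)
    ultimately show False using finite_imageD infinite_UNIV_nat by blast
  qed
  have der: "((\<lambda>x. (\<Prod>i\<in>UNIV. (x$i - x0$i) ^ (\<alpha> i)) * c \<alpha>) has_derivative
     (\<lambda>h. \<Sum>i\<in>UNIV. h $ i * T \<alpha> i x)) (at x within ?B)" for \<alpha> x
  proof -
    have "((\<lambda>x. (\<Prod>i\<in>UNIV. (x$i - x0$i) ^ (\<alpha> i)) * c \<alpha>) has_derivative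
      (\<lambda>h. (\<Sum>i\<in>UNIV. (real (\<alpha> i) * h$i * (x$i - x0$i) ^ (\<alpha> i - 1)) *
      (\<Prod>j\<in>UNIV-{i}. (x$j - x0$j) ^ \<alpha> j)) * c \<alpha>)) (at x within ?B)"
      by (rule derivative_eq_intros refl bounded_linear.has_derivative[OF bounded_linear_vec_nth] | simp)+
    then show ?thesis
      unfolding T_def by (simp add: sum_distrib_left mult_ac)
  qed
  have "(f has_derivative (\<lambda>h. \<Sum>i\<in>UNIV. h $ i * S i x)) (at x within ?B)" if x: "x \<in> ?B" for x
  proof (rule has_derivative_has_sum[OF inf convex_ball der _ _ _ _ x])
    show "(\<lambda>\<alpha>. n * M \<alpha>) summable_on UNIV" by (rule summable_on_cmult_right[OF sM])
    fix \<alpha> x and h :: "real^'n" assume x: "x \<in> ?B"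
    have "\<bar>\<Sum>i\<in>UNIV. h $ i * T \<alpha> i x\<bar> \<le> (\<Sum>i\<in>(UNIV::'n set). norm h * M \<alpha>)"
    proof (rule order_trans[OF sum_abs], rule sum_mono)
      fix i
      show "\<bar>h $ i * T \<alpha> i x\<bar> \<le> norm h * M \<alpha>"
        unfolding abs_mult by (intro mult_mono Tb[OF x] component_le_norm_cart) auto
    qed
    also have "\<dots> = n * M \<alpha> * norm h" unfolding n_def by simp
    finally show "\<bar>\<Sum>i\<in>UNIV. h $ i * T \<alpha> i x\<bar> \<le> n * M \<alpha> * norm h" .
  next
    fix x assume "x \<in> ?B"
    then show "((\<lambda>\<alpha>. (\<Prod>i\<in>UNIV. (x$i - x0$i) ^ (\<alpha> i)) * c \<alpha>) has_sum f x) UNIV"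
      using c \<rho>r by auto
  next
    fix x h assume "x \<in> ?B"
    then show "((\<lambda>\<alpha>. \<Sum>i\<in>UNIV. h $ i * T \<alpha> i x) has_sum (\<Sum>i\<in>UNIV. h $ i * S i x)) UNIV"
      by (intro has_sum_finite_sum has_sum_cmult_right S) auto
  qed
  hence D: "(f has_derivative (\<lambda>h. \<Sum>i\<in>UNIV. h $ i * S i x)) (at x)" if "x \<in> ?B" for x
    unfolding at_within_open[OF that open_ball, symmetric] using that by blast
  \<comment> \<open>Coefficients of the differentiated series: the monomial with exponent \<beta>
    comes from the one whose \<open>i\<close>-th exponent is larger by one. Terms with
    \<open>\<alpha> i = 0\<close> vanish, so the sum may be restricted to the range of this
    shift.\<close>
  define c' where "c' i \<beta> = c (\<beta>(i := Suc (\<beta> i))) * real (Suc (\<beta> i))" for i \<beta>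
  have "((\<lambda>\<beta>. (\<Prod>j\<in>UNIV. (x$j - x0$j) ^ (\<beta> j)) *\<^sub>R c' i \<beta>) has_sum S i x) UNIV" if x: "x \<in> ?B" for i x
  proof -
    define s where "s \<beta> = \<beta>(i := Suc (\<beta> i))" for \<beta> :: "'n \<Rightarrow> nat"
    have inj: "inj s"
    proof (rule injI)
      fix a b assume "s a = s b"
      hence *: "s a j = s b j" for j by simp
      show "a = b"
      proof
        show "a j = b j" for j using *[of j] by (cases "j = i") (auto simp: s_def)
      qed
    qed
    have T0: "T \<alpha> i x = 0" if "\<alpha> \<notin> range s" for \<alpha>
    proof -
      have "\<alpha> i = 0"
      proof (rule ccontr)
        assume "\<alpha> i \<noteq> 0"
        hence "\<alpha> = s (\<alpha>(i := \<alpha> i - 1))" unfolding s_def by auto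
        then show False using that by blast
      qed
      then show ?thesis by (simp add: T_def)
    qed
    have "((\<lambda>\<alpha>. T \<alpha> i x) has_sum S i x) (range s)"
      using S[OF x, of i] has_sum_cong_neutral[of UNIV "range s" "\<lambda>\<alpha>. T \<alpha> i x" "\<lambda>\<alpha>. T \<alpha> i x"] T0
      by auto
    hence "((\<lambda>\<beta>. T (s \<beta>) i x) has_sum S i x) UNIV"
      using has_sum_reindex[OF inj, of "\<lambda>\<alpha>. T \<alpha> i x"] by (simp add: o_def)
    moreover have "T (s \<beta>) i x = (\<Prod>j\<in>UNIV. (x$j - x0$j) ^ (\<beta> j)) *\<^sub>R c' i \<beta>" for \<beta>
    proof -
      have "(\<Prod>j\<in>UNIV-{i}. (x$j - x0$j) ^ s \<beta> j) = (\<Prod>j\<in>UNIV-{i}. (x$j - x0$j) ^ \<beta> j)"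
        by (rule prod.cong) (auto simp: s_def)
      moreover have "(\<Prod>j\<in>UNIV. (x$j - x0$j) ^ \<beta> j) = (x$i - x0$i) ^ \<beta> i * (\<Prod>j\<in>UNIV-{i}. (x$j - x0$j) ^ \<beta> j)"
        by (simp add: prod.remove)
      ultimately show ?thesis
        unfolding T_def c'_def by (simp add: s_def)
    qed
    ultimately show ?thesis by simp
  qed
  then show ?thesis
    using D \<rho> by (intro exI[of _ "\<rho>/2"] conjI exI[of _ S] exI[of _ c']) auto
qed

text \<open>Derivatives are unique, so the local expansions around different centres agree on the
  partial derivatives. Iteration gives derivatives of every order.\<close>

lemma real_analytic_partials:
  fixes f :: "real^'n \<Rightarrow> real"
  assumes "real_analytic f"
  shows "\<exists>D. (\<forall>x. (f has_derivative (\<lambda>h. \<Sum>i\<in>UNIV. h $ i * D i x)) (at x)) \<and>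
             (\<forall>i. real_analytic (D i))"
proof -
  have "\<exists>d. (f has_derivative (\<lambda>h. \<Sum>i\<in>UNIV. h $ i * d i)) (at x)" for x
  proof -
    obtain r S where "r > 0" "\<forall>y\<in>ball x r. (f has_derivative (\<lambda>h. \<Sum>i\<in>UNIV. h $ i * S i y)) (at y)"
      using real_analytic_partial_local[OF assms, of x] by blast
    then show ?thesis by (intro exI[of _ "\<lambda>i. S i x"]) simp
  qed
  then obtain d where d: "\<And>x. (f has_derivative (\<lambda>h. \<Sum>i\<in>UNIV. h $ i * d x i)) (at x)" by metis
  have "real_analytic (\<lambda>x. d x i)" for i
    unfolding real_analytic_def
  proof
    fix x0
    obtain r S c where r: "r > 0"
      and S: "\<And>x. x\<in>ball x0 r \<Longrightarrow> (f has_derivative (\<lambda>h. \<Sum>i\<in>UNIV. h $ i * S i x)) (at x)"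
      and c: "\<And>i x. x\<in>ball x0 r \<Longrightarrow> ((\<lambda>\<alpha>. (\<Prod>j\<in>UNIV. (x$j - x0$j) ^ (\<alpha> j)) *\<^sub>R c i \<alpha>) has_sum S i x) UNIV"
      using real_analytic_partial_local[OF assms, of x0] by blast
    have "d x i = S i x" if "x \<in> ball x0 r" for x
    proof -
      have "(\<Sum>j\<in>UNIV. axis i 1 $ j * d x j) = (\<Sum>j\<in>UNIV. axis i 1 $ j * S j x)"
        using has_derivative_unique[OF d S[OF that]] by meson
      then show ?thesis by (simp add: axis_def if_distrib[of "\<lambda>z. z * _"] sum.delta cong: if_cong)
    qed
    then show "\<exists>r>0. \<exists>c. \<forall>x\<in>ball x0 r.
          ((\<lambda>\<alpha>. (\<Prod>i\<in>UNIV. (x$i - x0$i) ^ (\<alpha> i)) *\<^sub>R c \<alpha>) has_sum d x i) UNIV"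
      using r c by (intro exI[of _ r] conjI exI[of _ "c i"]) auto
  qed
  then show ?thesis using d by (intro exI[of _ "\<lambda>i x. d x i"]) auto
qed

lemma real_analytic_continuous:
  fixes f :: "real^'n \<Rightarrow> real"
  assumes "real_analytic f"
  shows "continuous_on S f"
proof -
  obtain D where "\<And>x. (f has_derivative (\<lambda>h. \<Sum>i\<in>UNIV. h $ i * D i x)) (at x)"
    using real_analytic_partials[OF assms] by blast
  then show ?thesis
    by (intro continuous_at_imp_continuous_on ballI has_derivative_continuous)
qed

section \<open>Kernels in L2\<close>

text \<open>Cauchy-Schwarz for gauge integrals: integrating
  \<open>(a * f s - b * g s)\<^sup>2\<close> gives a nonnegative quadratic form in \<open>a\<close>
  and \<open>b\<close>, whose coefficients then satisfy the discriminant inequality.\<close>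

lemma integral_mult_le_sqrt:
  fixes f g :: "real \<Rightarrow> real"
  assumes f: "(\<lambda>s. (f s)\<^sup>2) integrable_on S" and g: "(\<lambda>s. (g s)\<^sup>2) integrable_on S"
    and fg: "(\<lambda>s. f s * g s) integrable_on S"
  shows "integral S (\<lambda>s. f s * g s) \<le> sqrt (integral S (\<lambda>s. (f s)\<^sup>2)) * sqrt (integral S (\<lambda>s. (g s)\<^sup>2))"
proof -
  let ?A = "integral S (\<lambda>s. (f s)\<^sup>2)" and ?B = "integral S (\<lambda>s. (g s)\<^sup>2)" and ?C = "integral S (\<lambda>s. f s * g s)"
  have A0: "?A \<ge> 0" and B0: "?B \<ge> 0" using f g by (auto intro!: integral_nonneg)
  have q: "0 \<le> a\<^sup>2 * ?A + b\<^sup>2 * ?B - 2 * a * b * ?C" for a b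
  proof -
    have "0 \<le> integral S (\<lambda>s. (a * f s - b * g s)\<^sup>2)"
    proof (rule integral_nonneg)
      have "(\<lambda>s. a\<^sup>2 * (f s)\<^sup>2 + b\<^sup>2 * (g s)\<^sup>2 - (2 * a * b) * (f s * g s)) integrable_on S"
        by (intro integrable_diff integrable_add integrable_on_mult_right f g fg)
      then show "(\<lambda>s. (a * f s - b * g s)\<^sup>2) integrable_on S"
        by (simp add: power2_eq_square algebra_simps)
    qed simp
    also have "(\<lambda>s. (a * f s - b * g s)\<^sup>2) = (\<lambda>s. a\<^sup>2 * (f s)\<^sup>2 + b\<^sup>2 * (g s)\<^sup>2 - (2 * a * b) * (f s * g s))"
      by (simp add: power2_eq_square algebra_simps)
    also have "integral S \<dots> = a\<^sup>2 * ?A + b\<^sup>2 * ?B - 2 * a * b * ?C"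
      by (subst integral_diff integral_add, intro integrable_add integrable_on_mult_right f g fg,
          intro integrable_on_mult_right f g fg)+
         (simp add: integral_mult_right)
    finally show ?thesis .
  qed
  have "?C\<^sup>2 \<le> ?A * ?B"
  proof (cases "?B = 0")
    case True
    have "?C = 0"
    proof (rule ccontr)
      assume C: "?C \<noteq> 0"
      \<comment> \<open>With \<open>?B = 0\<close> the form is affine in the second coefficient, and
        this coefficient gives it the value \<open>-1\<close>.\<close>
      have "0 \<le> ?A - 2 * ((?A + 1) / (2 * ?C)) * ?C"
        using q[of 1 "(?A+1)/(2 * ?C)"] True by simp
      also have "\<dots> = -1" using C by (simp add: field_simps)
      finally show False by simp
    qed
    then show ?thesis using A0 B0 by simp
  next
    case False
    hence "?B > 0" using B0 by simp
    have "0 \<le> ?B\<^sup>2 * ?A + ?C\<^sup>2 * ?B - 2 * ?B * ?C * ?C" by (rule q)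
    also have "\<dots> = ?B * (?A * ?B - ?C\<^sup>2)" by (simp add: power2_eq_square algebra_simps)
    finally show ?thesis using \<open>?B > 0\<close> by (simp add: zero_le_mult_iff)
  qed
  hence "sqrt (?C\<^sup>2) \<le> sqrt (?A * ?B)" by (rule real_sqrt_le_mono)
  then show ?thesis by (simp add: real_sqrt_mult)
qed

lemma has_integral_exp_mult:
  fixes a b K :: real
  assumes "a \<le> b" "K > 0"
  shows "((\<lambda>s. exp (K * s)) has_integral (exp (K * b) - exp (K * a)) / K) {a..b}"
proof -
  have "((\<lambda>s. exp (K * s)) has_integral (exp (K * b) / K - exp (K * a) / K)) {a..b}"
    using assms by (intro fundamental_theorem_of_calculus)
      (auto intro!: derivative_eq_intros simp: has_real_derivative_iff_has_vector_derivative[symmetric])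
  then show ?thesis by (simp add: diff_divide_distrib)
qed

text \<open>The weight \<open>exp (K s)\<close> is chosen so that integration against an \<open>L\<^sup>2\<close> kernel
  contracts once \<open>K\<close> is large.\<close>

lemma integral_kernel_exp_le:
  fixes h :: "real \<Rightarrow> real"
  assumes h0: "\<And>s. s \<in> {0..1} \<Longrightarrow> h s \<ge> 0"
    and hi: "h integrable_on {0..1}" and h2: "(\<lambda>s. (h s)\<^sup>2) integrable_on {0..1}"
    and R: "integral {0..1} (\<lambda>s. (h s)\<^sup>2) \<le> R\<^sup>2" "R \<ge> 0"
    and K: "K \<ge> 2 * R\<^sup>2" "K > 0" and t: "t \<in> {0..1}"
  shows "(\<lambda>s. h s * exp (K * s)) integrable_on {0..t}"
    and "integral {0..t} (\<lambda>s. h s * exp (K * s)) \<le> exp (K * t) / 2"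
    and "(\<lambda>s. h s * exp (- K * s)) integrable_on {t..1}"
    and "integral {t..1} (\<lambda>s. h s * exp (- K * s)) \<le> exp (- K * t) / 2"
proof -
  have ha: "h absolutely_integrable_on {0..1}"
    using hi h0 by (rule nonnegative_absolutely_integrable_1)
  have prod: "(\<lambda>s. exp (c * s) * h s) integrable_on {0..1}" for c
  proof -
    have "(\<lambda>s. exp (c * s) * h s) absolutely_integrable_on {0..1}"
    proof (rule absolutely_integrable_bounded_measurable_product_real[OF _ _ _ ha])
      show "bounded ((\<lambda>s. exp (c * s)) ` {0..1})"
        by (intro compact_imp_bounded compact_continuous_image continuous_intros) auto
      show "(\<lambda>s. exp (c * s)) \<in> borel_measurable (lebesgue_on {0..1})"
        by (intro continuous_imp_measurable_on_sets_lebesgue continuous_intros) auto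
    qed auto
    then show ?thesis using set_lebesgue_integral_eq_integral(1) by blast
  qed
  have sub: "{0..t} \<subseteq> {0..1}" "{t..1} \<subseteq> {0..1}" using t by auto
  show 1: "(\<lambda>s. h s * exp (K * s)) integrable_on {0..t}"
    using integrable_on_subinterval[OF prod[of K] sub(1)] by (simp add: mult.commute)
  show 2: "(\<lambda>s. h s * exp (- K * s)) integrable_on {t..1}"
    using integrable_on_subinterval[OF prod[of "-K"] sub(2)] by (simp add: mult.commute)
  \<comment> \<open>Both directions at once: \<open>c = K\<close> on \<open>{0..t}\<close> and
    \<open>c = - K\<close> on \<open>{t..1}\<close>. In either case \<open>d = t\<close> is the end
    at which the weight is largest.\<close>
  have main: "integral {a..b} (\<lambda>s. h s * exp (c * s)) \<le> exp (c * d) / 2"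
    if ab: "{a..b} \<subseteq> {0..1}" "a \<le> b" and i: "(\<lambda>s. h s * exp (c * s)) integrable_on {a..b}"
      and I: "((\<lambda>s. exp (2 * c * s)) has_integral I) {a..b}" "I \<le> exp (2 * c * d) / (2 * K)" for a b c d I
  proof -
    have e2: "(exp (c * s))\<^sup>2 = exp (2 * c * s)" for s :: real
      by (simp add: power2_eq_square flip: exp_add)
    have "integral {a..b} (\<lambda>s. h s * exp (c * s))
       \<le> sqrt (integral {a..b} (\<lambda>s. (h s)\<^sup>2)) * sqrt (integral {a..b} (\<lambda>s. (exp (c * s))\<^sup>2))"
    proof (rule integral_mult_le_sqrt[OF _ _ i])
      show "(\<lambda>s. (h s)\<^sup>2) integrable_on {a..b}" using integrable_on_subinterval[OF h2 ab(1)] .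
      show "(\<lambda>s. (exp (c * s))\<^sup>2) integrable_on {a..b}" using I e2 by auto
    qed
    also have "\<dots> \<le> R * sqrt (exp (2 * c * d) / (2 * K))"
    proof (rule mult_mono)
      have "integral {a..b} (\<lambda>s. (h s)\<^sup>2) \<le> integral {0..1} (\<lambda>s. (h s)\<^sup>2)"
        using ab h2 by (intro integral_subset_le integrable_on_subinterval[OF h2]) auto
      also note R(1)
      finally show "sqrt (integral {a..b} (\<lambda>s. (h s)\<^sup>2)) \<le> R" using R(2) by (simp add: real_le_lsqrt)
      show "sqrt (integral {a..b} (\<lambda>s. (exp (c * s))\<^sup>2)) \<le> sqrt (exp (2 * c * d) / (2 * K))"
        using I by (simp add: e2 integral_unique)
      show "0 \<le> R" by (rule R)
      show "0 \<le> sqrt (integral {a..b} (\<lambda>s. (exp (c * s))\<^sup>2))"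
        using I(1) e2 by (auto intro!: integral_nonneg)
    qed
    also have "\<dots> = (R / sqrt (2 * K)) * exp (c * d)"
      by (simp add: real_sqrt_divide e2[of d, symmetric])
    also have "\<dots> \<le> (1/2) * exp (c * d)"
    proof (rule mult_right_mono)
      \<comment> \<open>The size of \<open>K\<close> is chosen for this line:
        \<open>4 * R\<^sup>2 \<le> 2 * K\<close>.\<close>
      have "2 * R \<le> sqrt (2 * K)"
        using K R by (intro real_le_rsqrt) (simp add: power2_eq_square)
      then show "R / sqrt (2 * K) \<le> 1 / 2" using K by (simp add: field_simps)
    qed simp
    finally show ?thesis by simp
  qed
  show "integral {0..t} (\<lambda>s. h s * exp (K * s)) \<le> exp (K * t) / 2"
  proof (rule main[OF sub(1) _ 1])
    show "((\<lambda>s. exp (2 * K * s)) has_integral (exp (2 * K * t) - exp (2 * K * 0)) / (2 * K)) {0..t}"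
      using has_integral_exp_mult[of 0 t "2 * K"] t K by auto
    show "(exp (2 * K * t) - exp (2 * K * 0)) / (2 * K) \<le> exp (2 * K * t) / (2 * K)"
      using K by (intro divide_right_mono) auto
  qed (use t in auto)
  show "integral {t..1} (\<lambda>s. h s * exp (- K * s)) \<le> exp (- K * t) / 2"
  proof (rule main[OF sub(2) _ 2])
    show "((\<lambda>s. exp (2 * - K * s)) has_integral (exp (2 * - K * t) - exp (2 * - K * 1)) / (2 * K)) {t..1}"
    proof -
      have "((\<lambda>s. exp (2 * - K * s)) has_integral (exp (2 * - K * 1) / (2 * -K) - exp (2 * - K * t) / (2 * -K))) {t..1}"
        using K t by (intro fundamental_theorem_of_calculus)
          (auto intro!: derivative_eq_intros simp: has_real_derivative_iff_has_vector_derivative[symmetric])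
      then show ?thesis by (simp add: diff_divide_distrib)
    qed
    show "(exp (2 * - K * t) - exp (2 * - K * 1)) / (2 * K) \<le> exp (2 * - K * t) / (2 * K)"
      using K by (intro divide_right_mono) auto
  qed (use t in auto)
qed

text \<open>The inequality is evaluated where \<open>exp (- K * s) * norm (z s)\<close> is maximal;
  there the kernel integral is at most half of the left-hand side and can be absorbed. The kernel
  enters the bound only through \<open>R\<close>, which makes the estimate uniform over bounded sets
  of controls.\<close>

lemma gronwall_L2_kernel:
  fixes z :: "real \<Rightarrow> 'a::real_normed_vector" and h :: "real \<Rightarrow> real"
  assumes z: "continuous_on {0..1} z"
    and h0: "\<And>s. s \<in> {0..1} \<Longrightarrow> h s \<ge> 0"
    and hi: "h integrable_on {0..1}" and h2: "(\<lambda>s. (h s)\<^sup>2) integrable_on {0..1}"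
    and R: "integral {0..1} (\<lambda>s. (h s)\<^sup>2) \<le> R\<^sup>2" "R \<ge> 0"
    and bnd: "\<And>t. t \<in> {0..1} \<Longrightarrow> norm (z t) \<le> A + integral {0..t} (\<lambda>s. h s * norm (z s))"
    and A: "A \<ge> 0" and t: "t \<in> {0..1}"
  shows "norm (z t) \<le> 2 * A * exp (2 * R\<^sup>2 + 1)"
proof -
  \<comment> \<open>The summand one keeps \<open>K\<close> positive when
    \<open>R = 0\<close>.\<close>
  define K where "K = 2 * R\<^sup>2 + 1"
  have K: "K \<ge> 2 * R\<^sup>2" "K > 0" unfolding K_def by (auto intro: add_nonneg_pos)
  have ha: "h absolutely_integrable_on {0..1}"
    using hi h0 by (rule nonnegative_absolutely_integrable_1)
  have "continuous_on {0..1} (\<lambda>s. exp (- K * s) * norm (z s))"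
    by (intro continuous_intros z)
  then obtain r where r: "r \<in> {0..1}" and rmax: "\<And>s. s \<in> {0..1} \<Longrightarrow> exp (- K * s) * norm (z s) \<le> exp (- K * r) * norm (z r)"
    using continuous_attains_sup[of "{0..1::real}" "\<lambda>s. exp (- K * s) * norm (z s)"] by auto
  define M where "M = exp (- K * r) * norm (z r)"
  have zM: "norm (z s) \<le> M * exp (K * s)" if "s \<in> {0..1}" for s
    using rmax[OF that] unfolding M_def[symmetric] by (simp add: exp_minus field_simps)
  have zr: "norm (z r) = M * exp (K * r)" unfolding M_def by (simp add: exp_minus field_simps)
  have hz: "(\<lambda>s. norm (z s) * h s) integrable_on {0..1}"
  proof -
    have "(\<lambda>s. norm (z s) * h s) absolutely_integrable_on {0..1}"
    proof (rule absolutely_integrable_bounded_measurable_product_real[OF _ _ _ ha])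
      show "bounded ((\<lambda>s. norm (z s)) ` {0..1})"
        by (intro compact_imp_bounded compact_continuous_image continuous_intros z) auto
      show "(\<lambda>s. norm (z s)) \<in> borel_measurable (lebesgue_on {0..1})"
        by (intro continuous_imp_measurable_on_sets_lebesgue continuous_intros z) auto
    qed auto
    then show ?thesis using set_lebesgue_integral_eq_integral(1) by blast
  qed
  have "norm (z r) \<le> A + integral {0..r} (\<lambda>s. h s * norm (z s))" using bnd r by blast
  also have "integral {0..r} (\<lambda>s. h s * norm (z s)) \<le> integral {0..r} (\<lambda>s. M * (h s * exp (K * s)))"
  proof (rule integral_le)
    show "(\<lambda>s. h s * norm (z s)) integrable_on {0..r}"
      using integrable_on_subinterval[OF hz, of 0 r] r by (simp add: mult.commute)
    show "(\<lambda>s. M * (h s * exp (K * s))) integrable_on {0..r}"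
      by (intro integrable_on_mult_right integral_kernel_exp_le(1)[OF h0 hi h2 R K r])
    fix s assume "s \<in> {0..r}"
    hence s: "s \<in> {0..1}" using r by auto
    show "h s * norm (z s) \<le> M * (h s * exp (K * s))"
      using mult_left_mono[OF zM[OF s] h0[OF s]] by (simp add: mult_ac)
  qed
  also have "\<dots> = M * integral {0..r} (\<lambda>s. h s * exp (K * s))" by simp
  also have "\<dots> \<le> M * (exp (K * r) / 2)"
    by (intro mult_left_mono integral_kernel_exp_le(2)[OF h0 hi h2 R K r]) (auto simp: M_def)
  finally have 1: "M * exp (K * r) \<le> 2 * A" unfolding zr by simp
  have "M \<le> M * exp (K * r)"
    using K r mult_left_mono[of 1 "exp (K * r)" M] by (simp add: M_def)
  with 1 have M: "M \<le> 2 * A" by simp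
  have "norm (z t) \<le> M * exp (K * t)" using zM t by blast
  also have "\<dots> \<le> (2 * A) * exp K"
    using M A K t by (intro mult_mono) (auto simp: mult_le_cancel_left1)
  finally show ?thesis unfolding K_def .
qed

text \<open>The Banach fixed point theorem in a weighted supremum norm with contraction factor one
  half. The weight stays general because the state equation needs an increasing exponential and the
  backward costate equation a decreasing one.\<close>

lemma weighted_contraction_fixpoint:
  fixes T :: "(real \<Rightarrow> 'a::euclidean_space) \<Rightarrow> real \<Rightarrow> 'a" and w :: "real \<Rightarrow> real"
  assumes w: "continuous_on {0..1} w" "\<And>t. t \<in> {0..1} \<Longrightarrow> w t > 0"
    and cont: "\<And>x. continuous_on {0..1} x \<Longrightarrow> continuous_on {0..1} (T x)"
    and contr: "\<And>x y M t. continuous_on {0..1} x \<Longrightarrow> continuous_on {0..1} y \<Longrightarrow> M \<ge> 0 \<Longrightarrow>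
      (\<And>s. s \<in> {0..1} \<Longrightarrow> norm (x s - y s) \<le> M * w s) \<Longrightarrow> t \<in> {0..1} \<Longrightarrow>
      norm (T x t - T y t) \<le> M * (w t / 2)"
  shows "\<exists>x. continuous_on {0..1} x \<and> (\<forall>t\<in>{0..1}. x t = T x t)"
proof -
  \<comment> \<open>Clamping time to \<open>{0..1}\<close> extends functions to the whole line, as
    bounded continuous functions of type \<open>bcontfun\<close> require.\<close>
  define c :: "real \<Rightarrow> real" where "c t = max 0 (min 1 t)" for t
  have c: "c t \<in> {0..1}" for t unfolding c_def by auto
  have cid: "c t = t" if "t \<in> {0..1}" for t using that unfolding c_def by auto
  have cc: "continuous_on S c" for S unfolding c_def by (intro continuous_intros)
  \<comment> \<open>An unweighted \<open>X\<close> encodes the candidate \<open>w * X\<close>. In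
    terms of \<open>X\<close>, the weighted estimate is a contraction for the supremum metric, and
    \<open>G\<close> is the operator \<open>T\<close> transported to this encoding.\<close>
  define e :: "(real \<Rightarrow>\<^sub>C 'a) \<Rightarrow> real \<Rightarrow> 'a" where "e X s = w s *\<^sub>R apply_bcontfun X s" for X s
  have e: "continuous_on {0..1} (e X)" for X
    unfolding e_def by (intro continuous_intros w continuous_on_apply_bcontfun)
  define G where "G X t = inverse (w (c t)) *\<^sub>R T (e X) (c t)" for X t
  have G: "G X \<in> bcontfun" for X
  proof -
    have 1: "continuous_on {0..1} (\<lambda>t. inverse (w t) *\<^sub>R T (e X) t)"
      using w(2) by (intro continuous_intros cont e w) force
    have "bounded ((\<lambda>t. inverse (w t) *\<^sub>R T (e X) t) ` {0..1})"
      by (intro compact_imp_bounded compact_continuous_image 1) simp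
    then obtain b where b: "\<And>t. t \<in> {0..1} \<Longrightarrow> norm (inverse (w t) *\<^sub>R T (e X) t) \<le> b"
      unfolding bounded_iff by blast
    show ?thesis
    proof (rule bcontfun_normI)
      show "continuous_on UNIV (G X)"
        unfolding G_def using continuous_on_compose2[OF 1 cc[of UNIV] image_subsetI[OF c]] by simp
      show "norm (G X t) \<le> b" for t
        unfolding G_def using b c by blast
    qed
  qed
  have "\<exists>!X. Bcontfun (G X) = X"
  proof (rule banach_fix_type[of "1/2"])
    show "\<forall>X Y. dist (Bcontfun (G X)) (Bcontfun (G Y)) \<le> 1 / 2 * dist X Y"
    proof (intro allI dist_bound)
      fix X Y t
      have "norm (T (e X) (c t) - T (e Y) (c t)) \<le> dist X Y * (w (c t) / 2)"
      proof (rule contr[OF e e _ _ c])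
        fix s :: real assume s: "s \<in> {0..1}"
        have "norm (e X s - e Y s) = w s * dist (apply_bcontfun X s) (apply_bcontfun Y s)"
          unfolding e_def using w(2)[OF s] by (simp add: dist_norm flip: scaleR_diff_right)
        also have "\<dots> \<le> w s * dist X Y"
          using w(2)[OF s] by (intro mult_left_mono dist_bounded) auto
        finally show "norm (e X s - e Y s) \<le> dist X Y * w s" by (simp add: mult.commute)
      qed simp
      hence "inverse (w (c t)) * norm (T (e X) (c t) - T (e Y) (c t)) \<le> inverse (w (c t)) * (dist X Y * (w (c t) / 2))"
        using w(2)[OF c[of t]] by (intro mult_left_mono) auto
      also have "\<dots> = 1/2 * dist X Y" using w(2)[OF c[of t]] by simp
      finally have "dist (G X t) (G Y t) \<le> 1/2 * dist X Y"
        unfolding G_def dist_norm using w(2)[OF c[of t]] by (simp flip: scaleR_diff_right)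
      then show "dist (apply_bcontfun (Bcontfun (G X)) t) (apply_bcontfun (Bcontfun (G Y)) t) \<le> 1 / 2 * dist X Y"
        by (simp add: Bcontfun_inverse G)
    qed
  qed auto
  then obtain X where "Bcontfun (G X) = X" by blast
  hence X: "apply_bcontfun X t = G X t" for t using Bcontfun_inverse[OF G[of X]] by simp
  have "e X t = T (e X) t" if t: "t \<in> {0..1}" for t
    using w(2)[OF t] by (simp add: e_def[of X t] X G_def cid[OF t])
  then show ?thesis using e by blast
qed

section \<open>The space L2 and indefinite integrals\<close>

text \<open>The bridge from the Lebesgue integrals of the definitions to gauge integrals, in which
  the estimates are carried out. For a nonnegative integrand the two notions of integrability
  coincide.\<close>

lemma L2_iff:
  fixes u :: "real \<Rightarrow> real^'k"
  shows "u \<in> L2 \<longleftrightarrow> u \<in> borel_measurable (lebesgue_on {0..1}) \<and> (\<lambda>s. (norm (u s))\<^sup>2) integrable_on {0..1}"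
proof -
  have "integrable (lebesgue_on {0..1}) (\<lambda>s. (norm (u s))\<^sup>2) \<longleftrightarrow> (\<lambda>s. (norm (u s))\<^sup>2) integrable_on {0..1}"
    using integrable_on_lebesgue_on[of "{0..1}" "\<lambda>s. (norm (u s))\<^sup>2"]
      absolutely_integrable_imp_integrable[OF nonnegative_absolutely_integrable_1, of "\<lambda>s. (norm (u s))\<^sup>2" "{0..1}"]
    by auto
  then show ?thesis unfolding L2_def by simp
qed

lemma L2norm_eq:
  fixes u :: "real \<Rightarrow> real^'k"
  assumes "u \<in> L2"
  shows "L2norm u = sqrt (integral {0..1} (\<lambda>s. (norm (u s))\<^sup>2))"
  using assms unfolding L2norm_def L2_def by (simp add: lebesgue_integral_eq_integral)

lemma L2norm_nonneg: "L2norm u \<ge> 0"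
  unfolding L2norm_def by simp

lemma L2norm_power2:
  fixes u :: "real \<Rightarrow> real^'k"
  assumes "u \<in> L2"
  shows "integral {0..1} (\<lambda>s. (norm (u s))\<^sup>2) = (L2norm u)\<^sup>2"
  using assms by (simp add: L2norm_eq L2_iff integral_nonneg)

lemma L2_norm_mult_norm:
  fixes u :: "real \<Rightarrow> real^'k" and v :: "real \<Rightarrow> real^'m"
  assumes u: "u \<in> L2" and v: "v \<in> L2"
  shows "(\<lambda>s. norm (u s) * norm (v s)) integrable_on {0..1}"
    and "integral {0..1} (\<lambda>s. norm (u s) * norm (v s)) \<le> L2norm u * L2norm v"
proof -
  show 1: "(\<lambda>s. norm (u s) * norm (v s)) integrable_on {0..1}"
  proof (rule measurable_bounded_by_integrable_imp_integrable_real)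
    show "(\<lambda>s. norm (u s) * norm (v s)) \<in> borel_measurable (lebesgue_on {0..1})"
      using u v unfolding L2_iff by (intro borel_measurable_times borel_measurable_norm) auto
    show "(\<lambda>s. (norm (u s))\<^sup>2 + (norm (v s))\<^sup>2) integrable_on {0..1}"
      using u v unfolding L2_iff by (intro integrable_add) auto
    fix s
    have "0 \<le> (norm (u s) - norm (v s))\<^sup>2" "0 \<le> norm (u s) * norm (v s)" by auto
    then show "\<bar>norm (u s) * norm (v s)\<bar> \<le> (norm (u s))\<^sup>2 + (norm (v s))\<^sup>2"
      unfolding power2_diff by linarith
  qed auto
  show "integral {0..1} (\<lambda>s. norm (u s) * norm (v s)) \<le> L2norm u * L2norm v"
    using u v unfolding L2norm_eq[OF u] L2norm_eq[OF v]
    by (intro integral_mult_le_sqrt 1) (auto simp: L2_iff)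
qed

text \<open>Cauchy-Schwarz against the constant one; the interval has length one, so no further
  factor appears.\<close>

lemma L2_norm:
  fixes u :: "real \<Rightarrow> real^'k"
  assumes u: "u \<in> L2"
  shows "(\<lambda>s. norm (u s)) integrable_on {0..1}"
    and "integral {0..1} (\<lambda>s. norm (u s)) \<le> L2norm u"
proof -
  have b: "norm (u s) * 1 \<le> (norm (u s))\<^sup>2 + 1\<^sup>2" for s
  proof -
    have "0 \<le> (norm (u s) - 1)\<^sup>2" by simp
    then have "2 * norm (u s) \<le> (norm (u s))\<^sup>2 + 1" by (simp add: power2_diff)
    then show ?thesis using norm_ge_zero[of "u s"] unfolding mult_1_right power_one by linarith
  qed
  have 1: "(\<lambda>s. norm (u s) * 1) integrable_on {0..1}"
  proof (rule measurable_bounded_by_integrable_imp_integrable_real)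
    show "(\<lambda>s. norm (u s) * 1) \<in> borel_measurable (lebesgue_on {0..1})"
      using u unfolding L2_iff by (intro borel_measurable_times borel_measurable_norm) auto
    show "(\<lambda>s. (norm (u s))\<^sup>2 + 1\<^sup>2) integrable_on {0..1::real}"
      using u unfolding L2_iff by (intro integrable_add) auto
    show "\<bar>norm (u s) * 1\<bar> \<le> (norm (u s))\<^sup>2 + 1\<^sup>2" for s using b[of s] by simp
  qed auto
  then show "(\<lambda>s. norm (u s)) integrable_on {0..1}" by simp
  have "integral {0..1} (\<lambda>s. norm (u s) * 1) \<le>
     sqrt (integral {0..1} (\<lambda>s. (norm (u s))\<^sup>2)) * sqrt (integral {0..1::real} (\<lambda>s. 1\<^sup>2))"
    by (rule integral_mult_le_sqrt[OF _ _ 1]) (use u in \<open>auto simp: L2_iff\<close>)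
  then show "integral {0..1} (\<lambda>s. norm (u s)) \<le> L2norm u"
    using L2norm_eq[OF u] by simp
qed

text \<open>The parallelogram identity supplies an integrable majorant. Sums, differences and
  multiples are the special cases used later.\<close>

lemma L2_add_scaleR:
  fixes u :: "real \<Rightarrow> real^'k"
  assumes u: "u \<in> L2" and v: "v \<in> L2"
  shows "(\<lambda>s. u s + c *\<^sub>R v s) \<in> L2"
proof -
  have m: "(\<lambda>s. u s + c *\<^sub>R v s) \<in> borel_measurable (lebesgue_on {0..1})"
    using u v unfolding L2_iff by (intro borel_measurable_add borel_measurable_scaleR) auto
  have "(\<lambda>s. (norm (u s + c *\<^sub>R v s))\<^sup>2) integrable_on {0..1}"
  proof (rule measurable_bounded_by_integrable_imp_integrable_real)
    show "(\<lambda>s. (norm (u s + c *\<^sub>R v s))\<^sup>2) \<in> borel_measurable (lebesgue_on {0..1})"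
      using m by measurable
    show "(\<lambda>s. 2 * (norm (u s))\<^sup>2 + (2 * c\<^sup>2) * (norm (v s))\<^sup>2) integrable_on {0..1}"
      using u v unfolding L2_iff by (intro integrable_add integrable_on_mult_right) auto
    fix s
    have "(norm (u s + c *\<^sub>R v s))\<^sup>2 + (norm (u s - c *\<^sub>R v s))\<^sup>2 = 2 * (norm (u s))\<^sup>2 + (2 * c\<^sup>2) * (norm (v s))\<^sup>2"
      by (simp add: power2_norm_eq_inner inner_add_left inner_add_right inner_diff_left inner_diff_right power2_eq_square[of c] algebra_simps)
    then show "\<bar>(norm (u s + c *\<^sub>R v s))\<^sup>2\<bar> \<le> 2 * (norm (u s))\<^sup>2 + (2 * c\<^sup>2) * (norm (v s))\<^sup>2"
      using zero_le_power2[of "norm (u s - c *\<^sub>R v s)"]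
      unfolding abs_of_nonneg[OF zero_le_power2] by linarith
  qed auto
  with m show ?thesis unfolding L2_iff by blast
qed

lemma L2_zero [simp]: "(\<lambda>s. 0) \<in> L2"
  unfolding L2_def by simp

lemma L2_add: "u \<in> L2 \<Longrightarrow> v \<in> L2 \<Longrightarrow> (\<lambda>s. u s + v s) \<in> L2"
  using L2_add_scaleR[of u v 1] by simp

lemma L2_diff: "u \<in> L2 \<Longrightarrow> v \<in> L2 \<Longrightarrow> (\<lambda>s. u s - v s) \<in> L2"
  using L2_add_scaleR[of u v "-1"] by simp

lemma L2_scaleR: "u \<in> L2 \<Longrightarrow> (\<lambda>s. c *\<^sub>R u s) \<in> L2"
  using L2_add_scaleR[of "\<lambda>s. 0" u c] by simp

lemma L2_inner:
  fixes u :: "real \<Rightarrow> real^'k"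
  assumes u: "u \<in> L2" and v: "v \<in> L2"
  shows "(\<lambda>s. u s \<bullet> v s) absolutely_integrable_on {0..1}"
    and "L2inner u v = integral {0..1} (\<lambda>s. u s \<bullet> v s)"
proof -
  show 1: "(\<lambda>s. u s \<bullet> v s) absolutely_integrable_on {0..1}"
  proof (rule measurable_bounded_by_integrable_imp_absolutely_integrable)
    show "(\<lambda>s. u s \<bullet> v s) \<in> borel_measurable (lebesgue_on {0..1})"
      using u v unfolding L2_iff by (intro borel_measurable_inner) auto
    show "(\<lambda>s. norm (u s) * norm (v s)) integrable_on {0..1}" using L2_norm_mult_norm[OF u v] by blast
    show "norm (u s \<bullet> v s) \<le> norm (u s) * norm (v s)" for s by (simp add: Cauchy_Schwarz_ineq2)
  qed auto
  show "L2inner u v = integral {0..1} (\<lambda>s. u s \<bullet> v s)"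
    unfolding L2inner_def by (rule lebesgue_integral_eq_integral[OF absolutely_integrable_imp_integrable[OF 1]]) auto
qed

lemma L2inner_commute: "L2inner u v = L2inner v u"
  unfolding L2inner_def by (simp add: inner_commute)

lemma L2inner_add_scaleR_left:
  fixes u :: "real \<Rightarrow> real^'k"
  assumes u: "u \<in> L2" and v: "v \<in> L2" and w: "w \<in> L2"
  shows "L2inner (\<lambda>s. u s + c *\<^sub>R v s) w = L2inner u w + c * L2inner v w"
proof -
  have "integral {0..1} (\<lambda>s. u s \<bullet> w s + c * (v s \<bullet> w s)) =
      integral {0..1} (\<lambda>s. u s \<bullet> w s) + integral {0..1} (\<lambda>s. c * (v s \<bullet> w s))"
    by (intro integral_add integrable_on_mult_right)
      (use L2_inner(1)[OF u w] L2_inner(1)[OF v w] in \<open>auto simp: absolutely_integrable_on_def\<close>)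
  then show ?thesis
    using L2_inner(2)[OF L2_add_scaleR[OF u v] w] L2_inner(2)[OF u w] L2_inner(2)[OF v w]
    by (simp add: inner_add_left)
qed

lemma L2inner_add_scaleR_right:
  fixes u :: "real \<Rightarrow> real^'k"
  assumes "u \<in> L2" "v \<in> L2" "w \<in> L2"
  shows "L2inner w (\<lambda>s. u s + c *\<^sub>R v s) = L2inner w u + c * L2inner w v"
  using L2inner_add_scaleR_left[OF assms] by (simp add: L2inner_commute)

lemma L2inner_diff_left:
  fixes u :: "real \<Rightarrow> real^'k"
  shows "u \<in> L2 \<Longrightarrow> v \<in> L2 \<Longrightarrow> w \<in> L2 \<Longrightarrow> L2inner (\<lambda>s. u s - v s) w = L2inner u w - L2inner v w"
  using L2inner_add_scaleR_left[of u v w "-1"] by simp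

lemma L2inner_diff_right:
  fixes u :: "real \<Rightarrow> real^'k"
  shows "u \<in> L2 \<Longrightarrow> v \<in> L2 \<Longrightarrow> w \<in> L2 \<Longrightarrow> L2inner w (\<lambda>s. u s - v s) = L2inner w u - L2inner w v"
  using L2inner_add_scaleR_right[of u v w "-1"] by simp

lemma L2inner_scaleR_right:
  fixes u :: "real \<Rightarrow> real^'k"
  shows "u \<in> L2 \<Longrightarrow> v \<in> L2 \<Longrightarrow> L2inner v (\<lambda>s. c *\<^sub>R u s) = c * L2inner v u"
  using L2inner_add_scaleR_right[of "\<lambda>s. 0" u v c] by (simp add: L2inner_def)

lemma L2inner_self:
  fixes u :: "real \<Rightarrow> real^'k"
  shows "L2inner u u = (L2norm u)\<^sup>2"
  unfolding L2inner_def L2norm_def by (simp add: power2_norm_eq_inner)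

lemma L2inner_le:
  fixes u :: "real \<Rightarrow> real^'k"
  assumes u: "u \<in> L2" and v: "v \<in> L2"
  shows "\<bar>L2inner u v\<bar> \<le> L2norm u * L2norm v"
proof -
  have "norm (integral {0..1} (\<lambda>s. u s \<bullet> v s)) \<le> integral {0..1} (\<lambda>s. norm (u s) * norm (v s))"
    using L2_inner(1)[OF u v] L2_norm_mult_norm(1)[OF u v]
    by (intro integral_norm_bound_integral) (auto simp: absolutely_integrable_on_def Cauchy_Schwarz_ineq2)
  also have "\<dots> \<le> L2norm u * L2norm v" by (rule L2_norm_mult_norm(2)[OF u v])
  finally show ?thesis using L2_inner(2)[OF u v] by simp
qed

lemma L2norm_triangle:
  fixes u :: "real \<Rightarrow> real^'k"
  assumes u: "u \<in> L2" and v: "v \<in> L2"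
  shows "L2norm (\<lambda>s. u s + v s) \<le> L2norm u + L2norm v"
proof -
  have "(L2norm (\<lambda>s. u s + v s))\<^sup>2 = L2inner (\<lambda>s. u s + 1 *\<^sub>R v s) (\<lambda>s. u s + 1 *\<^sub>R v s)"
    by (simp add: L2inner_self)
  also have "\<dots> = L2inner u u + 2 * L2inner u v + L2inner v v"
    using L2inner_add_scaleR_left[OF u v L2_add_scaleR[OF u v], of 1 1]
      L2inner_add_scaleR_right[OF u v u, of 1] L2inner_add_scaleR_right[OF u v v, of 1]
    by (simp add: L2inner_commute[of v u])
  also have "\<dots> \<le> (L2norm u + L2norm v)\<^sup>2"
    using L2inner_le[OF u v] by (simp add: L2inner_self power2_sum)
  finally show ?thesis
    by (rule power2_le_imp_le) (simp add: L2norm_nonneg)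
qed

lemma L2norm_scaleR:
  fixes u :: "real \<Rightarrow> real^'k"
  shows "L2norm (\<lambda>s. c *\<^sub>R u s) = \<bar>c\<bar> * L2norm u"
  unfolding L2norm_def by (simp add: power_mult_distrib real_sqrt_mult)

lemma L2norm_zero [simp]: "L2norm (\<lambda>s. 0) = 0"
  unfolding L2norm_def by simp

lemma L2norm_minus_commute: "L2norm (\<lambda>s. u s - v s) = L2norm (\<lambda>s. v s - u s)"
  unfolding L2norm_def by (simp add: norm_minus_commute)

lemma L2norm_triangle_diff:
  fixes u :: "real \<Rightarrow> real^'k"
  assumes u: "u \<in> L2" and v: "v \<in> L2" and w: "w \<in> L2"
  shows "L2norm (\<lambda>s. u s - w s) \<le> L2norm (\<lambda>s. u s - v s) + L2norm (\<lambda>s. v s - w s)"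
  using L2norm_triangle[OF L2_diff[OF u v] L2_diff[OF v w]] by simp

section \<open>Continuous functions and products of indefinite integrals on the unit
  interval\<close>

lemma continuous_bounded_interval:
  fixes x :: "real \<Rightarrow> 'a::real_normed_vector"
  assumes "continuous_on {0..1} x"
  obtains B where "B \<ge> 0" "\<And>s. s \<in> {0..1} \<Longrightarrow> norm (x s) \<le> B"
proof -
  have "bounded (x ` {0..1})"
    using assms by (intro compact_imp_bounded compact_continuous_image) auto
  then obtain B where "B > 0" "\<forall>y\<in>x ` {0..1}. norm y \<le> B" unfolding bounded_pos by blast
  then show ?thesis using that[of B] by auto
qed

lemma continuous_L2:
  fixes u :: "real \<Rightarrow> real^'k"
  assumes "continuous_on {0..1} u"
  shows "u \<in> L2"
  unfolding L2_iff
  using assms by (auto intro!: integrable_continuous_real continuous_intros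
      continuous_imp_measurable_on_sets_lebesgue)

text \<open>On a partition whose \<phi>-increments are at most \<epsilon>, the squares are at most
  \<epsilon> times the increments, and the latter telescope. This criterion for constancy replaces
  an argument by differentiation almost everywhere.\<close>

lemma square_variation_const:
  fixes f \<phi> :: "real \<Rightarrow> real"
  assumes \<phi>: "continuous_on {0..1} \<phi>"
    and f: "\<And>a b. 0 \<le> a \<Longrightarrow> a \<le> b \<Longrightarrow> b \<le> 1 \<Longrightarrow> \<bar>f b - f a\<bar> \<le> (\<phi> b - \<phi> a)\<^sup>2"
    and mono: "\<And>a b. 0 \<le> a \<Longrightarrow> a \<le> b \<Longrightarrow> b \<le> 1 \<Longrightarrow> \<phi> a \<le> \<phi> b"
  shows "f 1 = f 0"
proof -
  have small: "\<bar>f 1 - f 0\<bar> \<le> \<epsilon> * (\<phi> 1 - \<phi> 0)" if "\<epsilon> > 0" for \<epsilon>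
  proof -
    have "uniformly_continuous_on {0..1} \<phi>" using \<phi> by (rule compact_uniformly_continuous) simp
    from this[unfolded uniformly_continuous_on_def, rule_format, OF that]
    obtain d where d: "d > 0" "\<And>a b. a \<in> {0..1} \<Longrightarrow> b \<in> {0..1} \<Longrightarrow> dist a b < d \<Longrightarrow> dist (\<phi> a) (\<phi> b) < \<epsilon>"
      by blast
    obtain n :: nat where n: "n > 0" "1 / real n < d"
      using d(1) real_arch_inverse[of d] by (auto simp: inverse_eq_divide)
    define p where "p i = real i / real n" for i :: nat
    have step: "\<bar>f (p (Suc i)) - f (p i)\<bar> \<le> \<epsilon> * (\<phi> (p (Suc i)) - \<phi> (p i))" if "i < n" for i
    proof -
      have r: "0 \<le> p i" "p i \<le> p (Suc i)" "p (Suc i) \<le> 1"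
        using that n by (auto simp: p_def field_simps)
      have "dist (p (Suc i)) (p i) < d"
        using n by (simp add: p_def dist_norm flip: diff_divide_distrib)
      hence "\<phi> (p (Suc i)) - \<phi> (p i) \<le> \<epsilon>"
        using d(2)[of "p (Suc i)" "p i"] r by (auto simp: dist_norm)
      hence "(\<phi> (p (Suc i)) - \<phi> (p i))\<^sup>2 \<le> \<epsilon> * (\<phi> (p (Suc i)) - \<phi> (p i))"
        unfolding power2_eq_square using mono[OF r] by (intro mult_right_mono) auto
      then show ?thesis using f[OF r] by linarith
    qed
    have "f (p n) - f (p 0) = (\<Sum>i<n. f (p (Suc i)) - f (p i))" by (rule sum_lessThan_telescope[symmetric])
    hence "\<bar>f (p n) - f (p 0)\<bar> \<le> (\<Sum>i<n. \<bar>f (p (Suc i)) - f (p i)\<bar>)" using sum_abs[of "\<lambda>i. f (p (Suc i)) - f (p i)" "{..<n}"] by simp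
    also have "\<dots> \<le> (\<Sum>i<n. \<epsilon> * (\<phi> (p (Suc i)) - \<phi> (p i)))" using step by (intro sum_mono) auto
    also have "\<dots> = \<epsilon> * (\<phi> (p n) - \<phi> (p 0))"
      by (simp only: sum_distrib_left[symmetric] sum_lessThan_telescope[of "\<lambda>i. \<phi> (p i)"])
    finally show ?thesis using n by (simp add: p_def)
  qed
  have "\<bar>f 1 - f 0\<bar> \<le> \<delta>" if "\<delta> > 0" for \<delta>
  proof -
    have pos: "\<phi> 1 - \<phi> 0 + 1 > 0" using mono[of 0 1] by simp
    \<comment> \<open>The added one keeps the denominator positive when
      \<open>\<phi> 1 = \<phi> 0\<close>.\<close>
    have "\<bar>f 1 - f 0\<bar> \<le> \<delta> / (\<phi> 1 - \<phi> 0 + 1) * (\<phi> 1 - \<phi> 0)"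
      using that pos by (intro small) simp
    also have "\<dots> \<le> \<delta>" using that pos by (simp add: field_simps)
    finally show ?thesis .
  qed
  then show ?thesis using field_le_epsilon[of "\<bar>f 1 - f 0\<bar>" 0] by simp
qed

lemma absolutely_integrable_continuous_inner:
  fixes p x :: "real \<Rightarrow> 'a::euclidean_space"
  assumes p: "p absolutely_integrable_on {0..1}" and x: "continuous_on {0..1} x"
  shows "(\<lambda>s. x s \<bullet> p s) absolutely_integrable_on {0..1}"
proof (rule absolutely_integrable_bounded_measurable_product[of "(\<bullet>)", OF _ _ _ _ p])
  show "bilinear ((\<bullet>) :: 'a \<Rightarrow> _)" by (simp add: bilinear_conv_bounded_bilinear bounded_bilinear_inner)
  show "bounded (x ` {0..1})"
    by (intro compact_imp_bounded compact_continuous_image x) auto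
  show "x \<in> borel_measurable (lebesgue_on {0..1})"
    by (intro continuous_imp_measurable_on_sets_lebesgue x) auto
qed auto

text \<open>Integration by parts for absolutely continuous functions. The defect \<open>D\<close>,
  the difference between \<open>x t \<bullet> y t\<close> and the integral of the formal derivative,
  changes over an interval only by a quantity quadratic in the integral of
  \<open>norm (p s) + norm (q s)\<close>, hence is constant.\<close>

lemma indefinite_integral_product_rule:
  fixes p q x y :: "real \<Rightarrow> 'a::euclidean_space"
  assumes p: "p absolutely_integrable_on {0..1}" and q: "q absolutely_integrable_on {0..1}"
    and x: "\<And>t. t \<in> {0..1} \<Longrightarrow> x t = x 0 + integral {0..t} p"
    and y: "\<And>t. t \<in> {0..1} \<Longrightarrow> y t = y 0 + integral {0..t} q"
  shows "integral {0..1} (\<lambda>s. x s \<bullet> q s + y s \<bullet> p s) = x 1 \<bullet> y 1 - x 0 \<bullet> y 0"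
proof -
  have pi: "p integrable_on {0..1}" "(\<lambda>s. norm (p s)) integrable_on {0..1}"
    and qi: "q integrable_on {0..1}" "(\<lambda>s. norm (q s)) integrable_on {0..1}"
    using p q by (auto simp: absolutely_integrable_on_def)
  have cont: "continuous_on {0..1} z" if "r integrable_on {0..1}" "\<And>t. t \<in> {0..1} \<Longrightarrow> z t = z 0 + integral {0..t} r"
    for z r :: "real \<Rightarrow> 'a"
  proof -
    have "continuous_on {0..1} (\<lambda>t. z 0 + integral {0..t} r)"
      by (intro continuous_intros indefinite_integral_continuous_1 that)
    then show ?thesis by (rule continuous_on_eq) (rule that(2)[symmetric])
  qed
  note cx = cont[OF pi(1) x] and cy = cont[OF qi(1) y]
  define m where "m s = norm (p s) + norm (q s)" for s
  have m: "m integrable_on {0..1}" unfolding m_def by (intro integrable_add pi qi)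
  \<comment> \<open>Increments of \<open>x\<close> and of \<open>y\<close> are both dominated by
    those of this one monotone function.\<close>
  define \<phi> where "\<phi> t = integral {0..t} m" for t
  define r where "r s = x s \<bullet> q s + y s \<bullet> p s" for s
  have r: "r integrable_on {0..1}"
    unfolding r_def using absolutely_integrable_continuous_inner[OF q cx] absolutely_integrable_continuous_inner[OF p cy]
    by (intro integrable_add) (auto simp: absolutely_integrable_on_def)
  have comb: "integral {0..b} g - integral {0..a} g = integral {a..b} g"
    if "g integrable_on {0..1}" "0 \<le> a" "a \<le> b" "b \<le> 1" for a b and g :: "real \<Rightarrow> 'b::euclidean_space"
  proof -
    have "g integrable_on {0..b}" by (rule integrable_on_subinterval[OF that(1)]) (use that in auto)
    from Henstock_Kurzweil_Integration.integral_combine[OF that(2,3) this] show ?thesis by (simp add: algebra_simps)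
  qed
  have sub: "g integrable_on {a..b}" if "g integrable_on {0..1}" "0 \<le> a" "b \<le> 1" for a b and g :: "real \<Rightarrow> 'b::euclidean_space"
    by (rule integrable_on_subinterval[OF that(1)]) (use that in auto)
  have mle: "norm (integral {a'..b'} g) \<le> \<phi> b - \<phi> a"
    if "0 \<le> a" "a \<le> a'" "a' \<le> b'" "b' \<le> b" "b \<le> 1" "g integrable_on {0..1}" "\<And>s. norm (g s) \<le> m s"
    for a a' b b' and g :: "real \<Rightarrow> 'a"
  proof -
    have "norm (integral {a'..b'} g) \<le> integral {a'..b'} m"
      using that by (intro integral_norm_bound_integral sub[OF that(6)] sub[OF m]) auto
    also have "\<dots> \<le> integral {a..b} m"
      using that by (intro integral_subset_le sub[OF m]) (auto simp: m_def)
    also have "\<dots> = \<phi> b - \<phi> a" unfolding \<phi>_def using that by (intro comb[symmetric] m) auto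
    finally show ?thesis .
  qed
  define D where "D t = x t \<bullet> y t - integral {0..t} r" for t
  have "D 1 = D 0"
  proof (rule square_variation_const[of \<phi>])
    show "continuous_on {0..1} \<phi>" unfolding \<phi>_def by (rule indefinite_integral_continuous_1[OF m])
    show "\<phi> a \<le> \<phi> b" if "0 \<le> a" "a \<le> b" "b \<le> 1" for a b
    proof -
      have "0 \<le> integral {a..b} m" using that by (intro integral_nonneg sub[OF m]) (auto simp: m_def)
      then show ?thesis unfolding \<phi>_def using comb[OF m that] by simp
    qed
    fix a b :: real assume ab: "0 \<le> a" "a \<le> b" "b \<le> 1"
    define \<Delta> where "\<Delta> = \<phi> b - \<phi> a"
    have P: "x b - x a = integral {a..b} p" and Q: "y b - y a = integral {a..b} q"
      using x[of a] x[of b] y[of a] y[of b] comb[OF pi(1) ab] comb[OF qi(1) ab] ab by (auto simp: algebra_simps)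
    have xs: "norm (x s - x b) \<le> \<Delta>" and ys: "norm (y s - y a) \<le> \<Delta>" if "s \<in> {a..b}" for s
    proof -
      have s: "0 \<le> s" "s \<le> b" "a \<le> s" "s \<le> 1" using that ab by auto
      have "x b - x s = integral {s..b} p"
        using x[of s] x[of b] comb[OF pi(1) s(1,2)] s ab by (auto simp: algebra_simps)
      moreover have "norm (integral {s..b} p) \<le> \<Delta>"
        unfolding \<Delta>_def by (rule mle) (use s ab pi in \<open>auto simp: m_def\<close>)
      ultimately show "norm (x s - x b) \<le> \<Delta>" by (metis norm_minus_commute)
      have "y s - y a = integral {a..s} q"
        using y[of s] y[of a] comb[OF qi(1) ab(1) s(3,4)] s ab by (auto simp: algebra_simps)
      moreover have "norm (integral {a..s} q) \<le> \<Delta>"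
        unfolding \<Delta>_def by (rule mle) (use s ab qi in \<open>auto simp: m_def\<close>)
      ultimately show "norm (y s - y a) \<le> \<Delta>" by metis
    qed
    have ii: "((\<lambda>s. c \<bullet> g s) has_integral c \<bullet> integral {a..b} g) {a..b}" if "g integrable_on {0..1}" for c :: 'a and g
      using has_integral_linear[OF integrable_integral[OF sub[OF that ab(1,3)]] bounded_linear_inner_right[of c]]
      by (simp add: o_def)
    \<comment> \<open>Freezing \<open>x\<close> at the right end and \<open>y\<close> at the left
      end is exact for the product: its increment is
      \<open>x b \<bullet> (y b - y a) + y a \<bullet> (x b - x a)\<close>. What remains under the
      integral pairs the small differences \<open>x s - x b\<close> and \<open>y s - y a\<close>
      with \<open>q\<close> and \<open>p\<close>.\<close>
    have "((\<lambda>s. r s - x b \<bullet> q s - y a \<bullet> p s) has_integral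
       (integral {0..b} r - integral {0..a} r) - x b \<bullet> (y b - y a) - y a \<bullet> (x b - x a)) {a..b}"
      unfolding comb[OF r ab] P Q by (intro has_integral_diff ii pi(1) qi(1) integrable_integral sub[OF r] ab)
    moreover have "(integral {0..b} r - integral {0..a} r) - x b \<bullet> (y b - y a) - y a \<bullet> (x b - x a) = - (D b - D a)"
      by (simp add: D_def inner_diff_right inner_commute)
    ultimately have I: "((\<lambda>s. r s - x b \<bullet> q s - y a \<bullet> p s) has_integral - (D b - D a)) {a..b}" by simp
    have "norm (integral {a..b} (\<lambda>s. r s - x b \<bullet> q s - y a \<bullet> p s)) \<le> integral {a..b} (\<lambda>s. \<Delta> * m s)"
    proof (rule integral_norm_bound_integral)
      show "(\<lambda>s. r s - x b \<bullet> q s - y a \<bullet> p s) integrable_on {a..b}" using I by blast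
      show "(\<lambda>s. \<Delta> * m s) integrable_on {a..b}" by (intro integrable_on_mult_right sub[OF m] ab)
      fix s assume s: "s \<in> {a..b}"
      have "r s - x b \<bullet> q s - y a \<bullet> p s = (x s - x b) \<bullet> q s + (y s - y a) \<bullet> p s"
        unfolding r_def by (simp add: inner_diff_left)
      also have "norm \<dots> \<le> norm (x s - x b) * norm (q s) + norm (y s - y a) * norm (p s)"
        unfolding real_norm_def by (intro order_trans[OF abs_triangle_ineq] add_mono Cauchy_Schwarz_ineq2)
      also have "\<dots> \<le> \<Delta> * norm (q s) + \<Delta> * norm (p s)"
        by (intro add_mono mult_right_mono xs ys s) auto
      finally show "norm (r s - x b \<bullet> q s - y a \<bullet> p s) \<le> \<Delta> * m s" unfolding m_def by (simp add: algebra_simps)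
    qed
    also have "\<dots> = \<Delta> * \<Delta>"
      using comb[OF m ab] by (simp add: \<Delta>_def \<phi>_def)
    finally show "\<bar>D b - D a\<bar> \<le> (\<phi> b - \<phi> a)\<^sup>2"
      using integral_unique[OF I] by (simp add: \<Delta>_def power2_eq_square)
  qed
  then show ?thesis unfolding D_def r_def by simp
qed

section \<open>Trajectories and the adjoint equation\<close>

text \<open>Cauchy-Schwarz in each row. The norm of \<open>real^'k^'n\<close> is the Euclidean norm
  of the row norms, hence the constant one.\<close>

lemma norm_matrix_vector_mult_le:
  fixes A :: "real^'k^'n"
  shows "norm (A *v x) \<le> norm A * norm x"
proof -
  have "norm (A *v x) \<le> L2_set (\<lambda>i. norm (A $ i) * norm x) UNIV"
    unfolding norm_vec_def[of "A *v x"] 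
    by (rule L2_set_mono) (auto simp: matrix_vector_mul_component Cauchy_Schwarz_ineq2)
  also have "\<dots> = norm A * norm x"
    unfolding norm_vec_def[of A] by (rule L2_set_left_distrib[symmetric]) simp
  finally show ?thesis .
qed

lemma bounded_bilinear_matrix_vector_mult:
  "bounded_bilinear ((*v) :: real^'k^'n \<Rightarrow> _)"
proof
  show "\<exists>K. \<forall>A x. norm ((A::real^'k^'n) *v x) \<le> norm A * norm x * K"
    by (intro exI[of _ 1] allI) (simp add: norm_matrix_vector_mult_le)
qed (auto simp: matrix_vector_mult_add_rdistrib matrix_vector_right_distrib matrix_vector_mult_scaleR
     scaleR_matrix_vector_assoc)

lemma absolutely_integrable_matrix_vector:
  fixes A :: "real \<Rightarrow> real^'k^'n"
  assumes A: "continuous_on {0..1} A" and v: "v \<in> L2"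
  shows "(\<lambda>s. A s *v v s) absolutely_integrable_on {0..1}"
proof (rule absolutely_integrable_bounded_measurable_product[of "(*v)"])
  show "bilinear ((*v) :: real^'k^'n \<Rightarrow> _)"
    by (simp add: bilinear_conv_bounded_bilinear bounded_bilinear_matrix_vector_mult)
  show "A \<in> borel_measurable (lebesgue_on {0..1})"
    by (intro continuous_imp_measurable_on_sets_lebesgue A) auto
  show "bounded (A ` {0..1})"
    by (intro compact_imp_bounded compact_continuous_image A) auto
  show "v absolutely_integrable_on {0..1}"
    using v by (intro measurable_bounded_by_integrable_imp_absolutely_integrable[OF _ _ L2_norm(1)[OF v]])
      (auto simp: L2_iff)
qed auto

lemma integrable_on_unit_subinterval:
  fixes f :: "real \<Rightarrow> 'a::banach"
  assumes "f integrable_on {0..1}" "{a..b} \<subseteq> {0..1}"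
  shows "f integrable_on {a..b}"
  using assms integrable_on_subinterval by blast

text \<open>With \<open>D i\<close> the \<open>i\<close>-th partial derivative of the control
  matrix, this is the transposed Jacobian of the vector field \<open>F \<xi> *v w\<close> with
  respect to \<xi>, applied to the costate. Summing over axis vectors reduces continuity and
  integrability to scalar factors.\<close>

definition adj_rhs :: "('n \<Rightarrow> real^'n \<Rightarrow> real^'k^'n) \<Rightarrow> real^'n \<Rightarrow> real^'k \<Rightarrow> real^'n \<Rightarrow> real^'n" where
  "adj_rhs D \<xi> w p = (\<Sum>i\<in>UNIV. (p \<bullet> (D i \<xi> *v w)) *\<^sub>R axis i 1)"

lemma adj_rhs_component: "adj_rhs D \<xi> w p $ i = p \<bullet> (D i \<xi> *v w)"
  unfolding adj_rhs_def by (simp add: axis_def if_distrib[of "\<lambda>z. _ * z"] cong: if_cong)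

lemma adj_rhs_diff: "adj_rhs D \<xi> w p - adj_rhs D \<xi> w q = adj_rhs D \<xi> w (p - q)"
  by (simp add: vec_eq_iff adj_rhs_component inner_diff_left)

text \<open>The duality behind the adjoint equation: the derivative of the field in direction
  \<open>z\<close> moves from the costate side to the side of the state variation.\<close>

lemma inner_adj_rhs: "z \<bullet> adj_rhs D \<xi> w p = p \<bullet> ((\<Sum>i\<in>UNIV. z $ i *\<^sub>R D i \<xi>) *v w)"
proof -
  interpret bounded_bilinear "(*v) :: real^'b^'a \<Rightarrow> _" by (rule bounded_bilinear_matrix_vector_mult)
  show ?thesis
    by (simp add: inner_vec_def[of z] adj_rhs_component sum_left inner_sum_right scaleR_left)
qed

lemma norm_adj_rhs_le:
  "norm (adj_rhs D \<xi> w p) \<le> (\<Sum>i\<in>UNIV. norm (D i \<xi>)) * norm w * norm p"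
proof -
  have "norm (adj_rhs D \<xi> w p) \<le> (\<Sum>i\<in>UNIV. \<bar>adj_rhs D \<xi> w p $ i\<bar>)" by (rule norm_le_l1_cart)
  also have "\<dots> \<le> (\<Sum>i\<in>UNIV. norm (D i \<xi>) * norm w * norm p)"
  proof (rule sum_mono)
    fix i
    have "\<bar>adj_rhs D \<xi> w p $ i\<bar> \<le> norm p * norm (D i \<xi> *v w)"
      unfolding adj_rhs_component by (rule Cauchy_Schwarz_ineq2)
    also have "\<dots> \<le> norm p * (norm (D i \<xi>) * norm w)"
      by (intro mult_left_mono norm_matrix_vector_mult_le) auto
    finally show "\<bar>adj_rhs D \<xi> w p $ i\<bar> \<le> norm (D i \<xi>) * norm w * norm p" by (simp add: mult_ac)
  qed
  finally show ?thesis by (simp add: sum_distrib_right)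
qed

text \<open>The regularity from which trajectories, costates and the expansion of the cost are
  obtained. \<open>D i\<close> stands for the partial derivative of \<open>F\<close> in coordinate
  \<open>i\<close>; in \<open>strict\<close> both points move, and \<delta> serves all centres
  \<open>c\<close> of norm at most \<open>R\<close>.\<close>

locale control_system =
  fixes F :: "real^'n \<Rightarrow> real^'k^'n" and L :: real and D :: "'n \<Rightarrow> real^'n \<Rightarrow> real^'k^'n" and x0 :: "real^'n"
  assumes Lip: "norm (F x - F y) \<le> L * norm (x - y)" and L0: "L \<ge> 0"
    and D_cont: "continuous_on UNIV (D i)"
    and strict: "\<epsilon> > 0 \<Longrightarrow> \<exists>\<delta>>0. \<forall>c p q. norm c \<le> R \<longrightarrow> norm (p - c) \<le> \<delta> \<longrightarrow> norm (q - c) \<le> \<delta> \<longrightarrow>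
        norm (F p - F q - (\<Sum>i\<in>UNIV. (p - q) $ i *\<^sub>R D i c)) \<le> \<epsilon> * norm (p - q)"
begin

text \<open>The condition under the \<open>THE\<close> of \<open>traj_end\<close>, freed from the
  endpoint.\<close>

definition traj :: "(real \<Rightarrow> real^'k) \<Rightarrow> (real \<Rightarrow> real^'n) \<Rightarrow> bool" where
  "traj v x \<longleftrightarrow> continuous_on {0..1} x \<and>
     (\<forall>t\<in>{0..1}. ((\<lambda>s. F (x s) *v v s) has_integral (x t - x0)) {0..t})"

lemma F_cont: "continuous_on S F"
proof -
  have "L-lipschitz_on UNIV F"
    using Lip L0 by (intro lipschitz_onI) (auto simp: dist_norm)
  then show ?thesis using lipschitz_on_continuous_on continuous_on_subset subset_UNIV by blast
qed

lemma F_comp_cont: "continuous_on {0..1} x \<Longrightarrow> continuous_on {0..1} (\<lambda>s. F (x s))"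
  using continuous_on_compose2[OF F_cont[of UNIV]] by auto

lemma D_comp_cont: "continuous_on {0..1} x \<Longrightarrow> continuous_on {0..1} (\<lambda>s. D i (x s))"
  using continuous_on_compose2[OF D_cont] by auto

lemma D_sum_bounded:
  fixes x :: "real \<Rightarrow> real^'n"
  assumes x: "continuous_on {0..1} x"
  obtains d where "d \<ge> 0" "\<And>s. s \<in> {0..1} \<Longrightarrow> (\<Sum>i\<in>UNIV. norm (D i (x s))) \<le> d"
proof -
  have "continuous_on {0..1} (\<lambda>s. \<Sum>i\<in>UNIV. norm (D i (x s)))"
    by (intro continuous_intros D_comp_cont x)
  from continuous_bounded_interval[OF this] obtain d where
    d: "d \<ge> 0" "\<And>s. s \<in> {0..1} \<Longrightarrow> norm (\<Sum>i\<in>UNIV. norm (D i (x s))) \<le> d" by blast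
  show ?thesis by (rule that[OF d(1)]) (use d(2) in force)
qed

lemma rhs_integrable:
  assumes "v \<in> L2" "continuous_on {0..1} x"
  shows "(\<lambda>s. F (x s) *v v s) absolutely_integrable_on {0..1}"
  using absolutely_integrable_matrix_vector F_comp_cont assms by blast

text \<open>The hypotheses of the weighted kernel estimates for the kernel
  \<open>c * norm (v s)\<close>, with \<open>R = c * L2norm v\<close>: \<open>c\<close> is the
  Lipschitz constant for states and a bound on the partial derivatives for costates.\<close>

lemma kernel_norm:
  assumes v: "v \<in> L2" and c: "c \<ge> 0"
  shows "(\<lambda>s. c * norm (v s)) integrable_on {0..1}" "(\<lambda>s. (c * norm (v s))\<^sup>2) integrable_on {0..1}"
    "integral {0..1} (\<lambda>s. (c * norm (v s))\<^sup>2) \<le> (c * L2norm v)\<^sup>2" "c * L2norm v \<ge> 0"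
    "c * norm (v s) \<ge> 0"
proof -
  show "(\<lambda>s. c * norm (v s)) integrable_on {0..1}"
    by (intro integrable_on_mult_right L2_norm v)
  show "(\<lambda>s. (c * norm (v s))\<^sup>2) integrable_on {0..1}"
    unfolding power_mult_distrib using v by (intro integrable_on_mult_right) (auto simp: L2_iff)
  show "integral {0..1} (\<lambda>s. (c * norm (v s))\<^sup>2) \<le> (c * L2norm v)\<^sup>2"
    unfolding power_mult_distrib using L2norm_power2[OF v] by simp
  show "c * L2norm v \<ge> 0" "c * norm (v s) \<ge> 0" using c L2norm_nonneg[of v] by auto
qed

text \<open>Picard iteration on the whole interval in one step: a weight that grows fast enough
  makes the integral operator a contraction for a control of any size.\<close>

lemma traj_exists:
  assumes v: "v \<in> L2"
  shows "\<exists>x. traj v x"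
proof -
  define R where "R = L * L2norm v"
  define K where "K = 2 * R\<^sup>2 + 1"
  have K: "K \<ge> 2 * R\<^sup>2" "K > 0" unfolding K_def by (auto intro: add_nonneg_pos)
  define T where "T x t = x0 + integral {0..t} (\<lambda>s. F (x s) *v v s)" for x and t :: real
  note h = kernel_norm[OF v L0, folded R_def]
  have int: "(\<lambda>s. F (x s) *v v s) integrable_on {0..1}" if "continuous_on {0..1} x" for x
    using rhs_integrable[OF v that] by (simp add: absolutely_integrable_on_def)
  have "\<exists>x. continuous_on {0..1} x \<and> (\<forall>t\<in>{0..1}. x t = T x t)"
  proof (rule weighted_contraction_fixpoint)
    show "continuous_on {0..1} (\<lambda>t. exp (K * t))" by (intro continuous_intros)
    show "continuous_on {0..1} (T x)" if "continuous_on {0..1} x" for x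
      unfolding T_def by (intro continuous_intros indefinite_integral_continuous_1 int that)
    fix x y :: "real \<Rightarrow> real^'n" and M t :: real
    assume x: "continuous_on {0..1} x" and y: "continuous_on {0..1} y" and M: "M \<ge> 0"
      and xy: "\<And>s. s \<in> {0..1} \<Longrightarrow> norm (x s - y s) \<le> M * exp (K * s)" and t: "t \<in> {0..1}"
    have sub: "{0..t} \<subseteq> {0..1}" using t by auto
    note ii = integrable_on_unit_subinterval[OF int sub]
    have "T x t - T y t = integral {0..t} (\<lambda>s. F (x s) *v v s - F (y s) *v v s)"
      unfolding T_def by (simp add: integral_diff[OF ii[OF x] ii[OF y]])
    also have "norm \<dots> \<le> integral {0..t} (\<lambda>s. M * (L * norm (v s) * exp (K * s)))"
    proof (rule integral_norm_bound_integral)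
      show "(\<lambda>s. F (x s) *v v s - F (y s) *v v s) integrable_on {0..t}"
        by (intro integrable_diff ii x y)
      show "(\<lambda>s. M * (L * norm (v s) * exp (K * s))) integrable_on {0..t}"
        by (intro integrable_on_mult_right integral_kernel_exp_le(1)[OF h(5,1,2,3,4) K t])
      fix s assume "s \<in> {0..t}"
      hence s: "s \<in> {0..1}" using t by auto
      have "norm (F (x s) *v v s - F (y s) *v v s) \<le> norm (F (x s) - F (y s)) * norm (v s)"
        unfolding matrix_vector_mult_diff_rdistrib[symmetric] by (rule norm_matrix_vector_mult_le)
      also have "\<dots> \<le> (L * (M * exp (K * s))) * norm (v s)"
        by (intro mult_right_mono order_trans[OF Lip] mult_left_mono xy s L0) auto
      finally show "norm (F (x s) *v v s - F (y s) *v v s) \<le> M * (L * norm (v s) * exp (K * s))"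
        by (simp add: mult_ac)
    qed
    also have "\<dots> = M * integral {0..t} (\<lambda>s. L * norm (v s) * exp (K * s))" by simp
    also have "\<dots> \<le> M * (exp (K * t) / 2)"
      by (intro mult_left_mono integral_kernel_exp_le(2)[OF h(5,1,2,3,4) K t] M)
    finally show "norm (T x t - T y t) \<le> M * (exp (K * t) / 2)" .
  qed auto
  then obtain x where x: "continuous_on {0..1} x" "\<And>t. t \<in> {0..1} \<Longrightarrow> x t = T x t" by blast
  have "((\<lambda>s. F (x s) *v v s) has_integral (x t - x0)) {0..t}" if t: "t \<in> {0..1}" for t
  proof -
    have "(\<lambda>s. F (x s) *v v s) integrable_on {0..t}"
      by (rule integrable_on_unit_subinterval[OF int[OF x(1)]]) (use t in auto)
    then show ?thesis using x(2)[OF t] by (simp add: T_def has_integral_iff)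
  qed
  with x(1) show ?thesis unfolding traj_def by blast
qed

lemma traj_D:
  assumes "traj v x"
  shows "continuous_on {0..1} x" "x 0 = x0" "t \<in> {0..1} \<Longrightarrow> x t = x0 + integral {0..t} (\<lambda>s. F (x s) *v v s)"
proof -
  show "continuous_on {0..1} x" using assms unfolding traj_def by blast
  have i: "((\<lambda>s. F (x s) *v v s) has_integral (x t - x0)) {0..t}" if "t \<in> {0..1}" for t
    using assms that unfolding traj_def by blast
  show e: "x t = x0 + integral {0..t} (\<lambda>s. F (x s) *v v s)" if "t \<in> {0..1}" for t
    using integral_unique[OF i[OF that]] by simp
  show "x 0 = x0" using e[of 0] by simp
qed

text \<open>The estimate is deliberately asymmetric. A bound on \<open>F\<close> is asked for along
  \<open>y\<close> only and the exponent involves \<open>v\<close> only, so a reference trajectory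
  can be compared with one about which nothing is known yet.\<close>

lemma traj_diff_le:
  assumes v: "v \<in> L2" and w: "w \<in> L2" and x: "traj v x" and y: "traj w y"
    and C: "\<And>s. s \<in> {0..1} \<Longrightarrow> norm (F (y s)) \<le> C" and t: "t \<in> {0..1}"
  shows "norm (x t - y t) \<le> 2 * (C * L2norm (\<lambda>s. v s - w s)) * exp (2 * (L * L2norm v)\<^sup>2 + 1)"
proof -
  note xc = traj_D(1)[OF x] and yc = traj_D(1)[OF y]
  have C0: "C \<ge> 0" using order_trans[OF norm_ge_zero C[of 0]] by simp
  note vw = L2_diff[OF v w]
  note h = kernel_norm[OF v L0]
  have int: "(\<lambda>s. F (x s) *v v s) integrable_on {0..1}" "(\<lambda>s. F (y s) *v w s) integrable_on {0..1}"
    using rhs_integrable[OF v xc] rhs_integrable[OF w yc] by (simp_all add: absolutely_integrable_on_def)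
  show ?thesis
  proof (rule gronwall_L2_kernel[OF _ h(5,1,2,3,4) _ _ t])
    show "continuous_on {0..1} (\<lambda>t. x t - y t)" by (intro continuous_intros xc yc)
    show "0 \<le> C * L2norm (\<lambda>s. v s - w s)" using C0 L2norm_nonneg[of "\<lambda>s. v s - w s"] by simp
    fix t :: real assume t: "t \<in> {0..1}"
    hence sub: "{0..t} \<subseteq> {0..1}" by auto
    note ii = integrable_on_unit_subinterval[OF _ sub]
    have hz: "(\<lambda>s. L * norm (v s) * norm (x s - y s)) integrable_on {0..1}"
    proof -
      have "(\<lambda>s. norm (x s - y s) * (L * norm (v s))) absolutely_integrable_on {0..1}"
      proof (rule absolutely_integrable_bounded_measurable_product_real)
        show "(\<lambda>s. L * norm (v s)) absolutely_integrable_on {0..1}"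
          by (rule nonnegative_absolutely_integrable_1[OF h(1)]) (rule h(5))
        show "bounded ((\<lambda>s. norm (x s - y s)) ` {0..1})"
          by (intro compact_imp_bounded compact_continuous_image continuous_intros xc yc) auto
        show "(\<lambda>s. norm (x s - y s)) \<in> borel_measurable (lebesgue_on {0..1})"
          by (intro continuous_imp_measurable_on_sets_lebesgue continuous_intros xc yc) auto
      qed auto
      then show ?thesis by (simp add: absolutely_integrable_on_def mult_ac)
    qed
    have "x t - y t = integral {0..t} (\<lambda>s. F (x s) *v v s - F (y s) *v w s)"
      unfolding traj_D(3)[OF x t] traj_D(3)[OF y t] by (simp add: integral_diff ii int)
    also have "norm \<dots> \<le> integral {0..t} (\<lambda>s. C * norm (v s - w s) + L * norm (v s) * norm (x s - y s))"
    proof (rule integral_norm_bound_integral)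
      show "(\<lambda>s. F (x s) *v v s - F (y s) *v w s) integrable_on {0..t}"
        by (intro integrable_diff ii int)
      show "(\<lambda>s. C * norm (v s - w s) + L * norm (v s) * norm (x s - y s)) integrable_on {0..t}"
        by (intro integrable_add integrable_on_mult_right ii[OF hz] ii[OF L2_norm(1)[OF vw]])
      fix s assume "s \<in> {0..t}"
      hence s: "s \<in> {0..1}" using t by auto
      have "F (x s) *v v s - F (y s) *v w s = F (y s) *v (v s - w s) + (F (x s) - F (y s)) *v v s"
        by (simp add: matrix_vector_mult_diff_rdistrib matrix_vector_mult_diff_distrib)
      also have "norm \<dots> \<le> norm (F (y s)) * norm (v s - w s) + norm (F (x s) - F (y s)) * norm (v s)"
        by (intro order_trans[OF norm_triangle_ineq] add_mono norm_matrix_vector_mult_le)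
      also have "\<dots> \<le> C * norm (v s - w s) + (L * norm (x s - y s)) * norm (v s)"
        by (intro add_mono mult_right_mono C[OF s] Lip) auto
      finally show "norm (F (x s) *v v s - F (y s) *v w s) \<le> C * norm (v s - w s) + L * norm (v s) * norm (x s - y s)"
        by (simp add: mult_ac)
    qed
    also have "\<dots> = C * integral {0..t} (\<lambda>s. norm (v s - w s)) + integral {0..t} (\<lambda>s. L * norm (v s) * norm (x s - y s))"
      by (subst integral_add) (auto intro!: integrable_on_mult_right ii[OF hz] ii[OF L2_norm(1)[OF vw]])
    also have "integral {0..t} (\<lambda>s. norm (v s - w s)) \<le> L2norm (\<lambda>s. v s - w s)"
      using integral_subset_le[OF sub ii[OF L2_norm(1)[OF vw]] L2_norm(1)[OF vw]] L2_norm(2)[OF vw] by auto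
    finally show "norm (x t - y t) \<le> C * L2norm (\<lambda>s. v s - w s) + integral {0..t} (\<lambda>s. L * norm (v s) * norm (x s - y s))"
      using C0 by (simp add: mult_left_mono)
  qed
qed

lemma traj_unique:
  assumes v: "v \<in> L2" and x: "traj v x" and y: "traj v y" and t: "t \<in> {0..1}"
  shows "x t = y t"
proof -
  obtain C where C: "C \<ge> 0" "\<And>s. s \<in> {0..1} \<Longrightarrow> norm (F (y s)) \<le> C"
    using continuous_bounded_interval[OF F_comp_cont[OF traj_D(1)[OF y]]] by blast
  have "norm (x t - y t) \<le> 2 * (C * L2norm (\<lambda>s. v s - v s)) * exp (2 * (L * L2norm v)\<^sup>2 + 1)"
    by (rule traj_diff_le[OF v v x y C(2) t])
  then show ?thesis by (simp add: L2norm_def)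
qed

lemma traj_end_eq:
  assumes v: "v \<in> L2" and x: "traj v x"
  shows "traj_end F x0 v = x 1"
  unfolding traj_end_def
proof (rule the_equality)
  show "\<exists>y. continuous_on {0..1} y \<and> (\<forall>t\<in>{0..1}. ((\<lambda>s. F (y s) *v v s) has_integral (y t - x0)) {0..t}) \<and> y 1 = x 1"
    using x unfolding traj_def by blast
  fix e
  assume "\<exists>y. continuous_on {0..1} y \<and> (\<forall>t\<in>{0..1}. ((\<lambda>s. F (y s) *v v s) has_integral (y t - x0)) {0..t}) \<and> y 1 = e"
  then obtain y where y: "traj v y" "y 1 = e" unfolding traj_def by blast
  then show "e = x 1" using traj_unique[OF v y(1) x, of 1] by simp
qed

text \<open>Two comparisons. Against the fixed trajectory \<open>x\<close>, the preceding estimate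
  bounds \<open>F\<close> along every trajectory whose control is within distance one of
  \<open>u\<close>; with this uniform bound it applies to any two such trajectories.\<close>

lemma traj_locally_lipschitz:
  assumes u: "u \<in> L2" and x: "traj u x"
  obtains K where "K > 0"
    "\<And>v w y z t. v \<in> L2 \<Longrightarrow> w \<in> L2 \<Longrightarrow> L2norm (\<lambda>s. v s - u s) \<le> 1 \<Longrightarrow> L2norm (\<lambda>s. w s - u s) \<le> 1 \<Longrightarrow>
       traj v y \<Longrightarrow> traj w z \<Longrightarrow> t \<in> {0..1} \<Longrightarrow> norm (y t - z t) \<le> K * L2norm (\<lambda>s. v s - w s)"
proof -
  obtain C where C: "C \<ge> 0" "\<And>s. s \<in> {0..1} \<Longrightarrow> norm (F (x s)) \<le> C"
    using continuous_bounded_interval[OF F_comp_cont[OF traj_D(1)[OF x]]] by blast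
  define E where "E = exp (2 * (L * (L2norm u + 1))\<^sup>2 + 1)"
  \<comment> \<open>The bound along \<open>x\<close>, plus \<open>L\<close> times the largest
    displacement \<open>2 * C * E\<close> from \<open>x\<close>.\<close>
  define C1 where "C1 = C + L * (2 * C * E)"
  have Ele: "exp (2 * (L * L2norm v)\<^sup>2 + 1) \<le> E" if "v \<in> L2" "L2norm (\<lambda>s. v s - u s) \<le> 1" for v
  proof -
    have "L2norm v \<le> L2norm (\<lambda>s. v s - u s) + L2norm u"
      using L2norm_triangle[OF L2_diff[OF that(1) u] u] by simp
    hence "L * L2norm v \<le> L * (L2norm u + 1)" using that by (intro mult_left_mono L0) auto
    hence "(L * L2norm v)\<^sup>2 \<le> (L * (L2norm u + 1))\<^sup>2"
      using L0 L2norm_nonneg[of v] by (intro power_mono) auto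
    then show ?thesis unfolding E_def by simp
  qed
  have E: "E > 0" unfolding E_def by simp
  have C1: "C1 \<ge> 0" unfolding C1_def using C L0 E by simp
  have Fz: "norm (F (z s)) \<le> C1"
    if w: "w \<in> L2" and wu: "L2norm (\<lambda>s. w s - u s) \<le> 1" and z: "traj w z" and s: "s \<in> {0..1}" for w z s
  proof -
    have "norm (z s - x s) \<le> 2 * (C * L2norm (\<lambda>s. w s - u s)) * exp (2 * (L * L2norm w)\<^sup>2 + 1)"
      by (rule traj_diff_le[OF w u z x C(2) s])
    also have "\<dots> \<le> 2 * (C * 1) * E"
      using C(1) wu L2norm_nonneg[of "\<lambda>s. w s - u s"] by (intro mult_mono Ele w mult_left_mono) auto
    finally have "norm (z s - x s) \<le> 2 * C * E" by simp
    hence "norm (F (z s) - F (x s)) \<le> L * (2 * C * E)"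
      by (intro order_trans[OF Lip] mult_left_mono L0)
    then show ?thesis
      using norm_triangle_ineq[of "F (z s) - F (x s)" "F (x s)"] C(2)[OF s] by (simp add: C1_def)
  qed
  show ?thesis
  proof (rule that[of "2 * C1 * E + 1"])
    show "2 * C1 * E + 1 > 0" using C1 E by (simp add: add_nonneg_pos)
    fix v w y z and t :: real
    assume v: "v \<in> L2" "L2norm (\<lambda>s. v s - u s) \<le> 1" "traj v y"
      and w: "w \<in> L2" "L2norm (\<lambda>s. w s - u s) \<le> 1" "traj w z" and t: "t \<in> {0..1}"
    have "norm (y t - z t) \<le> 2 * (C1 * L2norm (\<lambda>s. v s - w s)) * exp (2 * (L * L2norm v)\<^sup>2 + 1)"
      by (rule traj_diff_le[OF v(1) w(1) v(3) w(3) Fz[OF w] t])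
    also have "\<dots> \<le> 2 * (C1 * L2norm (\<lambda>s. v s - w s)) * E"
      using C1 L2norm_nonneg[of "\<lambda>s. v s - w s"] by (intro mult_left_mono Ele v) auto
    also have "\<dots> \<le> (2 * C1 * E + 1) * L2norm (\<lambda>s. v s - w s)"
      using L2norm_nonneg[of "\<lambda>s. v s - w s"] by (simp add: algebra_simps)
    finally show "norm (y t - z t) \<le> (2 * C1 * E + 1) * L2norm (\<lambda>s. v s - w s)" .
  qed
qed

section \<open>The adjoint equation and the expansion of the endpoint\<close>

lemma adj_rhs_integrable:
  assumes u: "u \<in> L2" and x: "continuous_on {0..1} x" and p: "continuous_on {0..1} p"
  shows "(\<lambda>s. adj_rhs D (x s) (u s) (p s)) absolutely_integrable_on {0..1}"
  unfolding adj_rhs_def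
proof (rule absolutely_integrable_sum)
  fix i
  show "(\<lambda>s. (p s \<bullet> (D i (x s) *v u s)) *\<^sub>R axis i (1::real)) absolutely_integrable_on {0..1}"
    by (intro absolutely_integrable_scaleR_right absolutely_integrable_continuous_inner
        absolutely_integrable_matrix_vector D_comp_cont u x p)
qed simp

text \<open>A linear integral equation running backwards from time one, solved by the same fixed
  point argument with the decreasing weight \<open>exp (- K * t)\<close>.\<close>

lemma adjoint_exists:
  assumes u: "u \<in> L2" and x: "continuous_on {0..1} x"
  shows "\<exists>p. continuous_on {0..1} p \<and>
    (\<forall>t\<in>{0..1}. p t = p1 + integral {t..1} (\<lambda>s. adj_rhs D (x s) (u s) (p s)))"
proof -
  obtain d where d: "d \<ge> 0" "\<And>s. s \<in> {0..1} \<Longrightarrow> (\<Sum>i\<in>UNIV. norm (D i (x s))) \<le> d"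
    using D_sum_bounded[OF x] by blast
  define R where "R = d * L2norm u"
  define K where "K = 2 * R\<^sup>2 + 1"
  have K: "K \<ge> 2 * R\<^sup>2" "K > 0" unfolding K_def by (auto intro: add_nonneg_pos)
  define T where "T p t = p1 + integral {t..1} (\<lambda>s. adj_rhs D (x s) (u s) (p s))" for p and t :: real
  note h = kernel_norm[OF u d(1), folded R_def]
  have int: "(\<lambda>s. adj_rhs D (x s) (u s) (p s)) integrable_on {0..1}" if "continuous_on {0..1} p" for p
    using adj_rhs_integrable[OF u x that] by (simp add: absolutely_integrable_on_def)
  have "\<exists>p. continuous_on {0..1} p \<and> (\<forall>t\<in>{0..1}. p t = T p t)"
  proof (rule weighted_contraction_fixpoint)
    show "continuous_on {0..1} (\<lambda>t. exp (- K * t))" by (intro continuous_intros)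
    show "continuous_on {0..1} (T p)" if "continuous_on {0..1} p" for p
      unfolding T_def by (intro continuous_intros indefinite_integral_continuous_1' int that)
    fix p q :: "real \<Rightarrow> real^'n" and M t :: real
    assume p: "continuous_on {0..1} p" and q: "continuous_on {0..1} q" and M: "M \<ge> 0"
      and pq: "\<And>s. s \<in> {0..1} \<Longrightarrow> norm (p s - q s) \<le> M * exp (- K * s)" and t: "t \<in> {0..1}"
    have sub: "{t..1} \<subseteq> {0..1}" using t by auto
    note ii = integrable_on_unit_subinterval[OF int sub]
    have "T p t - T q t = integral {t..1} (\<lambda>s. adj_rhs D (x s) (u s) (p s) - adj_rhs D (x s) (u s) (q s))"
      unfolding T_def by (simp add: integral_diff[OF ii[OF p] ii[OF q]])
    also have "norm \<dots> \<le> integral {t..1} (\<lambda>s. M * (d * norm (u s) * exp (- K * s)))"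
    proof (rule integral_norm_bound_integral)
      show "(\<lambda>s. adj_rhs D (x s) (u s) (p s) - adj_rhs D (x s) (u s) (q s)) integrable_on {t..1}"
        by (intro integrable_diff ii p q)
      show "(\<lambda>s. M * (d * norm (u s) * exp (- K * s))) integrable_on {t..1}"
        by (intro integrable_on_mult_right integral_kernel_exp_le(3)[OF h(5,1,2,3,4) K t])
      fix s assume "s \<in> {t..1}"
      hence s: "s \<in> {0..1}" using t by auto
      have "norm (adj_rhs D (x s) (u s) (p s) - adj_rhs D (x s) (u s) (q s)) \<le>
         (\<Sum>i\<in>UNIV. norm (D i (x s))) * norm (u s) * norm (p s - q s)"
        unfolding adj_rhs_diff by (rule norm_adj_rhs_le)
      also have "\<dots> \<le> d * norm (u s) * (M * exp (- K * s))"
        by (intro mult_mono d(2) pq s) (use d(1) in auto)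
      finally show "norm (adj_rhs D (x s) (u s) (p s) - adj_rhs D (x s) (u s) (q s)) \<le> M * (d * norm (u s) * exp (- K * s))"
        by (simp add: mult_ac)
    qed
    also have "\<dots> = M * integral {t..1} (\<lambda>s. d * norm (u s) * exp (- K * s))" by simp
    also have "\<dots> \<le> M * (exp (- K * t) / 2)"
      by (intro mult_left_mono integral_kernel_exp_le(4)[OF h(5,1,2,3,4) K t] M)
    finally show "norm (T p t - T q t) \<le> M * (exp (- K * t) / 2)" .
  qed auto
  then show ?thesis unfolding T_def by blast
qed

text \<open>The difference of two trajectories is paired with the costate of the base control.
  Integration by parts then cancels its first-order contribution through the dynamics, so that no
  linearised state equation has to be solved; what is left is small times the distance of the
  controls.\<close>

lemma endpoint_strict_derivative:
  assumes u: "u \<in> L2" and x: "traj u x" and pc: "continuous_on {0..1} p"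
    and p: "\<And>t. t \<in> {0..1} \<Longrightarrow> p t = p1 + integral {t..1} (\<lambda>s. adj_rhs D (x s) (u s) (p s))"
    and eps: "\<epsilon> > 0"
  shows "\<exists>\<delta>>0. \<forall>v w y z. v \<in> L2 \<longrightarrow> w \<in> L2 \<longrightarrow> L2norm (\<lambda>s. v s - u s) < \<delta> \<longrightarrow>
     L2norm (\<lambda>s. w s - u s) < \<delta> \<longrightarrow> traj v y \<longrightarrow> traj w z \<longrightarrow>
     \<bar>p1 \<bullet> (y 1 - z 1) - integral {0..1} (\<lambda>s. p s \<bullet> (F (x s) *v (v s - w s)))\<bar> \<le> \<epsilon> * L2norm (\<lambda>s. v s - w s)"
proof -
  obtain K where K: "K > 0" and Klip: "\<And>v w y z t. v \<in> L2 \<Longrightarrow> w \<in> L2 \<Longrightarrow> L2norm (\<lambda>s. v s - u s) \<le> 1 \<Longrightarrow> L2norm (\<lambda>s. w s - u s) \<le> 1 \<Longrightarrow>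
       traj v y \<Longrightarrow> traj w z \<Longrightarrow> t \<in> {0..1} \<Longrightarrow> norm (y t - z t) \<le> K * L2norm (\<lambda>s. v s - w s)"
    using traj_locally_lipschitz[OF u x] by blast
  note xc = traj_D(1)[OF x]
  obtain d where d: "d \<ge> 0" "\<And>s. s \<in> {0..1} \<Longrightarrow> (\<Sum>i\<in>UNIV. norm (D i (x s))) \<le> d"
    using D_sum_bounded[OF xc] by blast
  obtain R where R: "\<And>s. s \<in> {0..1} \<Longrightarrow> norm (x s) \<le> R"
    using continuous_bounded_interval[OF xc] by blast
  obtain \<Lambda> where \<Lambda>: "\<Lambda> \<ge> 0" "\<And>s. s \<in> {0..1} \<Longrightarrow> norm (p s) \<le> \<Lambda>"
    using continuous_bounded_interval[OF pc] by blast
  define N where "N = L2norm u + 1"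
  have N: "N > 0" unfolding N_def using L2norm_nonneg[of u] by simp
  \<comment> \<open>The summands \<open>L\<close>, \<open>N\<close> and \<open>d\<close> belong to
    the three error terms: the change of \<open>F\<close> between \<open>x\<close> and
    \<open>y\<close>, the strict remainder acting on \<open>w\<close>, and the derivative acting on
    \<open>w - u\<close>.\<close>
  define Q where "Q = \<Lambda> * K * (L + N + d) + 1"
  have Q: "Q > 0" unfolding Q_def using \<Lambda> K L0 N d by (simp add: add_nonneg_pos)
  define \<epsilon>1 where "\<epsilon>1 = \<epsilon> / Q"
  have \<epsilon>1: "\<epsilon>1 > 0" unfolding \<epsilon>1_def using eps Q by simp
  obtain \<delta>1 where \<delta>1: "\<delta>1 > 0" and st: "\<And>c p q. norm c \<le> R \<Longrightarrow> norm (p - c) \<le> \<delta>1 \<Longrightarrow> norm (q - c) \<le> \<delta>1 \<Longrightarrow>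
        norm (F p - F q - (\<Sum>i\<in>UNIV. (p - q) $ i *\<^sub>R D i c)) \<le> \<epsilon>1 * norm (p - q)"
    using strict[OF \<epsilon>1, of R] by blast
  \<comment> \<open>One for the local Lipschitz bound, \<open>\<epsilon>1\<close> for the size of
    the control differences, and \<open>\<delta>1 / K\<close> to keep \<open>y\<close> and
    \<open>z\<close> within the range of \<open>strict\<close> around \<open>x\<close>.\<close>
  define \<delta> where "\<delta> = min 1 (min \<epsilon>1 (\<delta>1 / K))"
  have "\<delta> \<le> \<delta>1 / K" unfolding \<delta>_def by simp
  hence "K * \<delta> \<le> \<delta>1" using K by (simp add: field_simps)
  moreover have "\<delta> > 0" "\<delta> \<le> 1" "\<delta> \<le> \<epsilon>1"
    unfolding \<delta>_def using \<epsilon>1 \<delta>1 K by auto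
  ultimately have \<delta>: "\<delta> > 0" "\<delta> \<le> 1" "\<delta> \<le> \<epsilon>1" "K * \<delta> \<le> \<delta>1" by auto
  show ?thesis
  proof (intro exI[of _ \<delta>] conjI allI impI)
    fix v w y z
    assume v: "v \<in> L2" and w: "w \<in> L2" and vu: "L2norm (\<lambda>s. v s - u s) < \<delta>" and wu: "L2norm (\<lambda>s. w s - u s) < \<delta>"
      and y: "traj v y" and z: "traj w z"
    note yc = traj_D(1)[OF y] and zc = traj_D(1)[OF z]
    note vw = L2_diff[OF v w] and wul = L2_diff[OF w u]
    define m where "m = L2norm (\<lambda>s. v s - w s)"
    have m0: "m \<ge> 0" unfolding m_def by (rule L2norm_nonneg)
    have wN: "L2norm w \<le> N"
      using L2norm_triangle[OF L2_diff[OF w u] u] wu \<delta> by (simp add: N_def)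
    define \<zeta> where "\<zeta> t = y t - z t" for t
    have \<zeta>: "norm (\<zeta> t) \<le> K * m" if "t \<in> {0..1}" for t
      unfolding \<zeta>_def m_def using Klip[OF v w _ _ y z that] vu wu \<delta> by simp
    have yx: "norm (y t - x t) \<le> K * \<delta>" and zx: "norm (z t - x t) \<le> K * \<delta>" if "t \<in> {0..1}" for t
    proof -
      have "norm (y t - x t) \<le> K * L2norm (\<lambda>s. v s - u s)"
        using Klip[OF v u _ _ y x that] vu \<delta> by simp
      also have "\<dots> \<le> K * \<delta>" using K vu by simp
      finally show "norm (y t - x t) \<le> K * \<delta>" .
      have "norm (z t - x t) \<le> K * L2norm (\<lambda>s. w s - u s)"
        using Klip[OF w u _ _ z x that] wu \<delta> by simp
      also have "\<dots> \<le> K * \<delta>" using K wu by simp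
      finally show "norm (z t - x t) \<le> K * \<delta>" .
    qed
    define P where "P s = F (y s) *v v s - F (z s) *v w s" for s
    define q where "q s = - adj_rhs D (x s) (u s) (p s)" for s
    have Pint: "P absolutely_integrable_on {0..1}"
      unfolding P_def by (intro set_integral_diff rhs_integrable v w yc zc)
    have aint: "(\<lambda>s. adj_rhs D (x s) (u s) (p s)) absolutely_integrable_on {0..1}"
      by (rule adj_rhs_integrable[OF u xc pc])
    have qint: "q absolutely_integrable_on {0..1}"
      unfolding q_def using absolutely_integrable_scaleR_left[OF aint, of "-1"] by simp
    have \<zeta>0: "\<zeta> 0 = 0" unfolding \<zeta>_def using traj_D(2)[OF y] traj_D(2)[OF z] by simp
    have \<zeta>1: "\<zeta> 1 = y 1 - z 1" unfolding \<zeta>_def ..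
    have \<zeta>P: "\<zeta> t = \<zeta> 0 + integral {0..t} P" if "t \<in> {0..1}" for t
    proof -
      have "(\<lambda>s. F (y s) *v v s) integrable_on {0..t}" "(\<lambda>s. F (z s) *v w s) integrable_on {0..t}"
        using that rhs_integrable[OF v yc] rhs_integrable[OF w zc]
        by (auto intro!: integrable_on_unit_subinterval simp: absolutely_integrable_on_def)
      then show ?thesis
        unfolding \<zeta>0 P_def by (simp add: \<zeta>_def traj_D(3)[OF y that] traj_D(3)[OF z that] integral_diff)
    qed
    have pq: "p t = p 0 + integral {0..t} q" if "t \<in> {0..1}" for t
    proof -
      have ai: "(\<lambda>s. adj_rhs D (x s) (u s) (p s)) integrable_on {0..1}"
        using aint by (simp add: absolutely_integrable_on_def)
      have "integral {0..t} (\<lambda>s. adj_rhs D (x s) (u s) (p s)) + integral {t..1} (\<lambda>s. adj_rhs D (x s) (u s) (p s))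
          = integral {0..1} (\<lambda>s. adj_rhs D (x s) (u s) (p s))"
        using that by (intro Henstock_Kurzweil_Integration.integral_combine ai) auto
      then show ?thesis
        using p[OF that] p[of 0] unfolding q_def by (simp add: algebra_simps)
    qed
    have \<zeta>c: "continuous_on {0..1} \<zeta>" unfolding \<zeta>_def by (intro continuous_intros yc zc)
    have "integral {0..1} (\<lambda>s. \<zeta> s \<bullet> q s + p s \<bullet> P s) = \<zeta> 1 \<bullet> p 1 - \<zeta> 0 \<bullet> p 0"
      by (rule indefinite_integral_product_rule[OF Pint qint \<zeta>P pq])
    moreover have "p 1 = p1" using p[of 1] by simp
    ultimately have I1: "integral {0..1} (\<lambda>s. \<zeta> s \<bullet> q s + p s \<bullet> P s) = p1 \<bullet> (y 1 - z 1)"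
      by (simp add: \<zeta>0 \<zeta>1 inner_commute)
    define G where "G s = p s \<bullet> (F (x s) *v (v s - w s))" for s
    have Gi: "G integrable_on {0..1}"
      unfolding G_def using absolutely_integrable_continuous_inner[OF rhs_integrable[OF vw xc] pc]
      by (simp add: absolutely_integrable_on_def)
    have Hi: "(\<lambda>s. \<zeta> s \<bullet> q s + p s \<bullet> P s) integrable_on {0..1}"
      using absolutely_integrable_continuous_inner[OF qint \<zeta>c] absolutely_integrable_continuous_inner[OF Pint pc]
      by (intro integrable_add) (auto simp: absolutely_integrable_on_def)
    define B where "B s = (\<Lambda> * L * K * \<delta>) * norm (v s - w s) + (\<Lambda> * \<epsilon>1 * (K * m)) * norm (w s) + (\<Lambda> * d * (K * m)) * norm (w s - u s)" for s
    have Bi: "B integrable_on {0..1}"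
      unfolding B_def by (intro integrable_add integrable_on_mult_right L2_norm(1) vw wul w)
    have pt: "norm ((\<zeta> s \<bullet> q s + p s \<bullet> P s) - G s) \<le> B s" if s: "s \<in> {0..1}" for s
    proof -
      define DD where "DD = (\<Sum>i\<in>UNIV. \<zeta> s $ i *\<^sub>R D i (x s))"
      have DD: "norm DD \<le> d * (K * m)"
      proof -
        have "norm DD \<le> (\<Sum>i\<in>UNIV. norm (\<zeta> s) * norm (D i (x s)))"
          unfolding DD_def by (intro order_trans[OF norm_sum] sum_mono)
            (auto intro!: mult_right_mono component_le_norm_cart)
        also have "\<dots> = (\<Sum>i\<in>UNIV. norm (D i (x s))) * norm (\<zeta> s)"
          by (simp add: sum_distrib_left[symmetric] mult.commute)
        also have "\<dots> \<le> d * (K * m)" using d \<zeta>[OF s] s by (intro mult_mono) auto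
        finally show ?thesis .
      qed
      have F1: "norm (F (y s) - F (x s)) \<le> L * (K * \<delta>)"
        by (rule order_trans[OF Lip]) (intro mult_left_mono yx s L0)
      have "norm (F (y s) - F (z s) - DD) \<le> \<epsilon>1 * norm (\<zeta> s)"
        unfolding DD_def \<zeta>_def using yx[OF s] zx[OF s] \<delta>(4) by (intro st R s) auto
      also have "\<dots> \<le> \<epsilon>1 * (K * m)" using \<epsilon>1 \<zeta>[OF s] by (intro mult_left_mono) auto
      finally have F2: "norm (F (y s) - F (z s) - DD) \<le> \<epsilon>1 * (K * m)" .
      \<comment> \<open>Adding and subtracting \<open>DD *v w s\<close> leaves three terms, each
        with a small factor: the first is small because \<open>y\<close> is near \<open>x\<close>,
        the second by strict differentiability, the third because \<open>w\<close> is near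
        \<open>u\<close>.\<close>
      have "(\<zeta> s \<bullet> q s + p s \<bullet> P s) - G s = p s \<bullet>
         ((F (y s) - F (x s)) *v (v s - w s) + (F (y s) - F (z s) - DD) *v w s + DD *v (w s - u s))"
        unfolding q_def inner_minus_right inner_adj_rhs DD_def[symmetric] P_def G_def
        by (simp add: matrix_vector_mult_diff_rdistrib matrix_vector_mult_diff_distrib inner_diff_right inner_add_right)
      also have "norm \<dots> \<le> norm (p s) * norm ((F (y s) - F (x s)) *v (v s - w s) + (F (y s) - F (z s) - DD) *v w s + DD *v (w s - u s))"
        by (simp add: Cauchy_Schwarz_ineq2)
      also have "\<dots> \<le> \<Lambda> * (L * (K * \<delta>) * norm (v s - w s) + \<epsilon>1 * (K * m) * norm (w s) + d * (K * m) * norm (w s - u s))"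
      proof (rule mult_mono)
        show "norm ((F (y s) - F (x s)) *v (v s - w s) + (F (y s) - F (z s) - DD) *v w s + DD *v (w s - u s))
          \<le> L * (K * \<delta>) * norm (v s - w s) + \<epsilon>1 * (K * m) * norm (w s) + d * (K * m) * norm (w s - u s)"
          by (intro order_trans[OF norm_triangle_ineq] add_mono order_trans[OF norm_matrix_vector_mult_le]
              mult_right_mono F1 F2 DD norm_ge_zero)
      qed (use \<Lambda> s in auto)
      finally show ?thesis unfolding B_def by (simp add: algebra_simps)
    qed
    have e1: "p1 \<bullet> (y 1 - z 1) - integral {0..1} G = integral {0..1} (\<lambda>s. (\<zeta> s \<bullet> q s + p s \<bullet> P s) - G s)"
      unfolding I1[symmetric] by (rule integral_diff[symmetric, OF Hi Gi])
    have "norm (p1 \<bullet> (y 1 - z 1) - integral {0..1} G) \<le> integral {0..1} B"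
      unfolding e1 by (rule integral_norm_bound_integral[OF integrable_diff[OF Hi Gi] Bi pt])
    also have "integral {0..1} B = (\<Lambda> * L * K * \<delta>) * integral {0..1} (\<lambda>s. norm (v s - w s)) +
       (\<Lambda> * \<epsilon>1 * (K * m)) * integral {0..1} (\<lambda>s. norm (w s)) + (\<Lambda> * d * (K * m)) * integral {0..1} (\<lambda>s. norm (w s - u s))"
      unfolding B_def by (rule integral_unique, rule has_integral_add, rule has_integral_add)
        (rule has_integral_mult_right[OF integrable_integral], rule L2_norm(1), fact)+
    also have "\<dots> \<le> (\<Lambda> * L * K * \<epsilon>1) * m + (\<Lambda> * \<epsilon>1 * (K * m)) * N + (\<Lambda> * d * (K * m)) * \<epsilon>1"
    proof (intro add_mono mult_mono[OF _ _ _ integral_nonneg])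
      show "integral {0..1} (\<lambda>s. norm (v s - w s)) \<le> m" unfolding m_def by (rule L2_norm(2)[OF vw])
      show "integral {0..1} (\<lambda>s. norm (w s)) \<le> N" using L2_norm(2)[OF w] wN by simp
      show "integral {0..1} (\<lambda>s. norm (w s - u s)) \<le> \<epsilon>1" using L2_norm(2)[OF wul] wu \<delta> by simp
      show "\<Lambda> * L * K * \<delta> \<le> \<Lambda> * L * K * \<epsilon>1" using \<Lambda> L0 K \<delta> by (intro mult_left_mono) auto
    qed (use \<Lambda> L0 K \<epsilon>1 d m0 L2_norm(1)[OF vw] L2_norm(1)[OF w] L2_norm(1)[OF wul] in auto)
    also have "\<dots> = (\<Lambda> * K * (L + N + d)) * \<epsilon>1 * m" by (simp add: algebra_simps)
    also have "\<dots> \<le> Q * \<epsilon>1 * m" using \<epsilon>1 m0 by (intro mult_right_mono) (auto simp: Q_def)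
    also have "\<dots> = \<epsilon> * m" using Q by (simp add: \<epsilon>1_def)
    finally show "\<bar>p1 \<bullet> (y 1 - z 1) - integral {0..1} (\<lambda>s. p s \<bullet> (F (x s) *v (v s - w s)))\<bar> \<le> \<epsilon> * L2norm (\<lambda>s. v s - w s)"
      unfolding m_def G_def by simp
  qed (rule \<delta>)
qed

end

section \<open>Strict differentiability of the cost\<close>

context control_system begin

text \<open>Three expansions add up: that of the quadratic term, that of \<open>a\<close> at the
  endpoint of \<open>x\<close>, and that of the endpoint paired with \<open>p1\<close>. The product
  \<open>p s v* F (x s)\<close> is the transpose of \<open>F (x s)\<close> applied to the costate,
  the L2 density of the third.\<close>

lemma cost_strict_derivative:
  fixes \<beta> :: real
  assumes u: "u \<in> L2" and x: "traj u x" and pc: "continuous_on {0..1} p"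
    and p: "\<And>t. t \<in> {0..1} \<Longrightarrow> p t = p1 + integral {t..1} (\<lambda>s. adj_rhs D (x s) (u s) (p s))"
    and a: "\<And>\<epsilon>. \<epsilon> > 0 \<Longrightarrow> \<exists>\<delta>>0. \<forall>y z. norm (y - x 1) \<le> \<delta> \<longrightarrow> norm (z - x 1) \<le> \<delta> \<longrightarrow>
        \<bar>a y - a z - p1 \<bullet> (y - z)\<bar> \<le> \<epsilon> * norm (y - z)"
  defines "g \<equiv> \<lambda>s. u s + \<beta> *\<^sub>R (p s v* F (x s))"
  shows "g \<in> L2"
    and "\<epsilon> > 0 \<Longrightarrow> \<exists>\<delta>>0. \<forall>v w. v \<in> L2 \<longrightarrow> w \<in> L2 \<longrightarrow> L2norm (\<lambda>s. v s - u s) < \<delta> \<longrightarrow>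
     L2norm (\<lambda>s. w s - u s) < \<delta> \<longrightarrow>
     \<bar>cost F x0 a \<beta> v - cost F x0 a \<beta> w - L2inner g (\<lambda>s. v s - w s)\<bar> \<le> \<epsilon> * L2norm (\<lambda>s. v s - w s)"
proof -
  define h where "h s = p s v* F (x s)" for s
  note xc = traj_D(1)[OF x]
  have "continuous_on {0..1} h"
    unfolding h_def vector_matrix_mult_def by (intro continuous_on_vec_lambda continuous_intros F_comp_cont xc pc)
  hence h: "h \<in> L2" by (rule continuous_L2)
  show g: "g \<in> L2" unfolding g_def h_def[symmetric] by (rule L2_add_scaleR[OF u h])
  assume eps: "\<epsilon> > 0"
  obtain K where K: "K > 0" and Klip: "\<And>v w y z t. v \<in> L2 \<Longrightarrow> w \<in> L2 \<Longrightarrow> L2norm (\<lambda>s. v s - u s) \<le> 1 \<Longrightarrow> L2norm (\<lambda>s. w s - u s) \<le> 1 \<Longrightarrow>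
       traj v y \<Longrightarrow> traj w z \<Longrightarrow> t \<in> {0..1} \<Longrightarrow> norm (y t - z t) \<le> K * L2norm (\<lambda>s. v s - w s)"
    using traj_locally_lipschitz[OF u x] by blast
  \<comment> \<open>One for the quadratic term; with factor \<open>\<bar>\<beta>\<bar>\<close>,
    \<open>K\<close> for the remainder of \<open>a\<close> and one for that of the endpoint.\<close>
  define Q where "Q = 1 + \<bar>\<beta>\<bar> * (K + 1)"
  have Q: "Q > 0" unfolding Q_def using K by (simp add: add_pos_nonneg)
  define e where "e = \<epsilon> / Q"
  have e: "e > 0" unfolding e_def using eps Q by simp
  obtain d1 where d1: "d1 > 0" and aa: "\<And>y z. norm (y - x 1) \<le> d1 \<Longrightarrow> norm (z - x 1) \<le> d1 \<Longrightarrow>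
        \<bar>a y - a z - p1 \<bullet> (y - z)\<bar> \<le> e * norm (y - z)" using a[OF e] by blast
  obtain d2 where d2: "d2 > 0" and ee: "\<And>v w y z. v \<in> L2 \<Longrightarrow> w \<in> L2 \<Longrightarrow> L2norm (\<lambda>s. v s - u s) < d2 \<Longrightarrow>
     L2norm (\<lambda>s. w s - u s) < d2 \<Longrightarrow> traj v y \<Longrightarrow> traj w z \<Longrightarrow>
     \<bar>p1 \<bullet> (y 1 - z 1) - integral {0..1} (\<lambda>s. p s \<bullet> (F (x s) *v (v s - w s)))\<bar> \<le> e * L2norm (\<lambda>s. v s - w s)"
    using endpoint_strict_derivative[OF u x pc p e] by blast
  define \<delta> where "\<delta> = min (min 1 e) (min d2 (d1 / K))"
  have "\<delta> \<le> d1 / K" unfolding \<delta>_def by simp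
  hence "K * \<delta> \<le> d1" using K by (simp add: field_simps)
  moreover have "\<delta> > 0" "\<delta> \<le> 1" "\<delta> \<le> e" "\<delta> \<le> d2"
    unfolding \<delta>_def using e d1 d2 K by auto
  ultimately have \<delta>: "\<delta> > 0" "\<delta> \<le> 1" "\<delta> \<le> e" "\<delta> \<le> d2" "K * \<delta> \<le> d1" by auto
  show "\<exists>\<delta>>0. \<forall>v w. v \<in> L2 \<longrightarrow> w \<in> L2 \<longrightarrow> L2norm (\<lambda>s. v s - u s) < \<delta> \<longrightarrow>
     L2norm (\<lambda>s. w s - u s) < \<delta> \<longrightarrow>
     \<bar>cost F x0 a \<beta> v - cost F x0 a \<beta> w - L2inner g (\<lambda>s. v s - w s)\<bar> \<le> \<epsilon> * L2norm (\<lambda>s. v s - w s)"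
  proof (intro exI[of _ \<delta>] conjI allI impI)
    fix v w
    assume v: "v \<in> L2" and w: "w \<in> L2" and vu: "L2norm (\<lambda>s. v s - u s) < \<delta>" and wu: "L2norm (\<lambda>s. w s - u s) < \<delta>"
    obtain y where y: "traj v y" using traj_exists[OF v] by blast
    obtain z where z: "traj w z" using traj_exists[OF w] by blast
    note vw = L2_diff[OF v w] and vuL = L2_diff[OF v u] and wuL = L2_diff[OF w u]
    define m where "m = L2norm (\<lambda>s. v s - w s)"
    have m0: "m \<ge> 0" unfolding m_def by (rule L2norm_nonneg)
    have one: "(1::real) \<in> {0..1}" by simp
    have yz: "norm (y 1 - z 1) \<le> K * m"
      unfolding m_def using vu wu \<delta> by (intro Klip[OF v w _ _ y z one]) auto
    have yx: "norm (y 1 - x 1) \<le> d1"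
    proof -
      have "norm (y 1 - x 1) \<le> K * L2norm (\<lambda>s. v s - u s)" using vu \<delta> by (intro Klip[OF v u _ _ y x one]) auto
      also have "\<dots> \<le> K * \<delta>" using K vu by simp
      finally show ?thesis using \<delta> by simp
    qed
    have zx: "norm (z 1 - x 1) \<le> d1"
    proof -
      have "norm (z 1 - x 1) \<le> K * L2norm (\<lambda>s. w s - u s)" using wu \<delta> by (intro Klip[OF w u _ _ z x one]) auto
      also have "\<dots> \<le> K * \<delta>" using K wu by simp
      finally show ?thesis using \<delta> by simp
    qed
    define A where "A = a (y 1) - a (z 1) - p1 \<bullet> (y 1 - z 1)"
    define E where "E = p1 \<bullet> (y 1 - z 1) - integral {0..1} (\<lambda>s. p s \<bullet> (F (x s) *v (v s - w s)))"
    define S where "S = (1/2) * (L2norm v)\<^sup>2 - (1/2) * (L2norm w)\<^sup>2 - L2inner u (\<lambda>s. v s - w s)"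
    have A: "\<bar>A\<bar> \<le> e * (K * m)"
      unfolding A_def using e by (intro order_trans[OF aa[OF yx zx]] mult_left_mono yz) auto
    have E: "\<bar>E\<bar> \<le> e * m"
      unfolding E_def m_def using vu wu \<delta> by (intro ee v w y z) auto
    \<comment> \<open>Half the difference of the squared norms is half the pairing of
      \<open>v + w\<close> with \<open>v - w\<close>; subtracting the pairing with \<open>u\<close>
      leaves the two small factors \<open>v - u\<close> and \<open>w - u\<close>.\<close>
    have "S = (1/2) * L2inner (\<lambda>s. v s - u s) (\<lambda>s. v s - w s) + (1/2) * L2inner (\<lambda>s. w s - u s) (\<lambda>s. v s - w s)"
      unfolding S_def L2inner_self[symmetric]
      using L2inner_diff_left[OF v u vw] L2inner_diff_left[OF w u vw] L2inner_diff_right[OF v w v]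
        L2inner_diff_right[OF v w w] L2inner_commute[of v w] by (simp add: algebra_simps)
    moreover have "\<bar>L2inner (\<lambda>s. v s - u s) (\<lambda>s. v s - w s)\<bar> \<le> e * m"
      unfolding m_def using vu \<delta> by (intro order_trans[OF L2inner_le[OF vuL vw]] mult_right_mono L2norm_nonneg) auto
    moreover have "\<bar>L2inner (\<lambda>s. w s - u s) (\<lambda>s. v s - w s)\<bar> \<le> e * m"
      unfolding m_def using wu \<delta> by (intro order_trans[OF L2inner_le[OF wuL vw]] mult_right_mono L2norm_nonneg) auto
    ultimately have S: "\<bar>S\<bar> \<le> e * m" by linarith
    have "L2inner h (\<lambda>s. v s - w s) = integral {0..1} (\<lambda>s. p s \<bullet> (F (x s) *v (v s - w s)))"
      using L2_inner(2)[OF h vw] unfolding h_def dot_lmul_matrix .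
    hence gi: "L2inner g (\<lambda>s. v s - w s) = L2inner u (\<lambda>s. v s - w s) + \<beta> * integral {0..1} (\<lambda>s. p s \<bullet> (F (x s) *v (v s - w s)))"
      unfolding g_def h_def[symmetric] using L2inner_add_scaleR_left[OF u h vw, of \<beta>] by simp
    have "cost F x0 a \<beta> v - cost F x0 a \<beta> w - L2inner g (\<lambda>s. v s - w s) = S + \<beta> * (A + E)"
      unfolding cost_def traj_end_eq[OF v y] traj_end_eq[OF w z] gi S_def A_def E_def by (simp add: algebra_simps)
    also have "\<bar>S + \<beta> * (A + E)\<bar> \<le> \<bar>S\<bar> + \<bar>\<beta>\<bar> * (\<bar>A\<bar> + \<bar>E\<bar>)"
      using abs_triangle_ineq[of S "\<beta> * (A + E)"] mult_left_mono[OF abs_triangle_ineq[of A E] abs_ge_zero[of \<beta>]]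
      by (simp add: abs_mult)
    also have "\<dots> \<le> e * m + \<bar>\<beta>\<bar> * (e * (K * m) + e * m)"
      by (intro add_mono mult_left_mono S A E) auto
    also have "\<dots> = Q * e * m" unfolding Q_def by (simp add: algebra_simps)
    also have "\<dots> = \<epsilon> * m" using Q by (simp add: e_def)
    finally show "\<bar>cost F x0 a \<beta> v - cost F x0 a \<beta> w - L2inner g (\<lambda>s. v s - w s)\<bar> \<le> \<epsilon> * L2norm (\<lambda>s. v s - w s)"
      unfolding m_def .
  qed (rule \<delta>)
qed

end

text \<open>The mean value inequality on a ball around \<open>c\<close> for \<open>f\<close> minus
  its linear part at \<open>c\<close>. Uniform continuity of the partial derivatives on a compact
  ball makes \<delta> independent of \<open>c\<close>.\<close>

lemma strict_derivative_real:
  fixes f :: "real^'n \<Rightarrow> real"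
  assumes der: "\<And>x. (f has_derivative (\<lambda>h. \<Sum>i\<in>UNIV. h $ i * d i x)) (at x)"
    and cont: "\<And>i. continuous_on UNIV (d i)" and eps: "\<epsilon> > 0"
  shows "\<exists>\<delta>>0. \<forall>c p q. norm c \<le> R \<longrightarrow> norm (p - c) \<le> \<delta> \<longrightarrow> norm (q - c) \<le> \<delta> \<longrightarrow>
        \<bar>f p - f q - (\<Sum>i\<in>UNIV. (p - q) $ i * d i c)\<bar> \<le> \<epsilon> * norm (p - q)"
proof -
  define n where "n = real CARD('n)"
  have n: "n > 0" unfolding n_def by simp
  \<comment> \<open>Radius \<open>R + 1\<close> leaves room for points at distance up to
    \<open>\<delta> \<le> 1\<close> from \<open>c\<close>.\<close>
  define S where "S = cball (0::real^'n) (R + 1)"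
  have "\<exists>\<delta>>0. \<forall>x\<in>S. \<forall>y\<in>S. dist y x < \<delta> \<longrightarrow> dist (d i y) (d i x) < \<epsilon> / n" for i
  proof -
    have "uniformly_continuous_on S (d i)"
      unfolding S_def by (intro compact_uniformly_continuous continuous_on_subset[OF cont]) auto
    then show ?thesis using eps n unfolding uniformly_continuous_on_def by auto
  qed
  then obtain D where D: "\<And>i. D i > 0"
    and dD: "\<And>i x y. x \<in> S \<Longrightarrow> y \<in> S \<Longrightarrow> dist y x < D i \<Longrightarrow> dist (d i y) (d i x) < \<epsilon> / n" by metis
  \<comment> \<open>Halving makes \<delta> strictly smaller than every \<open>D i\<close>, as the
    closed ball of radius \<delta> requires.\<close>
  define \<delta> where "\<delta> = min 1 (Min (range D) / 2)"
  have MD: "Min (range D) > 0" using D by auto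
  have \<delta>: "\<delta> > 0" "\<delta> \<le> 1" unfolding \<delta>_def using MD by auto
  have \<delta>D: "\<delta> < D i" for i
  proof -
    have "Min (range D) \<le> D i" by simp
    then show ?thesis unfolding \<delta>_def using MD by linarith
  qed
  show ?thesis
  proof (intro exI[of _ \<delta>] conjI allI impI \<delta>)
    fix c p q :: "real^'n"
    assume c: "norm c \<le> R" and p: "norm (p - c) \<le> \<delta>" and q: "norm (q - c) \<le> \<delta>"
    define G where "G x = f x - (\<Sum>i\<in>UNIV. x $ i * d i c)" for x
    have Gd: "(G has_derivative (\<lambda>h. \<Sum>i\<in>UNIV. h $ i * (d i x - d i c))) (at x within cball c \<delta>)" for x
    proof -
      have "(G has_derivative (\<lambda>h. (\<Sum>i\<in>UNIV. h $ i * d i x) - (\<Sum>i\<in>UNIV. h $ i * d i c))) (at x within cball c \<delta>)"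
        unfolding G_def
        by (intro has_derivative_diff has_derivative_at_withinI[OF der] has_derivative_sum has_derivative_mult_left
            bounded_linear.has_derivative[OF bounded_linear_vec_nth] has_derivative_ident)
      then show ?thesis by (simp add: algebra_simps sum_subtractf)
    qed
    have "norm (G p - G q) \<le> \<epsilon> * norm (p - q)"
    proof (rule differentiable_bound[OF convex_cball Gd])
      fix x assume x: "x \<in> cball c \<delta>"
      show "onorm (\<lambda>h. \<Sum>i\<in>UNIV. h $ i * (d i x - d i c)) \<le> \<epsilon>"
      proof (rule onorm_le)
        fix h :: "real^'n"
        have "norm (\<Sum>i\<in>UNIV. h $ i * (d i x - d i c)) \<le> (\<Sum>i\<in>(UNIV::'n set). norm h * (\<epsilon> / n))"
        proof (intro order_trans[OF norm_sum] sum_mono)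
          fix i
          have cS: "c \<in> S" unfolding S_def using c by simp
          have xS: "x \<in> S" unfolding S_def using norm_triangle_ineq[of "x - c" c] x c \<delta> by (simp add: dist_norm norm_minus_commute)
          have "\<bar>d i x - d i c\<bar> \<le> \<epsilon> / n"
            using dD[OF cS xS, of i] x \<delta>D[of i] by (simp add: dist_norm norm_minus_commute)
          then show "norm (h $ i * (d i x - d i c)) \<le> norm h * (\<epsilon> / n)"
            unfolding real_norm_def abs_mult by (intro mult_mono component_le_norm_cart) auto
        qed
        also have "\<dots> = \<epsilon> * norm h" using n by (simp add: n_def)
        finally show "norm (\<Sum>i\<in>UNIV. h $ i * (d i x - d i c)) \<le> \<epsilon> * norm h" .
      qed
    qed (use p q in \<open>auto simp: dist_norm norm_minus_commute\<close>)
    moreover have "G p - G q = f p - f q - (\<Sum>i\<in>UNIV. (p - q) $ i * d i c)"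
      unfolding G_def by (simp add: algebra_simps sum_subtractf)
    ultimately show "\<bar>f p - f q - (\<Sum>i\<in>UNIV. (p - q) $ i * d i c)\<bar> \<le> \<epsilon> * norm (p - q)" by simp
  qed
qed

text \<open>Entry by entry: each of the \<open>N\<close> entries gets the share
  \<open>\<epsilon> / N\<close>, since the norm of a matrix is at most the sum of the absolute
  values of its entries.\<close>

lemma strict_derivative_matrix:
  fixes F :: "real^'n \<Rightarrow> real^'k^'m"
  assumes der: "\<And>r j x. ((\<lambda>x. F x $ r $ j) has_derivative (\<lambda>h. \<Sum>i\<in>UNIV. h $ i * D i x $ r $ j)) (at x)"
    and cont: "\<And>i. continuous_on UNIV (D i)" and eps: "\<epsilon> > 0"
  shows "\<exists>\<delta>>0. \<forall>c p q. norm c \<le> R \<longrightarrow> norm (p - c) \<le> \<delta> \<longrightarrow> norm (q - c) \<le> \<delta> \<longrightarrow>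
        norm (F p - F q - (\<Sum>i\<in>UNIV. (p - q) $ i *\<^sub>R D i c)) \<le> \<epsilon> * norm (p - q)"
proof -
  define N where "N = real (CARD('m) * CARD('k))"
  have N: "N > 0" unfolding N_def by simp
  define P where "P r j \<delta> \<longleftrightarrow> \<delta> > 0 \<and> (\<forall>c p q. norm c \<le> R \<longrightarrow> norm (p - c) \<le> \<delta> \<longrightarrow> norm (q - c) \<le> \<delta> \<longrightarrow>
        \<bar>F p $ r $ j - F q $ r $ j - (\<Sum>i\<in>UNIV. (p - q) $ i * D i c $ r $ j)\<bar> \<le> \<epsilon> / N * norm (p - q))" for r j \<delta>
  have "\<exists>\<delta>. P r j \<delta>" for r j
  proof -
    have "continuous_on UNIV (\<lambda>x. D i x $ r $ j)" for i by (intro continuous_intros cont)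
    moreover have "\<epsilon> / N > 0" using eps N by simp
    ultimately show ?thesis unfolding P_def by (rule strict_derivative_real[OF der])
  qed
  then obtain \<Delta> where "\<And>r j. P r j (\<Delta> r j)" by metis
  hence \<Delta>: "\<And>r j. \<Delta> r j > 0"
    and d\<Delta>: "\<And>r j c p q. norm c \<le> R \<Longrightarrow> norm (p - c) \<le> \<Delta> r j \<Longrightarrow> norm (q - c) \<le> \<Delta> r j \<Longrightarrow>
        \<bar>F p $ r $ j - F q $ r $ j - (\<Sum>i\<in>UNIV. (p - q) $ i * D i c $ r $ j)\<bar> \<le> \<epsilon> / N * norm (p - q)"
    unfolding P_def by blast+
  define \<delta> where "\<delta> = Min (range (\<lambda>(r, j). \<Delta> r j))"
  have \<delta>: "\<delta> > 0" unfolding \<delta>_def using \<Delta> by auto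
  have \<delta>\<Delta>: "\<delta> \<le> \<Delta> r j" for r j
    unfolding \<delta>_def by (rule Min_le) (auto intro: rev_image_eqI[of "(r, j)"])
  show ?thesis
  proof (intro exI[of _ \<delta>] conjI allI impI \<delta>)
    fix c p q :: "real^'n"
    assume c: "norm c \<le> R" and p: "norm (p - c) \<le> \<delta>" and q: "norm (q - c) \<le> \<delta>"
    define A where "A = F p - F q - (\<Sum>i\<in>UNIV. (p - q) $ i *\<^sub>R D i c)"
    have Arj: "\<bar>A $ r $ j\<bar> \<le> \<epsilon> / N * norm (p - q)" for r j
    proof -
      have "A $ r $ j = F p $ r $ j - F q $ r $ j - (\<Sum>i\<in>UNIV. (p - q) $ i * D i c $ r $ j)"
        unfolding A_def by (simp add: sum_component)
      then show ?thesis using d\<Delta>[OF c, of p r j q] p q \<delta>\<Delta>[of r j] by simp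
    qed
    have "norm A \<le> (\<Sum>r\<in>UNIV. norm (A $ r))"
      unfolding norm_vec_def[of A] by (rule L2_set_le_sum) simp
    also have "\<dots> \<le> (\<Sum>r\<in>(UNIV::'m set). \<Sum>j\<in>(UNIV::'k set). \<epsilon> / N * norm (p - q))"
      by (intro sum_mono order_trans[OF norm_le_l1_cart] Arj)
    also have "\<dots> = \<epsilon> * norm (p - q)" using N by (simp add: N_def field_simps)
    finally show "norm (F p - F q - (\<Sum>i\<in>UNIV. (p - q) $ i *\<^sub>R D i c)) \<le> \<epsilon> * norm (p - q)"
      unfolding A_def .
  qed
qed

section \<open>Limit points of gradient flows\<close>

text \<open>Both \<open>h\<close> and \<open>g\<close> give first-order expansions of
  \<open>J\<close> at \<open>v\<close>. Tested on a small multiple of \<open>h - g\<close>, they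
  differ by the step length times the norm of \<open>h - g\<close>, which therefore cannot exceed
  the sum of the two error rates. This is continuity of the gradient at \<open>u\<close>, without a
  formula for it elsewhere.\<close>

lemma has_L2_gradient_close:
  assumes u: "u \<in> L2" and g: "g \<in> L2" and v: "v \<in> L2" and h: "has_L2_gradient J v h"
    and eps: "\<epsilon> \<ge> 0" and vu: "L2norm (\<lambda>s. v s - u s) < \<delta>"
    and strict: "\<And>v w. v \<in> L2 \<Longrightarrow> w \<in> L2 \<Longrightarrow> L2norm (\<lambda>s. v s - u s) < \<delta> \<Longrightarrow> L2norm (\<lambda>s. w s - u s) < \<delta> \<Longrightarrow>
      \<bar>J v - J w - L2inner g (\<lambda>s. v s - w s)\<bar> \<le> \<epsilon> * L2norm (\<lambda>s. v s - w s)"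
  shows "L2norm (\<lambda>s. h s - g s) \<le> \<epsilon>"
proof (cases "L2norm (\<lambda>s. h s - g s) = 0")
  case True
  then show ?thesis using eps by simp
next
  case False
  define k where "k = (\<lambda>s. h s - g s)"
  have hL: "h \<in> L2" using h unfolding has_L2_gradient_def by blast
  have k: "k \<in> L2" unfolding k_def by (rule L2_diff[OF hL g])
  have kp: "L2norm k > 0" using False L2norm_nonneg[of k] unfolding k_def by simp
  have "L2norm k \<le> \<epsilon> + \<epsilon>2" if e2: "\<epsilon>2 > 0" for \<epsilon>2
  proof -
    obtain \<delta>2 where \<delta>2: "\<delta>2 > 0" and hd: "\<And>w. w \<in> L2 \<Longrightarrow> L2norm w < \<delta>2 \<Longrightarrow>
        \<bar>J (\<lambda>s. v s + w s) - J v - L2inner h w\<bar> \<le> \<epsilon>2 * L2norm w"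
      using h e2 unfolding has_L2_gradient_def by blast
    \<comment> \<open>Half of the available room: \<open>w\<close> stays within
      \<open>\<delta>2\<close> of zero and the shifted control within \<delta> of
      \<open>u\<close>.\<close>
    define m where "m = min \<delta>2 (\<delta> - L2norm (\<lambda>s. v s - u s)) / 2"
    have m: "m > 0" "m < \<delta>2" "L2norm (\<lambda>s. v s - u s) + m < \<delta>"
      unfolding m_def using \<delta>2 vu by (auto simp: min_def field_simps)
    define c where "c = m / L2norm k"
    have c: "c > 0" unfolding c_def using m kp by simp
    define w where "w = (\<lambda>s. c *\<^sub>R k s)"
    have w: "w \<in> L2" unfolding w_def by (rule L2_scaleR[OF k])
    have wn: "L2norm w = m" unfolding w_def L2norm_scaleR using m kp by (simp add: c_def)
    have vw: "(\<lambda>s. v s + w s) \<in> L2" by (rule L2_add[OF v w])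
    have "L2norm (\<lambda>s. v s + w s - u s) \<le> L2norm (\<lambda>s. v s - u s) + L2norm w"
      using L2norm_triangle[OF L2_diff[OF v u] w] by (simp add: algebra_simps)
    hence "L2norm (\<lambda>s. v s + w s - u s) < \<delta>" using m wn by simp
    from strict[OF vw v this vu] have 1: "\<bar>J (\<lambda>s. v s + w s) - J v - L2inner g w\<bar> \<le> \<epsilon> * m"
      using wn by simp
    have 2: "\<bar>J (\<lambda>s. v s + w s) - J v - L2inner h w\<bar> \<le> \<epsilon>2 * m"
      using hd[OF w] wn m by simp
    have "L2inner h w - L2inner g w = L2inner k w"
      unfolding k_def by (rule L2inner_diff_left[OF hL g w, symmetric])
    also have "\<dots> = c * (L2norm k)\<^sup>2"
      unfolding w_def L2inner_scaleR_right[OF k k] L2inner_self ..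
    also have "\<dots> = m * L2norm k" using kp by (simp add: c_def power2_eq_square)
    finally have "m * L2norm k \<le> m * (\<epsilon> + \<epsilon>2)" using 1 2 by (simp add: algebra_simps)
    then show ?thesis using m by simp
  qed
  then show ?thesis unfolding k_def using field_le_epsilon by blast
qed

text \<open>At interior points the derivative within \<open>{0..}\<close> is two-sided; at
  \<open>s\<close>, which may be zero, continuity suffices.\<close>

lemma mvt_halfline:
  fixes f :: "real \<Rightarrow> real"
  assumes der: "\<And>t. t \<ge> 0 \<Longrightarrow> (f has_real_derivative f' t) (at t within {0..})" and st: "0 \<le> s" "s < t"
  obtains \<xi> where "s < \<xi>" "\<xi> < t" "f t - f s = (t - s) * f' \<xi>"
proof -
  have "continuous_on {0..} f"
    by (auto simp: continuous_on_eq_continuous_within intro: DERIV_continuous der)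
  hence c: "continuous_on {s..t} f" by (rule continuous_on_subset) (use st in auto)
  have d: "(f has_derivative (*) (f' \<xi>)) (at \<xi>)" if "s < \<xi>" "\<xi> < t" for \<xi>
  proof -
    have "at \<xi> within {0..} = at \<xi>" using that st by (intro at_within_interior) auto
    then show ?thesis using der[of \<xi>] that st by (simp add: has_field_derivative_def)
  qed
  show ?thesis
    by (rule mvt[OF st(2) c d]) (auto intro: that simp: mult.commute)
qed

lemma tendsto_shift_halfline:
  fixes N :: "real \<Rightarrow> 'a::topological_space" and t :: real
  assumes "(N \<longlongrightarrow> l) (at 0 within {h. t + h \<ge> 0})"
  shows "((\<lambda>y. N (y - t)) \<longlongrightarrow> l) (at t within {0..})"
proof (rule filterlim_compose[OF assms])
  show "LIM y at t within {0..}. y - t :> at 0 within {h. 0 \<le> t + h}"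
    unfolding filterlim_at
  proof
    show "((\<lambda>y. y - t) \<longlongrightarrow> 0) (at t within {0..})"
      by (auto intro!: tendsto_eq_intros)
    show "\<forall>\<^sub>F y in at t within {0..}. y - t \<in> {h. 0 \<le> t + h} \<and> y - t \<noteq> 0"
      unfolding eventually_at_filter by (intro always_eventually) auto
  qed
qed

text \<open>Near a point with \<open>g \<noteq> 0\<close> the flow moves with speed of order \<open>c = L2norm g\<close>, so it
  spends a time \<open>\<tau>\<close> bounded below in the ball where \<open>J\<close> decreases at rate at least \<open>c\<^sup>2 / 4\<close>;
  this contradicts the convergence of the monotone function \<open>J \<circ> U\<close>.\<close>

lemma gradient_flow_limit_point_critical:
  fixes U :: "real \<Rightarrow> real \<Rightarrow> real^'k" and u g :: "real \<Rightarrow> real^'k"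
  assumes u: "u \<in> L2" and g: "g \<in> L2"
    and strict: "\<And>\<epsilon>. \<epsilon> > 0 \<Longrightarrow> \<exists>\<delta>>0. \<forall>v w. v \<in> L2 \<longrightarrow> w \<in> L2 \<longrightarrow> L2norm (\<lambda>s. v s - u s) < \<delta> \<longrightarrow> L2norm (\<lambda>s. w s - u s) < \<delta> \<longrightarrow>
      \<bar>J v - J w - L2inner g (\<lambda>s. v s - w s)\<bar> \<le> \<epsilon> * L2norm (\<lambda>s. v s - w s)"
    and U: "\<And>t. t \<ge> 0 \<Longrightarrow> U t \<in> L2"
    and flow: "\<And>t. t \<ge> 0 \<Longrightarrow> \<exists>h. has_L2_gradient J (U t) h \<and>
        ((\<lambda>\<eta>. L2norm (\<lambda>s. (U (t + \<eta>) s - U t s) /\<^sub>R \<eta> + h s)) \<longlongrightarrow> 0) (at 0 within {\<eta>. t + \<eta> \<ge> 0})"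
    and tj: "filterlim tj at_top sequentially"
    and lim: "(\<lambda>j. L2norm (\<lambda>s. U (tj j) s - u s)) \<longlonglongrightarrow> 0"
  shows "L2norm g = 0"
proof (rule ccontr)
  define c where "c = L2norm g"
  assume "L2norm g \<noteq> 0"
  hence c: "c > 0" using L2norm_nonneg[of g] by (simp add: c_def)
  from flow have "\<forall>t. \<exists>h. t \<ge> 0 \<longrightarrow> has_L2_gradient J (U t) h \<and>
      ((\<lambda>\<eta>. L2norm (\<lambda>s. (U (t + \<eta>) s - U t s) /\<^sub>R \<eta> + h s)) \<longlongrightarrow> 0) (at 0 within {\<eta>. t + \<eta> \<ge> 0})"
    by blast
  from choice[OF this] obtain G where G: "\<And>t. t \<ge> 0 \<Longrightarrow> has_L2_gradient J (U t) (G t)"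
    and Gl: "\<And>t. t \<ge> 0 \<Longrightarrow> ((\<lambda>\<eta>. L2norm (\<lambda>s. (U (t + \<eta>) s - U t s) /\<^sub>R \<eta> + G t s)) \<longlongrightarrow> 0) (at 0 within {\<eta>. t + \<eta> \<ge> 0})"
    by blast
  have GL: "G t \<in> L2" if "t \<ge> 0" for t using G[OF that] unfolding has_L2_gradient_def by blast
  \<comment> \<open>The error of the difference quotient of the flow. Expressing everything through
    \<open>Q\<close> lets the estimates below rest on norms in L2 alone.\<close>
  define Q where "Q t y = (\<lambda>s. (U y s - U t s) /\<^sub>R (y - t) + G t s)" for t y
  have QL: "Q t y \<in> L2" if "t \<ge> 0" "y \<ge> 0" for t y
    unfolding Q_def by (intro L2_add L2_scaleR L2_diff U GL that)
  have Q0: "((\<lambda>y. L2norm (Q t y)) \<longlongrightarrow> 0) (at t within {0..})" if "t \<ge> 0" for t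
    using tendsto_shift_halfline[OF Gl[OF that]] unfolding Q_def by simp
  have dU: "L2norm (\<lambda>s. U y s - U t s) \<le> \<bar>y - t\<bar> * (L2norm (Q t y) + L2norm (G t))" if ty: "t \<ge> 0" "y \<ge> 0" for t y
  proof (cases "y = t")
    case True then show ?thesis by (simp add: L2norm_def)
  next
    case False
    have "(\<lambda>s. U y s - U t s) = (\<lambda>s. (y - t) *\<^sub>R (Q t y s + (-1) *\<^sub>R G t s))"
      unfolding Q_def using False by (simp add: fun_eq_iff)
    hence "L2norm (\<lambda>s. U y s - U t s) = \<bar>y - t\<bar> * L2norm (\<lambda>s. Q t y s + (-1) *\<^sub>R G t s)"
      by (simp only: L2norm_scaleR)
    also have "\<dots> \<le> \<bar>y - t\<bar> * (L2norm (Q t y) + L2norm (\<lambda>s. (-1) *\<^sub>R G t s))"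
      by (intro mult_left_mono L2norm_triangle QL L2_scaleR GL ty) auto
    finally show ?thesis by (simp only: L2norm_scaleR) simp
  qed
  have dU0: "((\<lambda>y. L2norm (\<lambda>s. U y s - U t s)) \<longlongrightarrow> 0) (at t within {0..})" if t: "t \<ge> 0" for t
  proof (rule tendsto_sandwich[OF _ _ tendsto_const])
    show "\<forall>\<^sub>F y in at t within {0..}. 0 \<le> L2norm (\<lambda>s. U y s - U t s)" by (simp add: L2norm_nonneg)
    show "\<forall>\<^sub>F y in at t within {0..}. L2norm (\<lambda>s. U y s - U t s) \<le> \<bar>y - t\<bar> * (L2norm (Q t y) + L2norm (G t))"
      unfolding eventually_at_filter using dU[OF t] by (intro always_eventually) auto
    have "((\<lambda>y. \<bar>y - t\<bar> * (L2norm (Q t y) + L2norm (G t))) \<longlongrightarrow> \<bar>t - t\<bar> * (0 + L2norm (G t))) (at t within {0..})"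
      by (intro tendsto_intros Q0 t)
    then show "((\<lambda>y. \<bar>y - t\<bar> * (L2norm (Q t y) + L2norm (G t))) \<longlongrightarrow> 0) (at t within {0..})" by simp
  qed
  \<comment> \<open>Pairing with a fixed \<open>w\<close> turns the flow in L2 into real functions
    of time, to which the ordinary mean value theorem applies.\<close>
  have din: "((\<lambda>r. L2inner w (U r)) has_real_derivative - L2inner w (G t)) (at t within {0..})"
    if w: "w \<in> L2" and t: "t \<ge> 0" for w t
    unfolding has_field_derivative_iff
  proof (rule Lim_transform_within_set_eq[THEN iffD1, rotated])
    have "((\<lambda>y. L2inner w (Q t y)) \<longlongrightarrow> 0) (at t within {0..})"
    proof (rule Lim_null_comparison)
      show "\<forall>\<^sub>F y in at t within {0..}. norm (L2inner w (Q t y)) \<le> L2norm w * L2norm (Q t y)"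
        unfolding eventually_at_filter using L2inner_le[OF w QL[OF t]] by (intro always_eventually) auto
      show "((\<lambda>y. L2norm w * L2norm (Q t y)) \<longlongrightarrow> 0) (at t within {0..})"
        using tendsto_mult_right_zero[OF Q0[OF t]] by simp
    qed
    hence "((\<lambda>y. L2inner w (Q t y) - L2inner w (G t)) \<longlongrightarrow> 0 - L2inner w (G t)) (at t within {0..})"
      by (intro tendsto_diff tendsto_const)
    moreover have "\<forall>\<^sub>F y in at t within {0..}. L2inner w (Q t y) - L2inner w (G t) = (L2inner w (U y) - L2inner w (U t)) / (y - t)"
      unfolding eventually_at_filter
    proof (intro always_eventually allI impI)
      fix y assume "y \<noteq> t" "y \<in> {0..}"
      hence y: "y \<ge> 0" by simp
      have d: "(\<lambda>s. (U y s - U t s) /\<^sub>R (y - t)) \<in> L2" by (intro L2_scaleR L2_diff U y t)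
      have "L2inner w (Q t y) = L2inner w (\<lambda>s. (U y s - U t s) /\<^sub>R (y - t)) + L2inner w (G t)"
        unfolding Q_def using L2inner_add_scaleR_right[OF d GL[OF t] w, of 1] by simp
      also have "L2inner w (\<lambda>s. (U y s - U t s) /\<^sub>R (y - t)) = inverse (y - t) * (L2inner w (U y) - L2inner w (U t))"
        using L2inner_scaleR_right[OF L2_diff[OF U[OF y] U[OF t]] w] L2inner_diff_right[OF U[OF y] U[OF t] w] by simp
      finally show "L2inner w (Q t y) - L2inner w (G t) = (L2inner w (U y) - L2inner w (U t)) / (y - t)"
        by (simp add: divide_inverse mult.commute)
    qed
    ultimately show "((\<lambda>y. (L2inner w (U y) - L2inner w (U t)) / (y - t)) \<longlongrightarrow> - L2inner w (G t)) (at t within {0..})"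
      using Lim_transform_eventually by fastforce
  qed (auto simp: eventually_at_filter)
  have dJ: "((\<lambda>r. J (U r)) has_real_derivative - (L2norm (G t))\<^sup>2) (at t within {0..})" if t: "t \<ge> 0" for t
  proof -
    define R where "R y = (J (U y) - J (U t) - L2inner (G t) (\<lambda>s. U y s - U t s)) / (y - t)" for y
    have "(R \<longlongrightarrow> 0) (at t within {0..})"
    proof (rule tendstoI)
      fix e :: real assume e: "e > 0"
      define M where "M = L2norm (G t) + 1"
      have M: "M > 0" unfolding M_def using L2norm_nonneg[of "G t"] by simp
      have "e / (2 * M) > 0" using e M by simp
      then obtain \<delta> where \<delta>: "\<delta> > 0" and hd: "\<And>w. w \<in> L2 \<Longrightarrow> L2norm w < \<delta> \<Longrightarrow>
        \<bar>J (\<lambda>s. U t s + w s) - J (U t) - L2inner (G t) w\<bar> \<le> e / (2 * M) * L2norm w"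
        using G[OF t] unfolding has_L2_gradient_def by blast
      have "\<forall>\<^sub>F y in at t within {0..}. y \<in> {0..} \<and> y \<noteq> t"
        by (auto simp: eventually_at_filter)
      moreover have "\<forall>\<^sub>F y in at t within {0..}. L2norm (\<lambda>s. U y s - U t s) < \<delta>"
        using order_tendstoD(2)[OF dU0[OF t] \<delta>] .
      moreover have "\<forall>\<^sub>F y in at t within {0..}. L2norm (Q t y) < 1"
        using order_tendstoD(2)[OF Q0[OF t], of 1] by simp
      ultimately show "\<forall>\<^sub>F y in at t within {0..}. dist (R y) 0 < e"
      proof eventually_elim
        case (elim y)
        hence y: "y \<ge> 0" "y \<noteq> t" by auto
        have "\<bar>J (U y) - J (U t) - L2inner (G t) (\<lambda>s. U y s - U t s)\<bar> \<le> e / (2 * M) * L2norm (\<lambda>s. U y s - U t s)"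
          using hd[OF L2_diff[OF U[OF y(1)] U[OF t]] elim(2)] by simp
        also have "\<dots> \<le> e / (2 * M) * (\<bar>y - t\<bar> * M)"
          using elim(3) e M by (intro mult_left_mono order_trans[OF dU[OF t y(1)]]) (auto simp: M_def)
        also have "\<dots> = e / 2 * \<bar>y - t\<bar>" using M by simp
        also have "\<dots> < e * \<bar>y - t\<bar>" using e y by simp
        finally show ?case unfolding R_def using y by (simp add: field_simps)
      qed
    qed
    moreover have "((\<lambda>y. (L2inner (G t) (U y) - L2inner (G t) (U t)) / (y - t)) \<longlongrightarrow> - (L2norm (G t))\<^sup>2) (at t within {0..})"
      using din[OF GL[OF t] t] unfolding has_field_derivative_iff L2inner_self .
    ultimately have "((\<lambda>y. R y + (L2inner (G t) (U y) - L2inner (G t) (U t)) / (y - t)) \<longlongrightarrow> 0 + - (L2norm (G t))\<^sup>2) (at t within {0..})"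
      by (rule tendsto_add)
    moreover have "\<forall>\<^sub>F y in at t within {0..}. R y + (L2inner (G t) (U y) - L2inner (G t) (U t)) / (y - t) = (J (U y) - J (U t)) / (y - t)"
      unfolding eventually_at_filter
      by (intro always_eventually allI impI)
         (simp add: R_def L2inner_diff_right[OF U U[OF t] GL[OF t]] flip: add_divide_distrib)
    ultimately show ?thesis
      unfolding has_field_derivative_iff using Lim_transform_eventually by fastforce
  qed
  have mono: "J (U t) \<le> J (U s)" if st: "0 \<le> s" "s \<le> t" for s t
  proof (cases "s = t")
    case False
    hence "s < t" using st by simp
    obtain \<xi> where "J (U t) - J (U s) = (t - s) * - (L2norm (G \<xi>))\<^sup>2"
      by (rule mvt_halfline[OF dJ st(1) \<open>s < t\<close>])
    moreover have "0 \<le> (t - s) * (L2norm (G \<xi>))\<^sup>2" using st by simp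
    ultimately show ?thesis by simp
  qed simp
  \<comment> \<open>With error rate \<open>c / 2\<close>, every gradient along the flow inside the
    ball of radius \<delta> has norm between \<open>c / 2\<close> and
    \<open>3 * c / 2\<close>.\<close>
  have c2: "c / 2 > 0" using c by simp
  from strict[OF c2] obtain \<delta> where \<delta>: "\<delta> > 0" and sd: "\<And>v w. v \<in> L2 \<Longrightarrow> w \<in> L2 \<Longrightarrow> L2norm (\<lambda>s. v s - u s) < \<delta> \<Longrightarrow> L2norm (\<lambda>s. w s - u s) < \<delta> \<Longrightarrow>
      \<bar>J v - J w - L2inner g (\<lambda>s. v s - w s)\<bar> \<le> c / 2 * L2norm (\<lambda>s. v s - w s)"
    by blast
  define N where "N t = L2norm (\<lambda>s. U t s - u s)" for t
  have Gc: "L2norm (G t) \<le> 3 * c / 2" "L2norm (G t) \<ge> c / 2" if t: "t \<ge> 0" "N t < \<delta>" for t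
  proof -
    have *: "L2norm (\<lambda>s. G t s - g s) \<le> c / 2"
      using c t by (intro has_L2_gradient_close[OF u g U[OF t(1)] G[OF t(1)] _ _ sd]) (auto simp: N_def)
    show "L2norm (G t) \<le> 3 * c / 2"
      using L2norm_triangle[OF L2_diff[OF GL[OF t(1)] g] g] * by (simp add: c_def)
    show "L2norm (G t) \<ge> c / 2"
      using L2norm_triangle[OF L2_diff[OF g GL[OF t(1)]] GL[OF t(1)]] *
      by (simp add: c_def L2norm_minus_commute[of g])
  qed
  \<comment> \<open>At speed at most \<open>3 * c / 2\<close> the distance covered in time \<tau> is
    at most \<open>3 * \<delta> / 8\<close>, less than the gap between the radii
    \<open>\<delta> / 2\<close> and \<delta>.\<close>
  define \<tau> where "\<tau> = \<delta> / (4 * c)"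
  have \<tau>: "\<tau> > 0" "\<tau> * (3 * c / 2) < \<delta> / 2" unfolding \<tau>_def using \<delta> c by (auto simp: field_simps)
  have Ncont: "continuous_on {0..} N"
    unfolding continuous_on_def
  proof
    fix t :: real assume "t \<in> {0..}"
    hence t: "t \<ge> 0" by simp
    have "((\<lambda>y. N y - N t) \<longlongrightarrow> 0) (at t within {0..})"
    proof (rule Lim_null_comparison[OF _ dU0[OF t]])
      show "\<forall>\<^sub>F y in at t within {0..}. norm (N y - N t) \<le> L2norm (\<lambda>s. U y s - U t s)"
        unfolding eventually_at_filter
      proof (intro always_eventually allI impI)
        fix y assume "y \<noteq> t" "y \<in> {0..}"
        hence y: "y \<ge> 0" by simp
        show "norm (N y - N t) \<le> L2norm (\<lambda>s. U y s - U t s)"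
          using L2norm_triangle_diff[OF U[OF y] U[OF t] u] L2norm_triangle_diff[OF U[OF t] U[OF y] u]
          by (simp add: N_def L2norm_minus_commute[of "U t"] abs_le_iff)
      qed
    qed
    then show "(N \<longlongrightarrow> N t) (at t within {0..})" by (rule LIM_zero_cancel)
  qed
  have trap: "N t < \<delta>" if s: "s \<ge> 0" "N s < \<delta> / 2" and t: "t \<in> {s..s + \<tau>}" for s t
  proof (rule ccontr)
    assume "\<not> N t < \<delta>"
    define A where "A = {r \<in> {s..s+\<tau>}. \<delta> \<le> N r}"
    have tA: "t \<in> A" using t \<open>\<not> N t < \<delta>\<close> by (simp add: A_def)
    have cl: "closed A"
      unfolding A_def by (intro continuous_on_closed_Collect_le continuous_on_const continuous_on_subset[OF Ncont]) (use s in auto)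
    have bb: "bdd_below A" unfolding A_def by (intro bdd_belowI[of _ s]) auto
    \<comment> \<open>The first exit time. \<open>A\<close> is closed, so the infimum is attained,
      and the gradient bounds hold strictly before \<open>r\<close>.\<close>
    define r where "r = Inf A"
    have rA: "r \<in> A" unfolding r_def by (rule closed_contains_Inf[OF _ bb cl]) (use tA in auto)
    have before: "N q < \<delta>" if "s \<le> q" "q < r" for q
    proof (rule ccontr)
      assume "\<not> N q < \<delta>"
      hence "q \<in> A" using that rA by (auto simp: A_def)
      hence "r \<le> q" unfolding r_def by (rule cInf_lower[OF _ bb])
      then show False using that by simp
    qed
    have r: "s < r" "r \<le> s + \<tau>" "N r \<ge> \<delta>"
      using rA s(2) \<delta> by (auto simp: A_def less_le)
    have r0: "r \<ge> 0" using r s by simp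
    \<comment> \<open>Testing the velocity against the displacement itself replaces a mean value
      inequality for curves in L2; cancelling one factor \<open>L2norm w\<close> bounds the distance
      travelled.\<close>
    define w where "w = (\<lambda>q. U r q - U s q)"
    have w: "w \<in> L2" unfolding w_def by (intro L2_diff U r0 s)
    obtain \<xi> where \<xi>: "s < \<xi>" "\<xi> < r" "L2inner w (U r) - L2inner w (U s) = (r - s) * - L2inner w (G \<xi>)"
      by (rule mvt_halfline[OF din[OF w] s(1) r(1)])
    have wsq: "(L2norm w)\<^sup>2 = (r - s) * - L2inner w (G \<xi>)"
      unfolding \<xi>(3)[symmetric] L2inner_self[symmetric]
      using L2inner_diff_right[OF U[OF r0] U[OF s(1)] w] by (simp add: w_def)
    note wsq
    also have "(r - s) * - L2inner w (G \<xi>) \<le> \<tau> * (L2norm w * (3 * c / 2))"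
    proof (rule mult_mono)
      have "- L2inner w (G \<xi>) \<le> L2norm w * L2norm (G \<xi>)"
        using L2inner_le[OF w GL[of \<xi>]] \<xi> s by simp
      also have "\<dots> \<le> L2norm w * (3 * c / 2)"
        using \<xi> s by (intro mult_left_mono Gc before L2norm_nonneg) auto
      finally show a: "- L2inner w (G \<xi>) \<le> L2norm w * (3 * c / 2)" .
      have "0 \<le> (r - s) * - L2inner w (G \<xi>)" unfolding wsq[symmetric] by simp
      then show "0 \<le> - L2inner w (G \<xi>)" using r by (simp add: zero_le_mult_iff mult_le_0_iff)
    qed (use r \<tau> in auto)
    finally have "L2norm w * L2norm w \<le> L2norm w * (\<tau> * (3 * c / 2))" by (simp add: power2_eq_square mult_ac)
    hence wle: "L2norm w \<le> \<tau> * (3 * c / 2)"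
      using L2norm_nonneg[of w] \<tau> c by (cases "L2norm w = 0") auto
    have "N r \<le> L2norm w + N s"
      unfolding N_def w_def by (rule L2norm_triangle_diff[OF U[OF r0] U[OF s(1)] u])
    then show False using wle \<tau>(2) s(2) r(3) by simp
  qed
  define \<kappa> where "\<kappa> = \<tau> * (c / 2)\<^sup>2"
  have \<kappa>: "\<kappa> > 0" unfolding \<kappa>_def using \<tau> c by simp
  have drop: "J (U (s + \<tau>)) \<le> J (U s) - \<kappa>" if s: "s \<ge> 0" "N s < \<delta> / 2" for s
  proof -
    obtain \<xi> where \<xi>: "s < \<xi>" "\<xi> < s + \<tau>" "J (U (s + \<tau>)) - J (U s) = (s + \<tau> - s) * - (L2norm (G \<xi>))\<^sup>2"
      using \<tau>(1) by (rule_tac mvt_halfline[OF dJ s(1), of "s + \<tau>"]) auto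
    have "c / 2 \<le> L2norm (G \<xi>)" using \<xi> s by (intro Gc trap[OF s]) auto
    hence "(c / 2)\<^sup>2 \<le> (L2norm (G \<xi>))\<^sup>2" using c by (intro power_mono) auto
    hence "\<kappa> \<le> \<tau> * (L2norm (G \<xi>))\<^sup>2" unfolding \<kappa>_def using \<tau> by (intro mult_left_mono) auto
    then show ?thesis using \<xi>(3) by simp
  qed
  \<comment> \<open>The pairing with \<open>g\<close> contributes \<open>c\<close> and the remainder
    \<open>c / 2\<close>; the constant is rounded up to \<open>2 * c\<close>.\<close>
  have Jc: "\<bar>J (U t) - J u\<bar> \<le> 2 * c * N t" if t: "t \<ge> 0" "N t < \<delta>" for t
  proof -
    have "\<bar>J (U t) - J u - L2inner g (\<lambda>s. U t s - u s)\<bar> \<le> c / 2 * N t"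
      using sd[OF U[OF t(1)] u] t(2) \<delta> unfolding N_def by (simp add: L2norm_def)
    moreover have "\<bar>L2inner g (\<lambda>s. U t s - u s)\<bar> \<le> c * N t"
      unfolding N_def c_def by (rule L2inner_le[OF g L2_diff[OF U[OF t(1)] u]])
    moreover have "0 \<le> c * N t" using c L2norm_nonneg[of "\<lambda>s. U t s - u s"] by (simp add: N_def)
    ultimately show ?thesis by linarith
  qed
  \<comment> \<open>Within distance \<open>\<kappa> / (8 * c)\<close> of \<open>u\<close> the cost
    differs from \<open>J u\<close> by at most \<open>\<kappa> / 4\<close>.\<close>
  define e where "e = min (\<delta> / 2) (\<kappa> / (8 * c))"
  have e: "e > 0" "e \<le> \<delta> / 2" "e \<le> \<kappa> / (8 * c)" unfolding e_def using \<delta> \<kappa> c by auto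
  have evN: "\<forall>\<^sub>F j in sequentially. N (tj j) < e"
    using order_tendstoD(2)[OF lim e(1)] unfolding N_def .
  have evt: "\<forall>\<^sub>F j in sequentially. tj j \<ge> B" for B
    using tj unfolding filterlim_at_top by blast
  have near: "\<bar>J (U t) - J u\<bar> \<le> \<kappa> / 4" if "t \<ge> 0" "N t < e" for t
  proof -
    have "\<bar>J (U t) - J u\<bar> \<le> 2 * c * N t" using that e \<delta> by (intro Jc) auto
    also have "\<dots> \<le> 2 * c * (\<kappa> / (8 * c))" using that e c by (intro mult_left_mono) auto
    finally show ?thesis using c by simp
  qed
  \<comment> \<open>Two visits at least \<tau> apart: between them the cost falls by at least
    \<kappa>, whereas closeness to \<open>u\<close> permits a difference of at most
    \<open>\<kappa> / 2\<close>.\<close>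
  obtain i where i: "tj i \<ge> 0" "N (tj i) < e"
    using eventually_happens[OF eventually_conj[OF evt[of 0] evN]] by auto
  obtain k where k: "tj k \<ge> tj i + \<tau>" "N (tj k) < e"
    using eventually_happens[OF eventually_conj[OF evt[of "tj i + \<tau>"] evN]] by auto
  have "J (U (tj k)) \<le> J (U (tj i + \<tau>))" using i k \<tau> by (intro mono) auto
  also have "\<dots> \<le> J (U (tj i)) - \<kappa>" using i e by (intro drop) auto
  finally have "J (U (tj k)) \<le> J (U (tj i)) - \<kappa>" .
  moreover have "\<bar>J (U (tj k)) - J u\<bar> \<le> \<kappa> / 4" using i k \<tau> by (intro near) auto
  ultimately show False using near[OF i] \<kappa> by arith
qed

section \<open>Smoothness of critical controls\<close>

inductive_set smooth_alg :: "(real \<Rightarrow> real^'n) \<Rightarrow> (real \<Rightarrow> real^'n) \<Rightarrow> (real \<Rightarrow> real) set"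
  for x p :: "real \<Rightarrow> real^'n" where
  analytic: "real_analytic f \<Longrightarrow> (\<lambda>s. f (x s)) \<in> smooth_alg x p"
| costate: "(\<lambda>s. p s $ i) \<in> smooth_alg x p"
| const: "(\<lambda>s. c) \<in> smooth_alg x p"
| add: "f \<in> smooth_alg x p \<Longrightarrow> g \<in> smooth_alg x p \<Longrightarrow> (\<lambda>s. f s + g s) \<in> smooth_alg x p"
| mult: "f \<in> smooth_alg x p \<Longrightarrow> g \<in> smooth_alg x p \<Longrightarrow> (\<lambda>s. f s * g s) \<in> smooth_alg x p"

lemma smooth_alg_sum:
  "finite I \<Longrightarrow> (\<And>i. i \<in> I \<Longrightarrow> f i \<in> smooth_alg x p) \<Longrightarrow> (\<lambda>s. \<Sum>i\<in>I. f i s) \<in> smooth_alg x p"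
  by (induction I rule: finite_induct) (auto intro: smooth_alg.intros)

text \<open>Sum and product rules propagate the claim; the generators are covered because the
  velocities \<open>X\<close> and \<open>P\<close> have all their components in the algebra.\<close>

lemma smooth_alg_derivative:
  assumes X: "\<And>t. t \<in> {0..1} \<Longrightarrow> (x has_vector_derivative X t) (at t within {0..1})"
    and XA: "\<And>i. (\<lambda>t. X t $ i) \<in> smooth_alg x p"
    and P: "\<And>t. t \<in> {0..1} \<Longrightarrow> (p has_vector_derivative P t) (at t within {0..1})"
    and PA: "\<And>i. (\<lambda>t. P t $ i) \<in> smooth_alg x p"
    and f: "f \<in> smooth_alg x p"
  shows "\<exists>d\<in>smooth_alg x p. \<forall>t\<in>{0..1}. (f has_real_derivative d t) (at t within {0..1})"
  using f
proof induction
  case (analytic f)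
  obtain D where D: "\<And>y. (f has_derivative (\<lambda>h. \<Sum>i\<in>UNIV. h $ i * D i y)) (at y)"
    and DA: "\<And>i. real_analytic (D i)" using real_analytic_partials[OF analytic] by blast
  show ?case
  proof (intro bexI ballI)
    show "(\<lambda>t. \<Sum>i\<in>UNIV. X t $ i * D i (x t)) \<in> smooth_alg x p"
      by (intro smooth_alg_sum smooth_alg.mult XA smooth_alg.analytic DA) simp
    fix t :: real assume t: "t \<in> {0..1}"
    have "((\<lambda>s. f (x s)) has_derivative (\<lambda>h. \<Sum>i\<in>UNIV. (h *\<^sub>R X t) $ i * D i (x t))) (at t within {0..1})"
      using has_derivative_compose[OF X[OF t, unfolded has_vector_derivative_def] D] .
    moreover have "(\<lambda>h. \<Sum>i\<in>UNIV. (h *\<^sub>R X t) $ i * D i (x t)) = (*) (\<Sum>i\<in>UNIV. X t $ i * D i (x t))"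
      by (simp add: fun_eq_iff sum_distrib_left sum_distrib_right mult_ac)
    ultimately show "((\<lambda>s. f (x s)) has_real_derivative (\<Sum>i\<in>UNIV. X t $ i * D i (x t))) (at t within {0..1})"
      by (simp add: has_field_derivative_def)
  qed
next
  case (costate i)
  show ?case
  proof (intro bexI ballI)
    show "(\<lambda>t. P t $ i) \<in> smooth_alg x p" by (rule PA)
    show "((\<lambda>s. p s $ i) has_real_derivative P t $ i) (at t within {0..1})" if "t \<in> {0..1}" for t
      unfolding has_real_derivative_iff_has_vector_derivative
      by (rule bounded_linear.has_vector_derivative[OF bounded_linear_vec_nth P[OF that]])
  qed
next
  case (const c)
  show ?case by (intro bexI[OF _ smooth_alg.const[of 0]]) (auto intro!: derivative_eq_intros)
next
  case (add f g)
  then obtain d e where de: "d \<in> smooth_alg x p" "e \<in> smooth_alg x p"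
    "\<And>t. t \<in> {0..1} \<Longrightarrow> (f has_real_derivative d t) (at t within {0..1})"
    "\<And>t. t \<in> {0..1} \<Longrightarrow> (g has_real_derivative e t) (at t within {0..1})" by blast
  show ?case
    by (intro bexI[OF _ smooth_alg.add[OF de(1,2)]] ballI DERIV_add de)
next
  case (mult f g)
  then obtain d e where de: "d \<in> smooth_alg x p" "e \<in> smooth_alg x p"
    "\<And>t. t \<in> {0..1} \<Longrightarrow> (f has_real_derivative d t) (at t within {0..1})"
    "\<And>t. t \<in> {0..1} \<Longrightarrow> (g has_real_derivative e t) (at t within {0..1})" by blast
  have "(\<lambda>t. d t * g t + e t * f t) \<in> smooth_alg x p"
    by (intro smooth_alg.add smooth_alg.mult de mult)
  then show ?case
    by (rule bexI[rotated]) (intro ballI DERIV_mult de)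
qed

lemma has_vector_derivative_axis_sum:
  fixes f :: "'n::finite \<Rightarrow> real \<Rightarrow> real"
  assumes "\<And>j. (f j has_real_derivative d j) (at t within S)"
  shows "((\<lambda>t. \<Sum>j\<in>UNIV. f j t *\<^sub>R axis j (1::real)) has_vector_derivative (\<Sum>j\<in>UNIV. d j *\<^sub>R axis j 1)) (at t within S)"
  by (intro has_vector_derivative_sum bounded_linear.has_vector_derivative[OF bounded_linear_scaleR_left]
      assms[unfolded has_real_derivative_iff_has_vector_derivative])

lemma axis_sum_component: "(\<Sum>j\<in>UNIV. f j *\<^sub>R axis j (1::real)) = (\<chi> j. f j)"
  by (simp add: vec_eq_iff axis_def if_distrib[of "\<lambda>z. _ * z"] cong: if_cong)

text \<open>Along a critical control the state and the costate solve an ODE whose right-hand side is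
  polynomial in the costate and in analytic functions of the state, so the algebra
  generated by these functions is closed under differentiation.\<close>

lemma extremal_control_smooth:
  fixes F :: "real^'n \<Rightarrow> real^'k^'n" and D :: "'n \<Rightarrow> real^'n \<Rightarrow> real^'k^'n"
  assumes FA: "\<And>i j. real_analytic (\<lambda>x. F x $ i $ j)"
    and DA: "\<And>i r j. real_analytic (\<lambda>x. D i x $ r $ j)"
    and w: "\<And>t. w t = c *\<^sub>R (p t v* F (x t))"
    and X: "\<And>t. t \<in> {0..1} \<Longrightarrow> (x has_vector_derivative F (x t) *v w t) (at t within {0..1})"
    and P: "\<And>t. t \<in> {0..1} \<Longrightarrow> (p has_vector_derivative - adj_rhs D (x t) (w t) (p t)) (at t within {0..1})"
  shows "\<exists>g :: nat \<Rightarrow> real \<Rightarrow> real^'k. g 0 = w \<and>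
     (\<forall>n. \<forall>t\<in>{0..1}. (g n has_vector_derivative g (Suc n) t) (at t within {0..1}))"
proof -
  let ?A = "smooth_alg x p"
  \<comment> \<open>The feedback formula expresses the control through state and costate;
    substituting it makes the system for the pair autonomous, and both velocities fall into the
    algebra.\<close>
  have wA: "(\<lambda>t. w t $ j) \<in> ?A" for j
  proof -
    have "(\<lambda>t. c * (\<Sum>i\<in>UNIV. F (x t) $ i $ j * p t $ i)) \<in> ?A"
      by (intro smooth_alg.mult smooth_alg.const smooth_alg_sum smooth_alg.costate smooth_alg.analytic FA) simp
    then show ?thesis by (simp add: w vector_matrix_mult_def mult.commute)
  qed
  have XA: "(\<lambda>t. (F (x t) *v w t) $ i) \<in> ?A" for i
  proof -
    have "(\<lambda>t. \<Sum>j\<in>UNIV. F (x t) $ i $ j * w t $ j) \<in> ?A"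
      by (intro smooth_alg.mult smooth_alg_sum wA smooth_alg.analytic FA) simp
    then show ?thesis by (simp add: matrix_vector_mult_def)
  qed
  have PA: "(\<lambda>t. (- adj_rhs D (x t) (w t) (p t)) $ i) \<in> ?A" for i
  proof -
    have "(\<lambda>t. (-1) * (\<Sum>r\<in>UNIV. p t $ r * (\<Sum>j\<in>UNIV. D i (x t) $ r $ j * w t $ j))) \<in> ?A"
      by (intro smooth_alg.mult smooth_alg.const smooth_alg.costate smooth_alg_sum wA smooth_alg.analytic DA) simp_all
    then show ?thesis by (simp add: adj_rhs_component matrix_vector_mult_def inner_vec_def)
  qed
  have "\<forall>f. \<exists>d. f \<in> ?A \<longrightarrow> d \<in> ?A \<and> (\<forall>t\<in>{0..1}. (f has_real_derivative d t) (at t within {0..1}))"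
    using smooth_alg_derivative[OF X XA P PA] by blast
  \<comment> \<open>A derivation on the algebra, selected once and for all; its iterates on the
    components of \<open>w\<close> are the derivatives of all orders.\<close>
  from choice[OF this] obtain \<delta> where \<delta>: "\<And>f. f \<in> ?A \<Longrightarrow> \<delta> f \<in> ?A"
    and der\<delta>: "\<And>f t. f \<in> ?A \<Longrightarrow> t \<in> {0..1} \<Longrightarrow> (f has_real_derivative \<delta> f t) (at t within {0..1})" by blast
  define h where "h n j = (\<delta> ^^ n) (\<lambda>t. w t $ j)" for n j
  have hA: "h n j \<in> ?A" for n j
    by (induction n) (auto simp: h_def wA \<delta>)
  define g where "g n t = (\<Sum>j\<in>UNIV. h n j t *\<^sub>R axis j (1::real))" for n t
  have "g 0 = w" by (simp add: fun_eq_iff g_def axis_sum_component h_def vec_eq_iff)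
  moreover have "(g n has_vector_derivative g (Suc n) t) (at t within {0..1})" if "t \<in> {0..1}" for n t
    unfolding g_def using der\<delta>[OF hA that] by (intro has_vector_derivative_axis_sum) (simp add: h_def)
  ultimately show ?thesis by blast
qed

section \<open>Classical derivatives as weak derivatives\<close>

lemma test_fun_derivatives:
  assumes "test_fun \<phi>"
  shows "((deriv ^^ j) \<phi> has_real_derivative (deriv ^^ Suc j) \<phi> x) (at x)"
    and "(deriv ^^ j) \<phi> 0 = 0" and "(deriv ^^ j) \<phi> 1 = 0"
proof -
  show d: "((deriv ^^ j) \<phi> has_real_derivative (deriv ^^ Suc j) \<phi> x) (at x)" for j x
    using assms unfolding test_fun_def by (simp add: DERIV_deriv_iff_real_differentiable)
  obtain a b where ab: "0 < a" "b < 1" and z: "\<And>x. x \<notin> {a..b} \<Longrightarrow> \<phi> x = 0"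
    using assms unfolding test_fun_def by blast
  \<comment> \<open>The complement of \<open>{a..b}\<close> is open and contains 0 and 1, so the
    vanishing of one derivative there passes on to the next.\<close>
  have "(deriv ^^ j) \<phi> x = 0" if "x \<notin> {a..b}" for j x
    using that
  proof (induction j arbitrary: x)
    case (Suc j)
    have "((\<lambda>_. 0) has_real_derivative (deriv ^^ Suc j) \<phi> x) (at x)"
      by (rule has_field_derivative_transform_within_open[OF d[of j x], of "- {a..b}"]) (use Suc in auto)
    then show ?case using DERIV_unique DERIV_const by blast
  qed (simp add: z)
  then show "(deriv ^^ j) \<phi> 0 = 0" "(deriv ^^ j) \<phi> 1 = 0" using ab by auto
qed

lemma test_fun_derivative_continuous:
  assumes "test_fun \<phi>"
  shows "continuous_on S ((deriv ^^ j) \<phi>)"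
  by (intro continuous_at_imp_continuous_on ballI) (rule DERIV_isCont[OF test_fun_derivatives(1)[OF assms]])

text \<open>Each step moves one derivative onto \<open>g\<close> and loses its boundary terms. The
  starting index \<open>n\<close> is left general because the induction hypothesis is applied at
  \<open>Suc n\<close>.\<close>

lemma test_fun_integral_by_parts:
  fixes g :: "nat \<Rightarrow> real \<Rightarrow> real^'k"
  assumes \<phi>: "test_fun \<phi>"
    and g: "\<And>n t. t \<in> {0..1} \<Longrightarrow> (g n has_vector_derivative g (Suc n) t) (at t within {0..1})"
  shows "integral {0..1} (\<lambda>s. (deriv ^^ j) \<phi> s *\<^sub>R g n s) = (-1) ^ j *\<^sub>R integral {0..1} (\<lambda>s. \<phi> s *\<^sub>R g (n + j) s)"
proof (induction j arbitrary: n)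
  case (Suc j)
  let ?f = "(deriv ^^ j) \<phi>" and ?f' = "(deriv ^^ Suc j) \<phi>"
  have gc: "continuous_on {0..1} (g n)" for n
    unfolding continuous_on_eq_continuous_within using has_vector_derivative_continuous[OF g] by blast
  have fc: "continuous_on {0..1} ((deriv ^^ i) \<phi>)" for i
    by (rule test_fun_derivative_continuous[OF \<phi>])
  have "((\<lambda>s. ?f s *\<^sub>R g (Suc n) s + ?f' s *\<^sub>R g n s) has_integral (?f 1 *\<^sub>R g n 1 - ?f 0 *\<^sub>R g n 0)) {0..1}"
    by (rule fundamental_theorem_of_calculus[OF zero_le_one])
      (rule has_vector_derivative_scaleR[OF has_field_derivative_at_within[OF test_fun_derivatives(1)[OF \<phi>]] g])
  hence "integral {0..1} (\<lambda>s. ?f s *\<^sub>R g (Suc n) s + ?f' s *\<^sub>R g n s) = 0"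
    by (simp add: test_fun_derivatives[OF \<phi>] integral_unique del: funpow.simps)
  hence "integral {0..1} (\<lambda>s. ?f s *\<^sub>R g (Suc n) s) + integral {0..1} (\<lambda>s. ?f' s *\<^sub>R g n s) = 0"
    by (subst (asm) integral_add) (intro integrable_continuous_real continuous_intros fc gc | assumption)+
  hence "integral {0..1} (\<lambda>s. ?f' s *\<^sub>R g n s) = - integral {0..1} (\<lambda>s. ?f s *\<^sub>R g (Suc n) s)"
    by (simp add: eq_neg_iff_add_eq_0 add.commute)
  also have "\<dots> = (-1) ^ Suc j *\<^sub>R integral {0..1} (\<lambda>s. \<phi> s *\<^sub>R g (n + Suc j) s)"
    unfolding Suc.IH by simp
  finally show ?case .
qed simp

lemma smooth_version_sobolev_H:
  fixes u :: "real \<Rightarrow> real^'k" and g :: "nat \<Rightarrow> real \<Rightarrow> real^'k"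
  assumes u: "u \<in> L2" and ug: "AE s in lebesgue_on {0..1}. u s = g 0 s"
    and g: "\<And>n t. t \<in> {0..1} \<Longrightarrow> (g n has_vector_derivative g (Suc n) t) (at t within {0..1})"
  shows "u \<in> sobolev_H m"
proof -
  have gc: "continuous_on {0..1} (g n)" for n
    unfolding continuous_on_eq_continuous_within using has_vector_derivative_continuous[OF g] by blast
  \<comment> \<open>The zeroth entry must be the function \<open>u\<close> itself, with which
    \<open>g 0\<close> agrees only almost everywhere.\<close>
  define G where "G = g(0 := u)"
  have GL: "G j \<in> L2" for j
    unfolding G_def using u continuous_L2[OF gc] by auto
  have "integral\<^sup>L (lebesgue_on {0..1}) (\<lambda>s. (deriv ^^ j) \<phi> s *\<^sub>R u s)
         = (-1) ^ j *\<^sub>R integral\<^sup>L (lebesgue_on {0..1}) (\<lambda>s. \<phi> s *\<^sub>R G j s)"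
    if j: "j \<in> {1..m}" and \<phi>: "test_fun \<phi>" for j \<phi>
  proof -
    have fc: "continuous_on {0..1} ((deriv ^^ i) \<phi>)" for i
      by (rule test_fun_derivative_continuous[OF \<phi>])
    have fm: "(deriv ^^ i) \<phi> \<in> borel_measurable (lebesgue_on {0..1})" for i
      by (intro continuous_imp_measurable_on_sets_lebesgue fc) auto
    have gm: "g n \<in> borel_measurable (lebesgue_on {0..1})" for n
      by (intro continuous_imp_measurable_on_sets_lebesgue gc) auto
    have L: "integral\<^sup>L (lebesgue_on {0..1}) (\<lambda>s. (deriv ^^ i) \<phi> s *\<^sub>R g n s) = integral {0..1} (\<lambda>s. (deriv ^^ i) \<phi> s *\<^sub>R g n s)" for i n
    proof (rule lebesgue_integral_eq_integral)
      have "continuous_on {0..1} (\<lambda>s. (deriv ^^ i) \<phi> s *\<^sub>R g n s)" by (intro continuous_intros fc gc)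
      then show "integrable (lebesgue_on {0..1}) (\<lambda>s. (deriv ^^ i) \<phi> s *\<^sub>R g n s)"
        by (intro absolutely_integrable_imp_integrable absolutely_integrable_continuous_real) auto
    qed simp
    have "integral\<^sup>L (lebesgue_on {0..1}) (\<lambda>s. (deriv ^^ j) \<phi> s *\<^sub>R u s) =
       integral\<^sup>L (lebesgue_on {0..1}) (\<lambda>s. (deriv ^^ j) \<phi> s *\<^sub>R g 0 s)"
      using ug by (intro integral_cong_AE borel_measurable_scaleR fm gm) (use u in \<open>auto simp: L2_iff\<close>)
    also have "\<dots> = (-1) ^ j *\<^sub>R integral {0..1} (\<lambda>s. \<phi> s *\<^sub>R g j s)"
      unfolding L using test_fun_integral_by_parts[OF \<phi>, of g j 0] g by simp
    also have "\<dots> = (-1) ^ j *\<^sub>R integral\<^sup>L (lebesgue_on {0..1}) (\<lambda>s. \<phi> s *\<^sub>R G j s)"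
      using L[of 0 j] j by (simp add: G_def)
    finally show ?thesis .
  qed
  then show ?thesis
    unfolding sobolev_H_def using GL u by (auto intro!: exI[of _ G] simp: G_def)
qed

section \<open>From equality almost everywhere to a classical ODE\<close>

lemma L2norm_eq_0_AE:
  fixes g :: "real \<Rightarrow> real^'k"
  assumes "g \<in> L2" "L2norm g = 0"
  shows "AE s in lebesgue_on {0..1}. g s = 0"
proof -
  have "integral\<^sup>L (lebesgue_on {0..1}) (\<lambda>s. (norm (g s))\<^sup>2) = 0"
    using assms(2) unfolding L2norm_def by simp
  hence "AE s in lebesgue_on {0..1}. (norm (g s))\<^sup>2 = 0"
    using assms(1) by (subst (asm) integral_nonneg_eq_0_iff_AE) (auto simp: L2_def)
  then show ?thesis by simp
qed

lemma AE_lebesgue_on_negligible: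
  assumes "AE s in lebesgue_on {0..1::real}. P s"
  obtains N where "negligible N" "\<And>s. s \<in> {0..1} - N \<Longrightarrow> P s"
proof -
  have "AE s in lebesgue. s \<in> {0..1} \<longrightarrow> P s"
    using assms by (subst (asm) AE_restrict_space_iff) auto
  then obtain N where "{s \<in> space lebesgue. \<not> (s \<in> {0..1} \<longrightarrow> P s)} \<subseteq> N" "N \<in> null_sets lebesgue"
    unfolding eventually_ae_filter by blast
  then show ?thesis using that[of N] by (auto simp: negligible_iff_null_sets)
qed

context control_system begin

text \<open>Changing the control on a negligible set leaves the integral equations intact. With a
  continuous representative their integrands are continuous, so the fundamental theorem gives
  classical derivatives, one-sided at the ends of the interval.\<close>

lemma extremal_ode:
  assumes u: "u \<in> L2" and x: "traj u x" and pc: "continuous_on {0..1} p"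
    and p: "\<And>t. t \<in> {0..1} \<Longrightarrow> p t = p1 + integral {t..1} (\<lambda>s. adj_rhs D (x s) (u s) (p s))"
    and w: "continuous_on {0..1} w" and uw: "AE s in lebesgue_on {0..1}. u s = w s" and t: "t \<in> {0..1}"
  shows "(x has_vector_derivative F (x t) *v w t) (at t within {0..1})"
    and "(p has_vector_derivative - adj_rhs D (x t) (w t) (p t)) (at t within {0..1})"
proof -
  note xc = traj_D(1)[OF x]
  obtain N where N: "negligible N" "\<And>s. s \<in> {0..1} - N \<Longrightarrow> u s = w s"
    using AE_lebesgue_on_negligible[OF uw] by blast
  interpret bounded_bilinear "(*v) :: real^'k^'n \<Rightarrow> _" by (rule bounded_bilinear_matrix_vector_mult)
  have c1: "continuous_on {0..1} (\<lambda>s. F (x s) *v w s)"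
    by (intro continuous_on F_comp_cont xc w)
  have c2: "continuous_on {0..1} (\<lambda>s. adj_rhs D (x s) (w s) (p s))"
    unfolding adj_rhs_def by (intro continuous_intros continuous_on D_comp_cont xc w pc)
  have x': "x r = x0 + integral {0..r} (\<lambda>s. F (x s) *v w s)" if r: "r \<in> {0..1}" for r
    unfolding traj_D(3)[OF x r] using N r by (intro arg_cong2[of _ _ _ _ "(+)"] refl integral_spike[OF N(1)]) auto
  have p': "p r = p 0 - integral {0..r} (\<lambda>s. adj_rhs D (x s) (w s) (p s))" if r: "r \<in> {0..1}" for r
  proof -
    have ai: "(\<lambda>s. adj_rhs D (x s) (u s) (p s)) integrable_on {0..1}"
      using adj_rhs_integrable[OF u xc pc] by (simp add: absolutely_integrable_on_def)
    have "integral {0..r} (\<lambda>s. adj_rhs D (x s) (u s) (p s)) + integral {r..1} (\<lambda>s. adj_rhs D (x s) (u s) (p s))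
        = integral {0..1} (\<lambda>s. adj_rhs D (x s) (u s) (p s))"
      using r by (intro Henstock_Kurzweil_Integration.integral_combine ai) auto
    moreover have "integral {0..r} (\<lambda>s. adj_rhs D (x s) (u s) (p s)) = integral {0..r} (\<lambda>s. adj_rhs D (x s) (w s) (p s))"
      using N r by (intro integral_spike[OF N(1)]) auto
    ultimately show ?thesis using p[OF r] p[of 0] by (simp add: algebra_simps)
  qed
  show "(x has_vector_derivative F (x t) *v w t) (at t within {0..1})"
  proof (rule has_vector_derivative_transform[OF t x'])
    show "((\<lambda>r. x0 + integral {0..r} (\<lambda>s. F (x s) *v w s)) has_vector_derivative F (x t) *v w t) (at t within {0..1})"
      using has_vector_derivative_add[OF has_vector_derivative_const integral_has_vector_derivative[OF c1 t]] by simp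
  qed
  show "(p has_vector_derivative - adj_rhs D (x t) (w t) (p t)) (at t within {0..1})"
  proof (rule has_vector_derivative_transform[OF t p'])
    show "((\<lambda>r. p 0 - integral {0..r} (\<lambda>s. adj_rhs D (x s) (w s) (p s))) has_vector_derivative - adj_rhs D (x t) (w t) (p t)) (at t within {0..1})"
      using has_vector_derivative_diff[OF has_vector_derivative_const integral_has_vector_derivative[OF c2 t]] by simp
  qed
qed

end

section \<open>The theorem\<close>

theorem mainTheorem17:
  fixes F :: "real^'n \<Rightarrow> real^'k^'n" and x0 :: "real^'n" and a :: "real^'n \<Rightarrow> real"
    and \<beta> :: real and U :: "real \<Rightarrow> real \<Rightarrow> real^'k" and u0 u_inf :: "real \<Rightarrow> real^'k"
  assumes Lip: "\<exists>L. \<forall>x y. norm (F x - F y) \<le> L * norm (x - y)"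
    and a_nonneg: "\<forall>x. a x \<ge> 0"
    and F_analytic: "\<forall>i. real_analytic (\<lambda>x. column i (F x))"
    and a_analytic: "real_analytic a"
    and beta_pos: "\<beta> > 0"
    and u0_L2: "u0 \<in> L2"
    and U_L2: "\<forall>t\<ge>0. U t \<in> L2"
    and U_init: "L2norm (\<lambda>s. U 0 s - u0 s) = 0"
    and U_flow: "\<forall>t\<ge>0. \<exists>g. has_L2_gradient (cost F x0 a \<beta>) (U t) g \<and>
                   ((\<lambda>h. L2norm (\<lambda>s. (U (t + h) s - U t s) /\<^sub>R h + g s)) \<longlongrightarrow> 0)
                     (at 0 within {h. t + h \<ge> 0})"
    and lim_L2: "u_inf \<in> L2"
    and lim_pt: "\<exists>tj :: nat \<Rightarrow> real. filterlim tj at_top sequentially \<and>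
                   (\<lambda>j. L2norm (\<lambda>s. U (tj j) s - u_inf s)) \<longlonglongrightarrow> 0"
  shows "has_L2_gradient (cost F x0 a \<beta>) u_inf (\<lambda>s. 0) \<and> (\<forall>m\<ge>1. u_inf \<in> sobolev_H m)"
proof -
  obtain L0 where L0: "\<And>x y. norm (F x - F y) \<le> L0 * norm (x - y)" using Lip by blast
  define L where "L = \<bar>L0\<bar>"
  have L: "norm (F x - F y) \<le> L * norm (x - y)" for x y
    unfolding L_def using order_trans[OF L0 mult_right_mono[OF abs_ge_self norm_ge_zero]] .
  have FA: "real_analytic (\<lambda>x. F x $ r $ j)" for r j
    using real_analytic_component[OF F_analytic[rule_format, of j], of r] by (simp add: column_def)
  \<comment> \<open>Indexing the entries by pairs lets a single choice select the partial
    derivatives of the whole matrix.\<close>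
  have "\<forall>rj. \<exists>d. (\<forall>x. ((\<lambda>x. F x $ fst rj $ snd rj) has_derivative (\<lambda>h. \<Sum>i\<in>UNIV. h $ i * d i x)) (at x)) \<and>
             (\<forall>i. real_analytic (d i))"
    using real_analytic_partials[OF FA] by blast
  from choice[OF this] obtain d where
    d: "\<And>rj x. ((\<lambda>x. F x $ fst rj $ snd rj) has_derivative (\<lambda>h. \<Sum>i\<in>UNIV. h $ i * d rj i x)) (at x)"
    and dA: "\<And>rj i. real_analytic (d rj i)" by blast
  define D where "D i x = (\<chi> r j. d (r, j) i x)" for i x
  have DA: "real_analytic (\<lambda>x. D i x $ r $ j)" for i r j
    unfolding D_def using dA by simp
  have Fder: "((\<lambda>x. F x $ r $ j) has_derivative (\<lambda>h. \<Sum>i\<in>UNIV. h $ i * D i x $ r $ j)) (at x)" for r j x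
    unfolding D_def using d[of "(r, j)" x] by simp
  have Dc: "continuous_on UNIV (D i)" for i
    unfolding D_def by (intro continuous_on_vec_lambda real_analytic_continuous dA)
  interpret control_system F L D x0
  proof
    show "norm (F x - F y) \<le> L * norm (x - y)" for x y by (rule L)
    show "L \<ge> 0" unfolding L_def by simp
    show "continuous_on UNIV (D i)" for i by (rule Dc)
    show "\<exists>\<delta>>0. \<forall>c p q. norm c \<le> R \<longrightarrow> norm (p - c) \<le> \<delta> \<longrightarrow> norm (q - c) \<le> \<delta> \<longrightarrow>
        norm (F p - F q - (\<Sum>i\<in>UNIV. (p - q) $ i *\<^sub>R D i c)) \<le> \<epsilon> * norm (p - q)"
      if "\<epsilon> > 0" for \<epsilon> R :: real
      by (rule strict_derivative_matrix[OF Fder Dc that])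
  qed
  let ?J = "cost F x0 a \<beta>"
  obtain x where x: "traj u_inf x" using traj_exists[OF lim_L2] by blast
  obtain da where da: "\<And>y. (a has_derivative (\<lambda>h. \<Sum>i\<in>UNIV. h $ i * da i y)) (at y)"
    and daA: "\<And>i. real_analytic (da i)" using real_analytic_partials[OF a_analytic] by blast
  \<comment> \<open>The gradient of \<open>a\<close> at the final state; \<beta> is kept out of the
    costate and multiplies it only in \<open>g\<close>.\<close>
  define p1 where "p1 = (\<chi> i. da i (x 1))"
  have a_strict: "\<exists>\<delta>>0. \<forall>y z. norm (y - x 1) \<le> \<delta> \<longrightarrow> norm (z - x 1) \<le> \<delta> \<longrightarrow>
        \<bar>a y - a z - p1 \<bullet> (y - z)\<bar> \<le> \<epsilon> * norm (y - z)" if eps: "\<epsilon> > 0" for \<epsilon>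
  proof -
    have eq: "(\<Sum>i\<in>UNIV. (y - z) $ i * da i (x 1)) = p1 \<bullet> (y - z)" for y z
      by (simp add: p1_def inner_vec_def mult.commute)
    obtain \<delta> where "\<delta> > 0" "\<And>c y z. norm c \<le> norm (x 1) \<Longrightarrow> norm (y - c) \<le> \<delta> \<Longrightarrow> norm (z - c) \<le> \<delta> \<Longrightarrow>
        \<bar>a y - a z - (\<Sum>i\<in>UNIV. (y - z) $ i * da i c)\<bar> \<le> \<epsilon> * norm (y - z)"
      using strict_derivative_real[OF da real_analytic_continuous[OF daA] eps, of "norm (x 1)"] by blast
    from this(1) this(2)[OF order_refl, unfolded eq] show ?thesis by blast
  qed
  obtain p where pc: "continuous_on {0..1} p"
    and p: "\<And>t. t \<in> {0..1} \<Longrightarrow> p t = p1 + integral {t..1} (\<lambda>s. adj_rhs D (x s) (u_inf s) (p s))"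
    using adjoint_exists[OF lim_L2 traj_D(1)[OF x]] by blast
  define g where "g s = u_inf s + \<beta> *\<^sub>R (p s v* F (x s))" for s
  have g: "g \<in> L2"
    unfolding g_def by (rule cost_strict_derivative(1)[OF lim_L2 x pc p a_strict])
  have strict_g: "\<exists>\<delta>>0. \<forall>v w. v \<in> L2 \<longrightarrow> w \<in> L2 \<longrightarrow> L2norm (\<lambda>s. v s - u_inf s) < \<delta> \<longrightarrow> L2norm (\<lambda>s. w s - u_inf s) < \<delta> \<longrightarrow>
      \<bar>?J v - ?J w - L2inner g (\<lambda>s. v s - w s)\<bar> \<le> \<epsilon> * L2norm (\<lambda>s. v s - w s)" if "\<epsilon> > 0" for \<epsilon>
    unfolding g_def
    by (rule cost_strict_derivative(2)[OF lim_L2 x pc], erule p, erule a_strict, rule that)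
  obtain tj where tj: "filterlim tj at_top sequentially" "(\<lambda>j. L2norm (\<lambda>s. U (tj j) s - u_inf s)) \<longlonglongrightarrow> 0"
    using lim_pt by blast
  have g0: "L2norm g = 0"
  proof (rule gradient_flow_limit_point_critical[OF lim_L2 g _ _ _ tj])
    show "U t \<in> L2" if "t \<ge> 0" for t using U_L2 that by blast
    show "\<exists>h. has_L2_gradient ?J (U t) h \<and>
        ((\<lambda>\<eta>. L2norm (\<lambda>s. (U (t + \<eta>) s - U t s) /\<^sub>R \<eta> + h s)) \<longlongrightarrow> 0) (at 0 within {\<eta>. t + \<eta> \<ge> 0})"
      if "t \<ge> 0" for t using U_flow that by blast
  qed (rule strict_g)
  have "has_L2_gradient ?J u_inf (\<lambda>s. 0)"
    unfolding has_L2_gradient_def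
  proof (intro conjI allI impI L2_zero)
    fix \<epsilon> :: real assume "\<epsilon> > 0"
    from strict_g[OF this] obtain \<delta> where \<delta>: "\<delta> > 0"
      and sd: "\<And>v w. v \<in> L2 \<Longrightarrow> w \<in> L2 \<Longrightarrow> L2norm (\<lambda>s. v s - u_inf s) < \<delta> \<Longrightarrow> L2norm (\<lambda>s. w s - u_inf s) < \<delta> \<Longrightarrow>
      \<bar>?J v - ?J w - L2inner g (\<lambda>s. v s - w s)\<bar> \<le> \<epsilon> * L2norm (\<lambda>s. v s - w s)" by blast
    show "\<exists>\<delta>>0. \<forall>v\<in>L2. L2norm v < \<delta> \<longrightarrow>
        \<bar>?J (\<lambda>s. u_inf s + v s) - ?J u_inf - L2inner (\<lambda>s. 0) v\<bar> \<le> \<epsilon> * L2norm v"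
    proof (intro exI[of _ \<delta>] conjI ballI impI \<delta>)
      fix v :: "real \<Rightarrow> real^'k" assume v: "v \<in> L2" and vn: "L2norm v < \<delta>"
      \<comment> \<open>\<open>g\<close> is zero only almost everywhere; pairings do not see the
        difference, so the zero function may serve as the gradient.\<close>
      have "L2inner g v = 0" using L2inner_le[OF g v] g0 by simp
      moreover have "L2inner (\<lambda>s. 0) v = 0" by (simp add: L2inner_def)
      ultimately show "\<bar>?J (\<lambda>s. u_inf s + v s) - ?J u_inf - L2inner (\<lambda>s. 0) v\<bar> \<le> \<epsilon> * L2norm v"
        using sd[OF L2_add[OF lim_L2 v] lim_L2] vn \<delta> by simp
    qed
  qed
  moreover have "u_inf \<in> sobolev_H m" for m
  proof -
    \<comment> \<open>The equation \<open>g = 0\<close> solved for the control: a continuous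
      representative of \<open>u_inf\<close> from which the bootstrap starts.\<close>
    define w where "w s = (- \<beta>) *\<^sub>R (p s v* F (x s))" for s
    have wc: "continuous_on {0..1} w"
      unfolding w_def vector_matrix_mult_def
      by (intro continuous_on_vec_lambda continuous_intros F_comp_cont traj_D(1)[OF x] pc)
    have uw: "AE s in lebesgue_on {0..1}. u_inf s = w s"
      using L2norm_eq_0_AE[OF g g0]
      by eventually_elim (simp add: g_def w_def eq_neg_iff_add_eq_0)
    obtain G where G: "G 0 = w" "\<And>n t. t \<in> {0..1} \<Longrightarrow> (G n has_vector_derivative G (Suc n) t) (at t within {0..1})"
      using extremal_control_smooth[OF FA DA w_def extremal_ode[OF lim_L2 x pc p wc uw]] by blast
    show ?thesis
      by (rule smooth_version_sobolev_H[where g = G, OF lim_L2 _ G(2)]) (simp_all add: uw G(1))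
  qed
  ultimately show ?thesis by blast
qed

end
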